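(* Let $(R,\mathfrak m)$ be a Noetherian local ring of dimension $d\ge 1$, let $J$ be an $\mathfrak m$-primary ideal, let $h\in R$ be integral over $J$, and set $I=(J,h)$. Then \[ e_1(I)-e_1(J)\le \operatorname{red}_J(I)\cdot \lambda\big(R/(J:I)\big)\cdot f_0(J). \]
   Context: $\lambda$ denotes length. For an $\mathfrak m$-primary ideal $K$, the Hilbert coefficients $e_i(K)$ are the integers with $\lambda(R/K^{n+1})=\sum_{i=0}^{d}(-1)^i e_i(K)\binom{n+d-i}{d-i}$ for $n\gg0$. $f_0(K)$ is the multiplicity of the special fiber ring $\bigoplus_{n\ge0}K^n/\mathfrak mK^n$, i.e. $\nu(K^n)=f_0(K)\binom{n+d-1}{d-1}+(\text{lower order terms})$ for $n\gg0$. Since $h$ is integral over $J$, $J$ is a reduction of $I$; the reduction number $\operatorname{red}_J(I)$ is the least $s\ge0$ with $I^{s+1}=JI^s$. $J:I=\{r\in R: rI\subseteq J\}$. *)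

theory Defs
  imports "HOL-Algebra.Ideal_Product" "HOL-Algebra.Ring_Divisibility" "HOL-Library.Landau_Symbols"
begin

primrec ideal_pow :: "('a, 'b) ring_scheme \<Rightarrow> 'a set \<Rightarrow> nat \<Rightarrow> 'a set" where
  "ideal_pow R K 0 = carrier R"
| "ideal_pow R K (Suc n) = ideal_prod R K (ideal_pow R K n)"

definition local_noetherian :: "('a, 'b) ring_scheme \<Rightarrow> 'a set \<Rightarrow> bool" where
  "local_noetherian R m \<longleftrightarrow> cring R \<and> noetherian_ring R \<and> maximalideal m R \<and>
     (\<forall>M. maximalideal M R \<longrightarrow> M = m)"

definition prime_chain :: "('a, 'b) ring_scheme \<Rightarrow> nat \<Rightarrow> bool" where
  "prime_chain R n \<longleftrightarrow> (\<exists>P :: nat \<Rightarrow> 'a set. (\<forall>i\<le>n. primeideal (P i) R) \<and>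
      (\<forall>i<n. P i \<subset> P (Suc i)))"

definition krull_dim_eq :: "('a, 'b) ring_scheme \<Rightarrow> nat \<Rightarrow> bool" where
  "krull_dim_eq R d \<longleftrightarrow> prime_chain R d \<and> \<not> prime_chain R (Suc d)"

definition colength :: "('a, 'b) ring_scheme \<Rightarrow> 'a set \<Rightarrow> nat" where
  "colength R K = (GREATEST n. \<exists>C :: nat \<Rightarrow> 'a set. C 0 = K \<and> C n = carrier R \<and>
      (\<forall>i\<le>n. ideal (C i) R) \<and> (\<forall>i<n. C i \<subset> C (Suc i)))"

definition m_primary :: "('a, 'b) ring_scheme \<Rightarrow> 'a set \<Rightarrow> 'a set \<Rightarrow> bool" where
  "m_primary R m K \<longleftrightarrow> ideal K R \<and> K \<noteq> carrier R \<and>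
     {x \<in> carrier R. \<exists>n. x [^]\<^bsub>R\<^esub> (n::nat) \<in> K} = m"

definition hilbert_coeff :: "('a, 'b) ring_scheme \<Rightarrow> nat \<Rightarrow> 'a set \<Rightarrow> nat \<Rightarrow> int" where
  "hilbert_coeff R d K = (THE e. (\<forall>i>d. e i = 0) \<and>
     (\<forall>\<^sub>F n in sequentially. int (colength R (ideal_pow R K (Suc n))) =
        (\<Sum>i\<le>d. (-1)^i * e i * int ((n + d - i) choose (d - i)))))"

definition mingens :: "('a, 'b) ring_scheme \<Rightarrow> 'a set \<Rightarrow> nat" where
  "mingens R K = (LEAST k. \<exists>S. S \<subseteq> carrier R \<and> finite S \<and> card S = k \<and> genideal R S = K)"

definition fiber_mult :: "('a, 'b) ring_scheme \<Rightarrow> nat \<Rightarrow> 'a set \<Rightarrow> int" where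
  "fiber_mult R d K = (THE f::int.
     (\<lambda>n. real (mingens R (ideal_pow R K n)) - real_of_int f * real ((n + d - 1) choose (d - 1)))
       \<in> O(\<lambda>n. real n powr (real d - 2)))"

definition integral_over :: "('a, 'b) ring_scheme \<Rightarrow> 'a set \<Rightarrow> 'a \<Rightarrow> bool" where
  "integral_over R J h \<longleftrightarrow> (\<exists>k::nat. \<exists>a :: nat \<Rightarrow> 'a. k \<ge> 1 \<and>
     (\<forall>i\<in>{1..k}. a i \<in> ideal_pow R J i) \<and>
     h [^]\<^bsub>R\<^esub> k \<oplus>\<^bsub>R\<^esub> (finsum R (\<lambda>i. a i \<otimes>\<^bsub>R\<^esub> h [^]\<^bsub>R\<^esub> (k - i)) {1..k}) = \<zero>\<^bsub>R\<^esub>)"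

definition red_num :: "('a, 'b) ring_scheme \<Rightarrow> 'a set \<Rightarrow> 'a set \<Rightarrow> nat" where
  "red_num R J I = (LEAST s. ideal_pow R I (Suc s) = ideal_prod R J (ideal_pow R I s))"

definition colon_ideal :: "('a, 'b) ring_scheme \<Rightarrow> 'a set \<Rightarrow> 'a set \<Rightarrow> 'a set" where
  "colon_ideal R J I = {r \<in> carrier R. \<forall>x\<in>I. r \<otimes>\<^bsub>R\<^esub> x \<in> J}"

end

theory Submission
  imports Defs
begin

text \<open>Write \<open>s\<close> for the reduction number. For \<open>n \<ge> s\<close> the module \<open>I\<^sup>n / J\<^sup>n\<close> is filtered
  by the sums \<open>J\<^sup>n + h J\<^bsup>n-1\<^esup> + \<dots> + h\<^sup>i J\<^bsup>n-i\<^esup>\<close> with \<open>i \<le> s\<close>. The \<open>i\<close>-th factor is killed by \<open>J : I\<close>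
  and generated by \<open>\<nu>(J\<^bsup>n-i\<^esup>)\<close> elements, so \<open>\<lambda>(I\<^sup>n / J\<^sup>n)\<close> is at most
  \<open>\<lambda>(R / (J : I)) (\<nu>(J\<^bsup>n-1\<^esup>) + \<dots> + \<nu>(J\<^bsup>n-s\<^esup>))\<close>, which grows like \<open>n\<^bsup>d-1\<^esup>\<close>. Hence
  \<open>e\<^sub>0(I) = e\<^sub>0(J)\<close>, and comparing the coefficients of \<open>n\<^bsup>d-1\<^esup>\<close> gives the inequality.

  The Hilbert polynomials are obtained by working with ideals of \<open>R\<close> only: a graded module over a
  polynomial ring is replaced by a pair of families of ideals \<open>B n \<subseteq> A n\<close> standing for \<open>\<Oplus> A n / B n\<close>, and the
  Hilbert-Serre induction on the number of variables stays within such pairs. The degree is bounded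
  by comparison with an ideal generated by \<open>d\<close> parameters.\<close>

text \<open>The filtration needs only \<open>s\<close> steps for every \<open>n \<ge> s\<close>
  because \<open>I^n = J^(n-s) I^s\<close>, so that powers of \<open>h\<close> beyond
  \<open>h^s\<close> do not occur. In the step that adds \<open>h^(i+1) J^(n-i-1)\<close>, an
  element \<open>q\<close> of \<open>J : I\<close> satisfies \<open>q h \<in> J\<close>: it trades
  one factor \<open>h\<close> for one more factor from \<open>J\<close> and lands in
  \<open>h^i J^(n-i)\<close>. Since \<open>\<nu>(J^(n-j))\<close> has the same leading term for each
  fixed \<open>j\<close>, the \<open>s\<close> summands contribute \<open>s\<close> times
  \<open>f_0(J)\<close>.

  Hilbert-Serre bounds the degree of a Hilbert polynomial by the number of generators, which may
  exceed \<open>d\<close>. The degree has to be cut down, because the definite descriptions behind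
  the coefficients fix a value only if a polynomial of the right degree exists and is unique. Growth
  does this: an ideal \<open>q\<close> generated by \<open>d\<close> parameters satisfies
  \<open>q^M \<subseteq> K\<close> for some \<open>M\<close>, so that
  \<open>\<lambda>(R/K^(n+1))\<close> is \<open>O(n^d)\<close>. The number of generators of
  \<open>J^n\<close> is then \<open>O(n^(d-1))\<close>, being at most
  \<open>\<lambda>(J^n/J^(n+1))\<close>.\<close>

context cring
begin

section \<open>Arithmetic of ideals: sums, multiples and colon ideals\<close>

lemma idealD:
  assumes "ideal A R"
  shows "\<zero> \<in> A" "\<And>a. a \<in> A \<Longrightarrow> a \<in> carrier R"
    "\<And>a b. \<lbrakk>a \<in> A; b \<in> A\<rbrakk> \<Longrightarrow> a \<oplus> b \<in> A" "\<And>a. a \<in> A \<Longrightarrow> \<ominus> a \<in> A"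
    "\<And>a b. \<lbrakk>a \<in> A; b \<in> A\<rbrakk> \<Longrightarrow> a \<ominus> b \<in> A"
    "\<And>a r. \<lbrakk>a \<in> A; r \<in> carrier R\<rbrakk> \<Longrightarrow> r \<otimes> a \<in> A"
    "\<And>a r. \<lbrakk>a \<in> A; r \<in> carrier R\<rbrakk> \<Longrightarrow> a \<otimes> r \<in> A"
proof -
  interpret ideal A R by fact
  show "\<zero> \<in> A" "\<And>a. a \<in> A \<Longrightarrow> a \<in> carrier R"
    "\<And>a b. \<lbrakk>a \<in> A; b \<in> A\<rbrakk> \<Longrightarrow> a \<oplus> b \<in> A" and neg: "\<And>a. a \<in> A \<Longrightarrow> \<ominus> a \<in> A"
    and "\<And>a r. \<lbrakk>a \<in> A; r \<in> carrier R\<rbrakk> \<Longrightarrow> r \<otimes> a \<in> A"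
    "\<And>a r. \<lbrakk>a \<in> A; r \<in> carrier R\<rbrakk> \<Longrightarrow> a \<otimes> r \<in> A"
    by (auto intro: I_l_closed I_r_closed)
  show "\<And>a b. \<lbrakk>a \<in> A; b \<in> A\<rbrakk> \<Longrightarrow> a \<ominus> b \<in> A"
    by (simp add: a_minus_def neg)
qed

lemma ideal_subset: "ideal A R \<Longrightarrow> A \<subseteq> carrier R"
  using idealD(2) by blast

lemma idealI':
  assumes "A \<subseteq> carrier R" "\<zero> \<in> A" "\<And>a b. \<lbrakk>a \<in> A; b \<in> A\<rbrakk> \<Longrightarrow> a \<oplus> b \<in> A"
    "\<And>a r. \<lbrakk>a \<in> A; r \<in> carrier R\<rbrakk> \<Longrightarrow> r \<otimes> a \<in> A"
  shows "ideal A R"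
proof (rule idealI)
  show "ring R" by (rule ring_axioms)
  have "\<ominus> a \<in> A" if "a \<in> A" for a
    using assms(4)[OF that, of "\<ominus> \<one>"] that assms(1) by (auto simp: l_minus)
  then show "subgroup A (add_monoid R)"
    using assms by (auto intro!: add.subgroupI simp flip: a_inv_def)
  fix a x assume "a \<in> A" "x \<in> carrier R"
  then show "x \<otimes> a \<in> A" "a \<otimes> x \<in> A"
    using assms(4) assms(1) by (auto simp: m_comm subset_iff)
qed

abbreviation ideal_sum :: "'a set \<Rightarrow> 'a set \<Rightarrow> 'a set" (infixl \<open>\<boxplus>\<close> 65) where
  "A \<boxplus> B \<equiv> set_add R A B"

lemma sum_memI: "a \<in> A \<Longrightarrow> b \<in> B \<Longrightarrow> a \<oplus> b \<in> A \<boxplus> B"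
  by (auto simp: set_add_def')

lemma sum_memE:
  assumes "z \<in> A \<boxplus> B" obtains a b where "a \<in> A" "b \<in> B" "z = a \<oplus> b"
  using assms by (auto simp: set_add_def')

lemma sum_upper1: "ideal A R \<Longrightarrow> ideal B R \<Longrightarrow> A \<subseteq> A \<boxplus> B"
  using sum_memI[of _ A \<zero> B] idealD(1,2) by (metis r_zero subsetI)

lemma sum_upper2: "ideal A R \<Longrightarrow> ideal B R \<Longrightarrow> B \<subseteq> A \<boxplus> B"
  using sum_memI[of \<zero> A _ B] idealD(1,2) by (metis l_zero subsetI)

lemma sum_least: "ideal D R \<Longrightarrow> A \<subseteq> D \<Longrightarrow> B \<subseteq> D \<Longrightarrow> A \<boxplus> B \<subseteq> D"
  by (auto elim!: sum_memE intro: idealD(3))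

lemma sum_mono: "A \<subseteq> A' \<Longrightarrow> B \<subseteq> B' \<Longrightarrow> A \<boxplus> B \<subseteq> A' \<boxplus> B'"
  by (auto elim!: sum_memE intro!: sum_memI)

abbreviation scale :: "'a \<Rightarrow> 'a set \<Rightarrow> 'a set" where
  "scale x A \<equiv> (\<lambda>a. x \<otimes> a) ` A"

lemma scale_ideal:
  assumes "x \<in> carrier R" "ideal A R"
  shows "ideal (scale x A) R"
proof (rule idealI')
  note [simp] = idealD(2)[OF assms(2)] assms(1)
  show "scale x A \<subseteq> carrier R" by auto
  show "\<zero> \<in> scale x A"
    using idealD(1)[OF assms(2)] by (metis assms(1) image_eqI r_null)
  show "a \<oplus> b \<in> scale x A" if "a \<in> scale x A" "b \<in> scale x A" for a b
    using that idealD(3)[OF assms(2)] by (auto simp flip: r_distr)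
  show "r \<otimes> a \<in> scale x A" if "a \<in> scale x A" "r \<in> carrier R" for a r
    using that idealD(6)[OF assms(2)] by (force simp: m_lcomm)
qed

text \<open>With \<open>S = {x}\<close> this makes "multiplied by \<open>x\<close> into
  \<open>B\<close>" an ideal condition. Several containments of generated ideals and of products
  below rest on it: the condition is checked on generators and passes to all that they
  generate.\<close>

lemma colon_ideal_ideal:
  assumes "ideal B R" "S \<subseteq> carrier R"
  shows "ideal (colon_ideal R B S) R"
proof (rule idealI')
  show "colon_ideal R B S \<subseteq> carrier R" by (auto simp: colon_ideal_def)
  show "\<zero> \<in> colon_ideal R B S"
    using assms idealD(1) by (auto simp: colon_ideal_def subset_iff)
  show "a \<oplus> b \<in> colon_ideal R B S" if "a \<in> colon_ideal R B S" "b \<in> colon_ideal R B S" for a b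
    using that assms idealD(3)[OF assms(1)] by (auto simp: colon_ideal_def l_distr subset_iff)
  show "r \<otimes> a \<in> colon_ideal R B S" if "a \<in> colon_ideal R B S" "r \<in> carrier R" for a r
    using that assms idealD(6)[OF assms(1)] by (auto simp: colon_ideal_def m_assoc subset_iff)
qed

lemma Idl_insert:
  assumes "x \<in> carrier R" "S \<subseteq> carrier R"
  shows "Idl (insert x S) = scale x (carrier R) \<boxplus> Idl S"
proof
  have S: "ideal (Idl S) R" and x: "ideal (scale x (carrier R)) R"
    using assms by (auto intro!: genideal_ideal scale_ideal oneideal)
  have "x \<in> scale x (carrier R)"
    using assms(1) by (metis imageI one_closed r_one)
  then show "Idl (insert x S) \<subseteq> scale x (carrier R) \<boxplus> Idl S"
    using sum_upper1[OF x S] sum_upper2[OF x S] genideal_self[OF assms(2)]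
    by (intro genideal_minimal add_ideals x S) blast+
  have i: "ideal (Idl (insert x S)) R" using assms by (intro genideal_ideal) auto
  have "insert x S \<subseteq> Idl (insert x S)"
    using assms by (intro genideal_self) auto
  then show "scale x (carrier R) \<boxplus> Idl S \<subseteq> Idl (insert x S)"
    using idealD(7)[OF i] by (intro sum_least i genideal_minimal) auto
qed

section \<open>Lengths of subquotients as lengths of ideal chains\<close>

text \<open>The chains behind \<open>colength\<close>, with a free upper end:
  \<open>chain n B A\<close> measures \<open>A/B\<close>, and such chains can be joined, cut and
  mapped by induction.\<close>

inductive chain :: "nat \<Rightarrow> 'a set \<Rightarrow> 'a set \<Rightarrow> bool" where
  chain_0: "ideal A R \<Longrightarrow> chain 0 A A"
| chain_Suc: "ideal B R \<Longrightarrow> B \<subset> D \<Longrightarrow> chain n D A \<Longrightarrow> chain (Suc n) B A"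

text \<open>\<open>GREATEST\<close> says nothing if chain lengths are unbounded, so finiteness is
  tracked apart from the value \<open>len\<close>.\<close>

definition fin_len :: "'a set \<Rightarrow> 'a set \<Rightarrow> bool" where
  "fin_len B A \<longleftrightarrow> (\<exists>N. \<forall>n. chain n B A \<longrightarrow> n \<le> N)"

definition len :: "'a set \<Rightarrow> 'a set \<Rightarrow> nat" where
  "len B A = (GREATEST n. chain n B A)"

lemma chainD: "chain n B A \<Longrightarrow> ideal B R \<and> ideal A R \<and> B \<subseteq> A"
  by (induction rule: chain.induct) auto

lemma chain_trans: "chain n C B \<Longrightarrow> chain p B A \<Longrightarrow> chain (n + p) C A"
  by (induction rule: chain.induct) (auto intro: chain_Suc)

lemma chain_1: "ideal B R \<Longrightarrow> ideal A R \<Longrightarrow> B \<subset> A \<Longrightarrow> chain 1 B A"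
  using chain_Suc[OF _ _ chain_0] by auto

lemma chain_exists: "ideal B R \<Longrightarrow> ideal A R \<Longrightarrow> B \<subseteq> A \<Longrightarrow> \<exists>n. chain n B A"
  using chain_1 chain_0 by (metis psubsetI)

lemma chain_self: "chain n A A \<Longrightarrow> n = 0"
  by (cases rule: chain.cases) (auto dest: chainD)

lemma chain_map:
  assumes "chain n B A"
    and "\<And>D. ideal D R \<Longrightarrow> B \<subseteq> D \<Longrightarrow> D \<subseteq> A \<Longrightarrow> ideal (f D) R"
    and "\<And>D D'. ideal D R \<Longrightarrow> ideal D' R \<Longrightarrow> B \<subseteq> D \<Longrightarrow> D \<subset> D' \<Longrightarrow> D' \<subseteq> A \<Longrightarrow> f D \<subset> f D'"
  shows "chain n (f B) (f A)"
  using assms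
proof (induction rule: chain.induct)
  case (chain_0 A)
  then show ?case by (auto intro: chain.chain_0)
next
  case (chain_Suc B D n A)
  have "chain n (f D) (f A)"
    by (rule chain_Suc.IH) (use chain_Suc in auto)
  then show ?case
    using chain_Suc.prems chain_Suc.hyps chainD[OF chain_Suc.hyps(3)]
    by (intro chain.chain_Suc[of _ "f D"]) auto
qed

text \<open>By the modular law a strict inclusion stays strict after intersecting with \<open>B\<close> or
  after adding \<open>B\<close>; this is what makes lengths additive.\<close>

lemma chain_split:
  assumes "chain n C A" "ideal B R"
  shows "\<exists>p q. n \<le> p + q \<and> chain p (C \<inter> B) (A \<inter> B) \<and> chain q (C \<boxplus> B) (A \<boxplus> B)"
  using assms(1)
proof (induction rule: chain.induct)
  case (chain_0 A)
  have "chain 0 (A \<inter> B) (A \<inter> B)" "chain 0 (A \<boxplus> B) (A \<boxplus> B)"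
    using chain_0 assms(2) by (auto intro!: chain.chain_0 i_intersect add_ideals)
  then show ?case by blast
next
  case (chain_Suc C D n A)
  then obtain p q where pq: "n \<le> p + q" "chain p (D \<inter> B) (A \<inter> B)" "chain q (D \<boxplus> B) (A \<boxplus> B)"
    by blast
  have D: "ideal D R" using chain_Suc chainD by blast
  have C: "ideal (C \<inter> B) R" "ideal (C \<boxplus> B) R"
    using chain_Suc assms(2) by (auto intro!: i_intersect add_ideals)
  have sub: "C \<inter> B \<subseteq> D \<inter> B" "C \<boxplus> B \<subseteq> D \<boxplus> B"
    using chain_Suc sum_mono[of C D B B] by auto
  have "C \<inter> B \<noteq> D \<inter> B \<or> C \<boxplus> B \<noteq> D \<boxplus> B"
  proof (rule ccontr)
    assume "\<not> ?thesis"
    then have eq: "C \<inter> B = D \<inter> B" "C \<boxplus> B = D \<boxplus> B" by auto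
    have "d \<in> C" if "d \<in> D" for d
    proof -
      have "d \<in> C \<boxplus> B" using that eq sum_upper1[OF D assms(2)] by auto
      then obtain c b where cb: "c \<in> C" "b \<in> B" "d = c \<oplus> b" by (rule sum_memE)
      note carr = idealD(2)[OF chain_Suc.hyps(1) cb(1)] idealD(2)[OF assms(2) cb(2)]
      have "b = d \<ominus> c" using carr cb by algebra
      moreover have "c \<in> D" using cb(1) chain_Suc.hyps(2) by blast
      ultimately have "b \<in> D" using idealD(5)[OF D that] by simp
      then have "b \<in> C" using cb eq by auto
      then show ?thesis using cb idealD(3)[OF chain_Suc.hyps(1)] by auto
    qed
    then show False using chain_Suc.hyps by blast
  qed
  then consider "C \<inter> B \<subset> D \<inter> B" | "C \<boxplus> B \<subset> D \<boxplus> B" using sub by blast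
  then show ?case
  proof cases
    case 1
    then have "chain (Suc p) (C \<inter> B) (A \<inter> B)" using pq C chain.chain_Suc by blast
    \<comment> \<open>The other half may become strict in the same step; it is then lengthened too,
      which \<open>n \<le> p + q\<close> allows.\<close>
    moreover obtain q' where "chain q' (C \<boxplus> B) (A \<boxplus> B)" "q \<le> q'"
    proof (cases "C \<boxplus> B = D \<boxplus> B")
      case True then show ?thesis using pq that by auto
    next
      case False
      then have "C \<boxplus> B \<subset> D \<boxplus> B" using sub by auto
      then have "chain (Suc q) (C \<boxplus> B) (A \<boxplus> B)" using pq C chain.chain_Suc by blast
      then show ?thesis using that by auto
    qed
    ultimately show ?thesis using pq(1)
      by (intro exI[of _ "Suc p"] exI[of _ q']) auto
  next
    case 2
    then have "chain (Suc q) (C \<boxplus> B) (A \<boxplus> B)" using pq C chain.chain_Suc by blast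
    moreover obtain p' where "chain p' (C \<inter> B) (A \<inter> B)" "p \<le> p'"
    proof (cases "C \<inter> B = D \<inter> B")
      case True then show ?thesis using pq that by auto
    next
      case False
      then have "C \<inter> B \<subset> D \<inter> B" using sub by auto
      then have "chain (Suc p) (C \<inter> B) (A \<inter> B)" using pq C chain.chain_Suc by blast
      then show ?thesis using that by auto
    qed
    ultimately show ?thesis using pq(1)
      by (intro exI[of _ p'] exI[of _ "Suc q"]) auto
  qed
qed

lemma chain_split':
  assumes "chain n C A" "ideal B R" "C \<subseteq> B" "B \<subseteq> A"
  shows "\<exists>p q. n \<le> p + q \<and> chain p C B \<and> chain q B A"
proof -
  have A: "ideal A R" and C: "ideal C R" using assms(1) chainD by auto
  have "C \<inter> B = C" "A \<inter> B = B" using assms by auto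
  moreover have "C \<boxplus> B = B"
    using sum_upper2[OF C assms(2)] sum_least[OF assms(2,3) subset_refl] by (rule equalityI[rotated])
  moreover have "A \<boxplus> B = A"
    using sum_upper1[OF A assms(2)] sum_least[OF A subset_refl assms(4)] by (rule equalityI[rotated])
  ultimately show ?thesis using chain_split[OF assms(1,2)] by simp
qed

lemma chain_le_len: "fin_len B A \<Longrightarrow> chain n B A \<Longrightarrow> n \<le> len B A"
  unfolding fin_len_def len_def by (metis Greatest_le_nat)

lemma chain_len:
  assumes "ideal B R" "ideal A R" "B \<subseteq> A" "fin_len B A"
  shows "chain (len B A) B A"
  using chain_exists[OF assms(1-3)] assms(4) unfolding fin_len_def len_def by (metis GreatestI_nat)

lemma len_le:
  assumes "ideal B R" "ideal A R" "B \<subseteq> A" "\<And>n. chain n B A \<Longrightarrow> n \<le> N"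
  shows "fin_len B A" "len B A \<le> N"
proof -
  show "fin_len B A" using assms(4) by (auto simp: fin_len_def)
  then show "len B A \<le> N" using assms chain_len by blast
qed

lemma fin_len_sub:
  assumes "fin_len C A" "ideal C R" "ideal B R" "ideal A R" "C \<subseteq> B" "B \<subseteq> A"
  shows "fin_len C B" "fin_len B A"
proof -
  obtain N where N: "\<And>n. chain n C A \<Longrightarrow> n \<le> N" using assms(1) by (auto simp: fin_len_def)
  obtain p q where "chain p C B" "chain q B A"
    using chain_exists assms by metis
  then show "fin_len C B" "fin_len B A"
    unfolding fin_len_def using N chain_trans by (meson add_leE)+
qed

text \<open>Cutting a chain at \<open>B\<close> bounds its length from above, and joining two
  longest chains attains the bound.\<close>

lemma len_add:
  assumes "ideal C R" "ideal B R" "ideal A R" "C \<subseteq> B" "B \<subseteq> A" "fin_len C B" "fin_len B A"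
  shows "len C A = len C B + len B A" "fin_len C A"
proof -
  have CA: "C \<subseteq> A" using assms by auto
  have le: "n \<le> len C B + len B A" if n: "chain n C A" for n
    using chain_split'[OF n assms(2,4,5)] chain_le_len[OF assms(6)] chain_le_len[OF assms(7)]
    by (meson add_mono order_trans)
  show fin: "fin_len C A" by (rule len_le(1)[OF assms(1,3) CA le])
  have "chain (len C B + len B A) C A"
    by (intro chain_trans[of _ _ B] chain_len assms)
  then show "len C A = len C B + len B A"
    using le chain_le_len[OF fin] chain_len[OF assms(1,3) CA fin] by (simp add: antisym)
qed

lemma len_self: "ideal A R \<Longrightarrow> fin_len A A \<and> len A A = 0"
  using len_le[of A A 0] chain_self by auto

lemma len_mono_left:
  assumes "ideal C R" "ideal B R" "ideal A R" "C \<subseteq> B" "B \<subseteq> A" "fin_len C A"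
  shows "len B A \<le> len C A"
  using len_add(1)[OF assms(1-5)] fin_len_sub[OF assms(6,1-5)] by auto

lemma chain_iff_function:
  "chain n K A \<longleftrightarrow> (\<exists>C :: nat \<Rightarrow> 'a set. C 0 = K \<and> C n = A \<and>
      (\<forall>i\<le>n. ideal (C i) R) \<and> (\<forall>i<n. C i \<subset> C (Suc i)))"
proof
  show "chain n K A \<Longrightarrow> \<exists>C :: nat \<Rightarrow> 'a set. C 0 = K \<and> C n = A \<and>
      (\<forall>i\<le>n. ideal (C i) R) \<and> (\<forall>i<n. C i \<subset> C (Suc i))"
  proof (induction rule: chain.induct)
    case (chain_0 A)
    then show ?case by (intro exI[of _ "\<lambda>_. A"]) auto
  next
    case (chain_Suc B D n A)
    then obtain C :: "nat \<Rightarrow> 'a set" where C: "C 0 = D" "C n = A"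
      "\<forall>i\<le>n. ideal (C i) R" "\<forall>i<n. C i \<subset> C (Suc i)" by auto
    show ?case
      using C chain_Suc.hyps
      by (intro exI[of _ "case_nat B C"]) (auto split: nat.splits)
  qed
next
  show "\<exists>C :: nat \<Rightarrow> 'a set. C 0 = K \<and> C n = A \<and>
      (\<forall>i\<le>n. ideal (C i) R) \<and> (\<forall>i<n. C i \<subset> C (Suc i)) \<Longrightarrow> chain n K A"
  proof (induction n arbitrary: K)
    case 0 then show ?case by (auto intro: chain_0)
  next
    case (Suc n)
    then obtain C :: "nat \<Rightarrow> 'a set" where C: "C 0 = K" "C (Suc n) = A"
      "\<forall>i\<le>Suc n. ideal (C i) R" "\<forall>i<Suc n. C i \<subset> C (Suc i)" by auto
    then have "chain n (C 1) A"
      by (intro Suc.IH exI[of _ "\<lambda>i. C (Suc i)"]) auto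
    then show ?case using C by (intro chain_Suc[of K "C 1"]) auto
  qed
qed

lemma colength_eq_len: "colength R K = len K (carrier R)"
  unfolding colength_def len_def chain_iff_function ..

text \<open>Multiplication by \<open>x\<close> identifies \<open>A / (A \<inter> (B : x))\<close> with \<open>(xA + B) / B\<close>.\<close>

lemma len_scale:
  assumes A: "ideal A R" and B: "ideal B R" and x: "x \<in> carrier R"
  defines "K \<equiv> A \<inter> colon_ideal R B {x}"
  shows "chain n K A \<longleftrightarrow> chain n B (scale x A \<boxplus> B)"
proof
  have K: "ideal K R" using assms by (auto simp: K_def intro!: i_intersect colon_ideal_ideal)
  have memK: "a \<in> K \<longleftrightarrow> a \<in> A \<and> a \<otimes> x \<in> B" for a
    using idealD(2)[OF A] by (auto simp: K_def colon_ideal_def)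
  \<comment> \<open>\<open>f\<close> takes images and \<open>g\<close> preimages under
    multiplication by \<open>x\<close> modulo \<open>B\<close>. Each preserves strict inclusions and
    matches the ends, so chains are carried both ways with their length.\<close>
  define f where "f D = scale x D \<boxplus> B" for D
  define g where "g E = A \<inter> colon_ideal R E {x}" for E
  have memg: "a \<in> g E \<longleftrightarrow> a \<in> A \<and> a \<otimes> x \<in> E" for a E
    using idealD(2)[OF A] by (auto simp: g_def colon_ideal_def)
  have fi: "ideal (f D) R" if "ideal D R" for D
    using that assms by (auto simp: f_def intro!: add_ideals scale_ideal)
  have gi: "ideal (g D) R" if "ideal D R" for D
    using that assms by (auto simp: g_def intro!: i_intersect colon_ideal_ideal)
  {
    assume "chain n K A"
    then have "chain n (f K) (f A)"
    proof (rule chain_map)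
      fix D D' assume D: "ideal D R" "ideal D' R" "K \<subseteq> D" "D \<subset> D'" "D' \<subseteq> A"
      then obtain d where d: "d \<in> D'" "d \<notin> D" by auto
      have "f D \<subseteq> f D'" unfolding f_def using D by (intro sum_mono) auto
      moreover have "x \<otimes> d \<in> f D'"
        unfolding f_def
        using sum_upper1[OF scale_ideal[OF x D(2)] B] d by blast
      moreover have "x \<otimes> d \<notin> f D"
      proof
        assume "x \<otimes> d \<in> f D"
        then obtain e b where e: "e \<in> D" "b \<in> B" "x \<otimes> d = x \<otimes> e \<oplus> b"
          unfolding f_def by (auto elim!: sum_memE)
        note carr = x idealD(2)[OF D(1) e(1)] idealD(2)[OF B e(2)] idealD(2)[OF D(2) d(1)]
        have "(d \<ominus> e) \<otimes> x = x \<otimes> d \<ominus> x \<otimes> e" using carr by algebra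
        also have "\<dots> = b" unfolding e(3) using carr by algebra
        finally have "(d \<ominus> e) \<in> K"
          using memK e(2) idealD(5)[OF D(2) d(1), of e] D e(1) by auto
        then have "d \<ominus> e \<oplus> e \<in> D" using D e idealD(3)[OF D(1)] by auto
        moreover have "d \<ominus> e \<oplus> e = d" using carr by algebra
        ultimately show False using d by auto
      qed
      ultimately show "f D \<subset> f D'" by blast
    qed (rule fi)
    moreover have "f K = B"
      unfolding f_def using sum_upper2[OF scale_ideal[OF x K] B] sum_least[OF B, of "scale x K" B]
        memK idealD(2)[OF A] x by (auto simp: m_comm)
    ultimately show "chain n B (scale x A \<boxplus> B)" by (simp add: f_def)
  }
  assume "chain n B (scale x A \<boxplus> B)"
  then have "chain n (g B) (g (scale x A \<boxplus> B))"
  proof (rule chain_map)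
    fix E E' assume E: "ideal E R" "ideal E' R" "B \<subseteq> E" "E \<subset> E'" "E' \<subseteq> scale x A \<boxplus> B"
    then obtain e where e: "e \<in> E'" "e \<notin> E" by auto
    then have "e \<in> scale x A \<boxplus> B" using E by blast
    then obtain a b where ab: "a \<in> A" "b \<in> B" "e = x \<otimes> a \<oplus> b" by (auto elim!: sum_memE)
    note carr = x idealD(2)[OF A ab(1)] idealD(2)[OF B ab(2)]
    have "a \<otimes> x = e \<ominus> b" unfolding ab(3) using carr by algebra
    then have "a \<in> g E'" using memg ab e E idealD(5)[OF E(2)] by auto
    moreover have "a \<notin> g E"
    proof
      assume "a \<in> g E"
      then have "a \<otimes> x \<oplus> b \<in> E" using memg ab E idealD(3)[OF E(1)] by auto
      then show False using e ab carr by (simp add: m_comm)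
    qed
    moreover have "g E \<subseteq> g E'" using memg E by blast
    ultimately show "g E \<subset> g E'" by blast
  qed (rule gi)
  moreover have "g (scale x A \<boxplus> B) = A"
    using memg sum_upper1[OF scale_ideal[OF x A] B] x idealD(2)[OF A] by (auto simp: m_comm)
  ultimately show "chain n K A" by (simp add: g_def K_def)
qed

end

context cring
begin

lemma Idl_ideal: "ideal A R \<Longrightarrow> Idl A = A"
  using genideal_minimal[of A A] genideal_self[OF ideal_subset[of A]] by auto

lemma Idl_mono: "S \<subseteq> T \<Longrightarrow> T \<subseteq> carrier R \<Longrightarrow> Idl S \<subseteq> Idl T"
  using genideal_self by (intro genideal_minimal genideal_ideal) auto

lemma Idl_scale:
  assumes "x \<in> carrier R" "S \<subseteq> carrier R"
  shows "scale x (Idl S) \<subseteq> Idl (scale x S)"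
proof -
  have S: "scale x S \<subseteq> carrier R" using assms by auto
  have i: "ideal (colon_ideal R (Idl (scale x S)) {x}) R"
    using assms S by (intro colon_ideal_ideal genideal_ideal) auto
  have "S \<subseteq> colon_ideal R (Idl (scale x S)) {x}"
    using genideal_self[OF S] assms by (auto simp: colon_ideal_def m_comm subset_iff)
  then have "Idl S \<subseteq> colon_ideal R (Idl (scale x S)) {x}"
    by (rule genideal_minimal[OF i])
  then show ?thesis using assms(1) by (auto simp: colon_ideal_def m_comm)
qed

text \<open>Each generator adds a cyclic module killed by \<open>Q\<close>.\<close>

lemma len_generated_le:
  assumes "finite S" "S \<subseteq> carrier R" "ideal B R" "ideal Q R" "fin_len Q (carrier R)"
    and "\<And>q s. q \<in> Q \<Longrightarrow> s \<in> S \<Longrightarrow> q \<otimes> s \<in> B"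
  shows "fin_len B (Idl (B \<union> S)) \<and> len B (Idl (B \<union> S)) \<le> card S * len Q (carrier R)"
  using assms(1,2,6)
proof (induction S)
  case empty
  then show ?case using len_self[OF assms(3)] Idl_ideal[OF assms(3)] by simp
next
  case (insert x S)
  define B' where "B' = Idl (B \<union> S)"
  have BS: "B \<union> S \<subseteq> carrier R" using insert ideal_subset[OF assms(3)] by auto
  then have B': "ideal B' R" "B \<subseteq> B'"
    using genideal_self[OF BS] by (auto simp: B'_def intro: genideal_ideal)
  define E where "E = scale x (carrier R) \<boxplus> B'"
  have x: "x \<in> carrier R" using insert by auto
  have E_eq: "E = Idl (B \<union> insert x S)"
    using Idl_insert[OF x BS] by (simp add: E_def B'_def)
  have E: "ideal E R" "B' \<subseteq> E"
    unfolding E_def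
    by (rule add_ideals[OF scale_ideal[OF x oneideal] B'(1)])
      (rule sum_upper2[OF scale_ideal[OF x oneideal] B'(1)])
  have K: "ideal (colon_ideal R B' {x}) R" "Q \<subseteq> colon_ideal R B' {x}" "colon_ideal R B' {x} \<subseteq> carrier R"
    using B' x insert.prems idealD(2)[OF assms(4)] colon_ideal_ideal[OF B'(1), of "{x}"]
    by (auto simp: colon_ideal_def)
  have "carrier R \<inter> colon_ideal R B' {x} = colon_ideal R B' {x}" using K by blast
  \<comment> \<open>\<open>E/B'\<close> is cyclic and isomorphic to \<open>R/(B' : x)\<close>, which
    is a quotient of \<open>R/Q\<close> because \<open>Q \<subseteq> B' : x\<close>.\<close>
  then have iff: "chain n (colon_ideal R B' {x}) (carrier R) \<longleftrightarrow> chain n B' E" for n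
    using len_scale[OF oneideal B'(1) x, of n] by (simp add: E_def)
  have le: "n \<le> len Q (carrier R)" if "chain n B' E" for n
    using chain_le_len[OF fin_len_sub(2)[OF assms(5,4) K(1) oneideal K(2,3)]]
      len_mono_left[OF assms(4) K(1) oneideal K(2,3) assms(5)] that iff
    by (meson le_trans)
  have 1: "fin_len B' E" "len B' E \<le> len Q (carrier R)"
    by (rule len_le[OF B'(1) E], erule le)+
  have 2: "fin_len B B'" "len B B' \<le> card S * len Q (carrier R)"
    using insert unfolding B'_def by auto
  show ?case
    using len_add[OF assms(3) B'(1) E(1) B'(2) E(2) 2(1) 1(1)] 1(2) 2 insert.hyps
    unfolding E_eq by simp
qed

section \<open>Products and powers of ideals\<close>

lemma ideal_prod_mono: "A \<subseteq> A' \<Longrightarrow> B \<subseteq> B' \<Longrightarrow> A \<cdot> B \<subseteq> A' \<cdot> B'"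
proof
  fix x assume *: "A \<subseteq> A'" "B \<subseteq> B'" and "x \<in> A \<cdot> B"
  from this(3) show "x \<in> A' \<cdot> B'"
    by (induction rule: ideal_prod.induct) (use * in \<open>auto intro: ideal_prod.intros\<close>)
qed

lemma ideal_prod_least:
  assumes "ideal D R" "\<And>a b. a \<in> A \<Longrightarrow> b \<in> B \<Longrightarrow> a \<otimes> b \<in> D"
  shows "A \<cdot> B \<subseteq> D"
proof
  fix x assume "x \<in> A \<cdot> B"
  then show "x \<in> D"
    by (induction rule: ideal_prod.induct) (use assms idealD(3) in auto)
qed

lemma pow_ideal: "ideal K R \<Longrightarrow> ideal (ideal_pow R K n) R"
  by (induction n) (auto intro: oneideal ideal_prod_is_ideal)

lemma pow_add:
  assumes "ideal K R"
  shows "ideal_pow R K (a + b) = ideal_pow R K a \<cdot> ideal_pow R K b"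
proof (induction a)
  case 0
  then show ?case
    using ideal_prod_one[OF pow_ideal[OF assms]] ideal_prod_commute[OF oneideal pow_ideal[OF assms]]
    by simp
next
  case (Suc a)
  then show ?case using ideal_prod_assoc[OF assms pow_ideal[OF assms] pow_ideal[OF assms]] by simp
qed

lemma pow_Suc_subset: "ideal K R \<Longrightarrow> ideal_pow R K (Suc n) \<subseteq> ideal_pow R K n"
  using ideal_prod_inter[OF _ pow_ideal, of K K n] by auto

lemma pow_antimono: "ideal K R \<Longrightarrow> a \<le> b \<Longrightarrow> ideal_pow R K b \<subseteq> ideal_pow R K a"
  using lift_Suc_antimono_le[of "ideal_pow R K"] pow_Suc_subset by blast

lemma pow_mono: "K \<subseteq> L \<Longrightarrow> ideal_pow R K n \<subseteq> ideal_pow R L n"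
  by (induction n) (simp_all add: ideal_prod_mono)

lemma pow_pow_subset:
  assumes "ideal q R" "ideal K R" "ideal_pow R q N \<subseteq> K"
  shows "ideal_pow R q (N * n) \<subseteq> ideal_pow R K n"
proof (induction n)
  case 0 then show ?case by simp
next
  case (Suc n)
  then show ?case using pow_add[OF assms(1), of N "N * n"] ideal_prod_mono[OF assms(3) Suc]
    by simp
qed

lemma elt_pow_mem: "ideal K R \<Longrightarrow> x \<in> K \<Longrightarrow> x [^] (n::nat) \<in> ideal_pow R K n"
proof (induction n)
  case (Suc n)
  then show ?case using ideal_prod.prod[of x K "x [^] n" "ideal_pow R K n" R] idealD(2)
    by (simp add: m_comm)
qed simp

section \<open>Prime ideals and prime avoidance\<close>

lemma prime_prod_subset:
  assumes "primeideal Q R" "A \<cdot> B \<subseteq> Q" "A \<subseteq> carrier R" "B \<subseteq> carrier R"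
  shows "A \<subseteq> Q \<or> B \<subseteq> Q"
proof (rule ccontr)
  assume "\<not> ?thesis"
  then obtain a b where ab: "a \<in> A" "b \<in> B" "a \<notin> Q" "b \<notin> Q" by auto
  then have "a \<otimes> b \<in> Q" using assms(2) ideal_prod.prod[of a A b B R] by auto
  then show False using primeideal.I_prime[OF assms(1), of a b] ab assms(3,4) by auto
qed

lemma foldr_prod_ideal:
  "(\<And>P. P \<in> set Ps \<Longrightarrow> ideal P R) \<Longrightarrow> ideal D R \<Longrightarrow> ideal (foldr (\<cdot>) Ps D) R"
  by (induction Ps) (auto intro: ideal_prod_is_ideal)

lemma foldr_prod_subset:
  "(\<And>P. P \<in> set Ps \<Longrightarrow> ideal P R) \<Longrightarrow> ideal D R \<Longrightarrow>
    foldr (\<cdot>) Ps D \<subseteq> foldr (\<cdot>) Ps (carrier R) \<cdot> D"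
proof (induction Ps)
  case Nil
  then show ?case 
    using ideal_prod_one[of D] ideal_prod_commute[OF oneideal, of D] by simp
next
  case (Cons P Ps)
  then show ?case
    using ideal_prod_assoc[of P "foldr (\<cdot>) Ps (carrier R)" D] foldr_prod_ideal[OF _ oneideal, of Ps]
    by (simp add: ideal_prod_mono)
qed

lemma prime_foldr_prod_subset:
  assumes "primeideal Q R"
  shows "(\<And>P. P \<in> set Ps \<Longrightarrow> ideal P R) \<Longrightarrow> foldr (\<cdot>) Ps (carrier R) \<subseteq> Q \<Longrightarrow>
    \<exists>P\<in>set Ps. P \<subseteq> Q"
proof (induction Ps)
  case Nil
  then show ?case
    using primeideal.I_notcarr[OF assms] ideal_subset[OF primeideal.axioms(1)[OF assms]] by auto
next
  case (Cons P Ps)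
  have "P \<subseteq> Q \<or> foldr (\<cdot>) Ps (carrier R) \<subseteq> Q"
    using Cons.prems foldr_prod_ideal[OF _ oneideal, of Ps]
    by (intro prime_prod_subset[OF assms] ideal_subset) auto
  then show ?case using Cons by auto
qed

lemma not_prime_witness:
  assumes "ideal A R" "A \<noteq> carrier R" "\<not> primeideal A R"
  obtains a b where "a \<in> carrier R" "b \<in> carrier R" "a \<notin> A" "b \<notin> A" "a \<otimes> b \<in> A"
proof -
  have "\<not> (\<forall>a b. a \<in> carrier R \<longrightarrow> b \<in> carrier R \<longrightarrow> a \<otimes> b \<in> A \<longrightarrow> a \<in> A \<or> b \<in> A)"
  proof
    assume "\<forall>a b. a \<in> carrier R \<longrightarrow> b \<in> carrier R \<longrightarrow> a \<otimes> b \<in> A \<longrightarrow> a \<in> A \<or> b \<in> A"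
    then have "primeideal A R"
      using assms by (intro primeidealI is_cring) auto
    then show False using assms by auto
  qed
  then show ?thesis using that by blast
qed

lemma prod_Idl_insert_subset:
  assumes "ideal A R" "a \<in> carrier R" "b \<in> carrier R" "a \<otimes> b \<in> A"
  shows "(Idl (insert a A)) \<cdot> (Idl (insert b A)) \<subseteq> A"
proof (rule ideal_prod_least[OF assms(1)])
  have eq: "Idl (insert c A) = scale c (carrier R) \<boxplus> A" if "c \<in> carrier R" for c
    using Idl_insert[OF that ideal_subset[OF assms(1)]] Idl_ideal[OF assms(1)] by simp
  fix x y assume "x \<in> Idl (insert a A)" "y \<in> Idl (insert b A)"
  then obtain r s u v where *: "r \<in> carrier R" "s \<in> carrier R" "u \<in> A" "v \<in> A"
    "x = a \<otimes> r \<oplus> u" "y = b \<otimes> s \<oplus> v"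
    unfolding eq[OF assms(2)] eq[OF assms(3)] by (auto elim!: sum_memE)
  note carr = assms(2,3) * (1,2) idealD(2)[OF assms(1) *(3)] idealD(2)[OF assms(1) *(4)]
  have "x \<otimes> y = (r \<otimes> s) \<otimes> (a \<otimes> b) \<oplus> (a \<otimes> r) \<otimes> v \<oplus> y \<otimes> u"
    unfolding *(5,6) using carr by algebra
  moreover have "y \<in> carrier R" using * carr by auto
  ultimately show "x \<otimes> y \<in> A"
    using carr idealD(3)[OF assms(1)] idealD(6)[OF assms(1)] * assms(4) by auto
qed

text \<open>Choose an element outside \<open>P\<close> from each ideal. The product of these lies in
  all the ideals, and outside \<open>P\<close> by primality.\<close>

lemma ideals_not_in_prime_witness:
  assumes "primeideal P R" "finite F" "\<And>A. A \<in> F \<Longrightarrow> ideal A R \<and> \<not> A \<subseteq> P"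
  shows "\<exists>z\<in>carrier R. z \<notin> P \<and> (\<forall>A\<in>F. z \<in> A)"
  using assms(2,3)
proof (induction F)
  case empty
  interpret P: primeideal P R by fact
  show ?case using P.I_notcarr P.a_subset by blast
next
  case (insert A F)
  then obtain z where z: "z \<in> carrier R" "z \<notin> P" "\<forall>A\<in>F. z \<in> A" by auto
  obtain a where a: "a \<in> A" "a \<notin> P" and A: "ideal A R" using insert by blast
  have "a \<otimes> z \<notin> P"
    using primeideal.I_prime[OF assms(1)] a z idealD(2)[OF A] by blast
  moreover have "a \<otimes> z \<in> B" if "B \<in> F" for B
    using insert.prems[of B] that z idealD(6)[of B z a] idealD(2)[OF A a(1)] by blast
  moreover have "a \<otimes> z \<in> A" using idealD(7)[OF A a(1) z(1)] .
  ultimately show ?case using z idealD(2)[OF A a(1)] by (intro bexI[of _ "a \<otimes> z"]) auto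
qed

text \<open>Induction on the number of primes. The prime split off is minimal in \<open>F\<close>,
  so neither \<open>A\<close> nor any of the other primes lies in it; this is what provides the
  correction term \<open>z\<close>.\<close>

lemma prime_avoidance:
  assumes "ideal A R" "finite F" "\<And>P. P \<in> F \<Longrightarrow> primeideal P R \<and> \<not> A \<subseteq> P"
  shows "\<exists>x\<in>A. \<forall>P\<in>F. x \<notin> P"
  using assms(2,3)
proof (induction "card F" arbitrary: F)
  case 0
  then show ?case using idealD(1)[OF assms(1)] by auto
next
  case (Suc n)
  then have "F \<noteq> {}" by auto
  then obtain P where P: "P \<in> F" "\<And>Q. Q \<in> F \<Longrightarrow> Q \<subseteq> P \<Longrightarrow> Q = P"
    using finite_has_minimal[OF Suc.prems(1)] by metis
  have prime: "primeideal P R" using P Suc by auto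
  define F' where "F' = F - {P}"
  have "card F' = n" "finite F'" using Suc.hyps(2) Suc.prems(1) P(1) by (auto simp: F'_def)
  then obtain y where y: "y \<in> A" "\<forall>Q\<in>F'. y \<notin> Q"
    using Suc.hyps(1)[of F'] Suc.prems(2) by (auto simp: F'_def)
  have id: "ideal Q R" if "Q \<in> F" for Q using that Suc.prems(2) primeideal.axioms(1) by blast
  show ?case
  proof (cases "y \<in> P")
    case False
    then show ?thesis using y by (auto simp: F'_def)
  next
    case True
    have "\<exists>z\<in>carrier R. z \<notin> P \<and> (\<forall>B\<in>insert A F'. z \<in> B)"
      using Suc.prems P assms(1) id \<open>finite F'\<close>
      by (intro ideals_not_in_prime_witness[OF prime]) (auto simp: F'_def)
    then obtain z where z: "z \<in> carrier R" "z \<notin> P" "z \<in> A" "\<forall>B\<in>F'. z \<in> B" by auto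
    have yc: "y \<in> carrier R" using y idealD(2)[OF assms(1)] by auto
    \<comment> \<open>\<open>y\<close> lies in \<open>P\<close> and in no other prime of
      \<open>F\<close>, while \<open>z\<close> lies in all of them except \<open>P\<close>; in each
      prime exactly one summand is missing.\<close>
    have "y \<oplus> z \<notin> Q" if "Q \<in> F" for Q
    proof
      assume s: "y \<oplus> z \<in> Q"
      have "z = y \<oplus> z \<ominus> y" "y = y \<oplus> z \<ominus> z" using z(1) yc by algebra+
      then show False
        using idealD(5)[OF id[OF that] s, of y] idealD(5)[OF id[OF that] s, of z] y z True that
        by (cases "Q = P") (auto simp: F'_def)
    qed
    moreover have "y \<oplus> z \<in> A" using y z idealD(3)[OF assms(1)] by auto
    ultimately show ?thesis by auto
  qed
qed

end

section \<open>Primes and parameters in Noetherian local rings\<close>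

locale noetherian_cring = cring R + noetherian_ring R for R (structure)
begin

lemma no_infinite_ascent:
  assumes "\<And>n :: nat. ideal (f n) R" "\<And>n. f n \<subset> f (Suc n)"
  shows False
proof -
  have mono: "f m \<subseteq> f n" if "m \<le> n" for m n
    using lift_Suc_mono_le[of f, OF _ that] assms(2) by blast
  have "subset.chain {I. ideal I R} (range f)"
    unfolding subset_chain_def
  proof (intro conjI ballI)
    fix A B assume "A \<in> range f" "B \<in> range f"
    then obtain i j where "A = f i" "B = f j" by auto
    then show "A \<subseteq> B \<or> B \<subseteq> A" using mono[of i j] mono[of j i] by (cases "i \<le> j") auto
  qed (use assms(1) in auto)
  then have "\<Union>(range f) \<in> range f"
    by (intro ideal_chain_is_trivial) auto
  then obtain n where "\<Union>(range f) = f n" by auto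
  then show False using assms(2)[of n] by blast
qed

lemma noetherian_induct [consumes 1, case_names step]:
  assumes "ideal A R"
    and "\<And>A. ideal A R \<Longrightarrow> (\<And>B. ideal B R \<Longrightarrow> A \<subset> B \<Longrightarrow> P B) \<Longrightarrow> P A"
  shows "P A"
proof -
  have "wf {(B, A). ideal A R \<and> ideal B R \<and> A \<subset> B}"
    unfolding wf_iff_no_infinite_down_chain
  proof
    assume "\<exists>f. \<forall>i :: nat. (f (Suc i), f i) \<in> {(B, A). ideal A R \<and> ideal B R \<and> A \<subset> B}"
    then obtain f :: "nat \<Rightarrow> 'a set" where "\<forall>i. (f (Suc i), f i) \<in> {(B, A). ideal A R \<and> ideal B R \<and> A \<subset> B}"
      by blast
    then show False by (intro no_infinite_ascent[of f]) auto
  qed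
  then show ?thesis using assms(1)
  proof (induction A rule: wf_induct_rule)
    case (less A)
    show ?case by (rule assms(2)) (use less in auto)
  qed
qed

lemma ascending_stable:
  assumes "\<And>n :: nat. ideal (f n) R" "\<And>n. f n \<subseteq> f (Suc n)"
  shows "\<exists>N. \<forall>n\<ge>N. f n = f N" "ideal (\<Union>(range f)) R"
proof -
  have mono: "f m \<subseteq> f n" if "m \<le> n" for m n
    using lift_Suc_mono_le[of f, OF _ that] assms(2) by blast
  have "subset.chain {I. ideal I R} (range f)"
    unfolding subset_chain_def
  proof (intro conjI ballI)
    fix A B assume "A \<in> range f" "B \<in> range f"
    then obtain i j where "A = f i" "B = f j" by auto
    then show "A \<subseteq> B \<or> B \<subseteq> A" using mono[of i j] mono[of j i] by (cases "i \<le> j") auto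
  qed (use assms(1) in auto)
  then have "\<Union>(range f) \<in> range f"
    by (intro ideal_chain_is_trivial) auto
  then obtain N where "\<Union>(range f) = f N" by auto
  then show "\<exists>N. \<forall>n\<ge>N. f n = f N" "ideal (\<Union>(range f)) R"
    using mono assms(1) by (auto intro!: exI[of _ N])
qed

text \<open>Noetherian induction: if \<open>ab \<in> A\<close> with \<open>a\<close> and
  \<open>b\<close> outside \<open>A\<close>, then \<open>A + (a)\<close> and \<open>A + (b)\<close>
  are larger and their product lies in \<open>A\<close>. The list, with repetitions, takes the place
  of the finitely many minimal primes: every prime over \<open>A\<close> contains one of its
  members.\<close>

lemma prime_product:
  assumes "ideal A R"
  shows "\<exists>Ps. (\<forall>P\<in>set Ps. primeideal P R \<and> A \<subseteq> P) \<and> foldr (\<cdot>) Ps (carrier R) \<subseteq> A"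
  using assms
proof (induction A rule: noetherian_induct)
  case (step A)
  consider "A = carrier R" | "primeideal A R" | "A \<noteq> carrier R" "\<not> primeideal A R" by auto
  then show ?case
  proof cases
    case 1
    then show ?thesis by (intro exI[of _ "[]"]) auto
  next
    case 2
    then show ?thesis using ideal_prod_one[OF step(1)] by (intro exI[of _ "[A]"]) auto
  next
    case 3
    then obtain a b where ab: "a \<in> carrier R" "b \<in> carrier R" "a \<notin> A" "b \<notin> A" "a \<otimes> b \<in> A"
      using not_prime_witness[OF step(1)] by blast
    have *: "ideal (Idl (insert c A)) R" "A \<subset> Idl (insert c A)" if "c \<in> carrier R" "c \<notin> A" for c
      using genideal_self[of "insert c A"] that ideal_subset[OF step(1)]
      by (auto intro!: genideal_ideal)
    obtain Ps where Ps: "\<forall>P\<in>set Ps. primeideal P R \<and> Idl (insert a A) \<subseteq> P"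
      "foldr (\<cdot>) Ps (carrier R) \<subseteq> Idl (insert a A)"
      using step(2)[of "Idl (insert a A)"] * ab by blast
    obtain Qs where Qs: "\<forall>P\<in>set Qs. primeideal P R \<and> Idl (insert b A) \<subseteq> P"
      "foldr (\<cdot>) Qs (carrier R) \<subseteq> Idl (insert b A)"
      using step(2)[of "Idl (insert b A)"] * ab by blast
    have "foldr (\<cdot>) Ps (foldr (\<cdot>) Qs (carrier R)) \<subseteq>
        foldr (\<cdot>) Ps (carrier R) \<cdot> foldr (\<cdot>) Qs (carrier R)"
      using Ps Qs by (intro foldr_prod_subset foldr_prod_ideal oneideal) (auto intro: primeideal.axioms(1))
    also have "\<dots> \<subseteq> (Idl (insert a A)) \<cdot> (Idl (insert b A))"
      using Ps Qs by (intro ideal_prod_mono)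
    also have "\<dots> \<subseteq> A" using ab step(1) by (intro prod_Idl_insert_subset)
    finally have "foldr (\<cdot>) (Ps @ Qs) (carrier R) \<subseteq> A" by simp
    moreover have "A \<subseteq> Idl (insert a A)" "A \<subseteq> Idl (insert b A)" using *(2) ab by blast+
    then have "\<forall>P\<in>set (Ps @ Qs). primeideal P R \<and> A \<subseteq> P"
      using Ps(1) Qs(1) by (metis Un_iff order_trans set_append)
    ultimately show ?thesis by blast
  qed
qed

text \<open>All factors of the product from \<open>prime_product\<close> equal \<open>m\<close>, so
  it is a power of \<open>m\<close> whose exponent is the length of the list.\<close>

lemma pow_subset_of_unique_prime:
  assumes "ideal A R" "\<And>P. primeideal P R \<Longrightarrow> A \<subseteq> P \<Longrightarrow> P = m"
  obtains N where "ideal_pow R m N \<subseteq> A"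
proof -
  obtain Ps where Ps: "\<forall>P\<in>set Ps. primeideal P R \<and> A \<subseteq> P" "foldr (\<cdot>) Ps (carrier R) \<subseteq> A"
    using prime_product[OF assms(1)] by blast
  have "\<forall>P\<in>set Ps. P = m" using Ps assms(2) by auto
  then have "foldr (\<cdot>) Ps (carrier R) = ideal_pow R m (length Ps)"
    by (induction Ps) auto
  then show ?thesis using that Ps by auto
qed

end

section \<open>Local rings: Nakayama, finite length and parameters\<close>

locale noetherian_local_ring = noetherian_cring R for R (structure) +
  fixes m :: "'a set"
  assumes max_m: "maximalideal m R" and unique_m: "\<And>M. maximalideal M R \<Longrightarrow> M = m"
begin

lemma ideal_m: "ideal m R"
  using max_m maximalideal.axioms(1) by auto

lemma m_proper: "m \<noteq> carrier R"
  using maximalideal.I_notcarr[OF max_m] by auto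

lemma prime_m: "primeideal m R"
  using maximalideal_prime[OF max_m] .

lemma proper_subset_m: "ideal A R \<Longrightarrow> A \<noteq> carrier R \<Longrightarrow> A \<subseteq> m"
proof (induction A rule: noetherian_induct)
  case (step A)
  show ?case
  proof (cases "maximalideal A R")
    case True
    then show ?thesis using unique_m by auto
  next
    case False
    then obtain J where "ideal J R" "A \<subseteq> J" "J \<noteq> A" "J \<noteq> carrier R"
      using maximalidealI[OF step(1)] step(3) by metis
    then show ?thesis using step(2)[of J] by blast
  qed
qed

lemma prime_subset_m: "primeideal P R \<Longrightarrow> P \<subseteq> m"
  using primeideal.I_notcarr primeideal.axioms(1) by (metis proper_subset_m)

lemma unit_of_notin_m:
  assumes "x \<in> carrier R" "x \<notin> m"
  obtains y where "y \<in> carrier R" "y \<otimes> x = \<one>"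
proof -
  have "scale x (carrier R) = carrier R"
    using proper_subset_m[OF scale_ideal[OF assms(1) oneideal]] assms
    by (metis image_subset_iff one_closed r_one)
  then have "\<one> \<in> scale x (carrier R)" by simp
  then show ?thesis using that assms(1) m_comm by fastforce
qed

lemma one_notin_m: "\<one> \<notin> m"
  using ideal.one_imp_carrier[OF ideal_m] m_proper by blast

text \<open>If \<open>K \<noteq> N\<close>, an ideal \<open>N'\<close> maximal with
  \<open>N \<subseteq> N' \<subset> K\<close> makes \<open>K/N'\<close> cyclic. For a generator
  \<open>k\<close> the hypothesis then gives a single equation \<open>k = ka + n\<close> with
  \<open>a \<in> m\<close> and \<open>n \<in> N'\<close>, and \<open>1 - a\<close> is a unit, so
  \<open>k \<in> N'\<close>.\<close>

lemma nakayama: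
  assumes "ideal N R" "ideal K R" "N \<subseteq> K" "K \<subseteq> Idl (N \<union> m \<cdot> K)"
  shows "K = N"
proof (rule ccontr)
  assume neq: "K \<noteq> N"
  have "\<exists>N'. ideal N' R \<and> N \<subseteq> N' \<and> N' \<subset> K \<and> (\<forall>B. ideal B R \<longrightarrow> N' \<subset> B \<longrightarrow> B \<subseteq> K \<longrightarrow> B = K)"
    using assms(1,3) neq
  proof (induction N rule: noetherian_induct)
    case (step N)
    show ?case
    proof (cases "\<exists>B. ideal B R \<and> N \<subset> B \<and> B \<subset> K")
      case True
      then obtain B where B: "ideal B R" "N \<subset> B" "B \<subset> K" by auto
      have "B \<subseteq> K" "K \<noteq> B" using B(3) by auto
      then obtain N' where N': "ideal N' R" "B \<subseteq> N'" "N' \<subset> K"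
        "\<forall>B. ideal B R \<longrightarrow> N' \<subset> B \<longrightarrow> B \<subseteq> K \<longrightarrow> B = K"
        using step(2)[OF B(1,2)] by metis
      moreover have "N \<subseteq> N'" using B(2) N'(2) by order
      ultimately show ?thesis by metis
    next
      case False
      then have "\<forall>B. ideal B R \<longrightarrow> N \<subset> B \<longrightarrow> B \<subseteq> K \<longrightarrow> B = K" by (metis psubsetI)
      moreover have "N \<subset> K" using step(3,4) by auto
      ultimately show ?thesis using step(1) by (metis subset_refl)
    qed
  qed
  then obtain N' where N': "ideal N' R" "N \<subseteq> N'" "N' \<subset> K"
    "\<And>B. ideal B R \<Longrightarrow> N' \<subset> B \<Longrightarrow> B \<subseteq> K \<Longrightarrow> B = K" by metis
  then obtain k where k: "k \<in> K" "k \<notin> N'" by auto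
  have kc: "k \<in> carrier R" using k idealD(2)[OF assms(2)] by auto
  have sub: "insert k N' \<subseteq> carrier R" using kc ideal_subset[OF N'(1)] by auto
  have ki: "Idl (insert k N') = K"
  proof (rule N'(4)[OF genideal_ideal[OF sub]])
    show "N' \<subset> Idl (insert k N')" using genideal_self[OF sub] k by auto
    show "Idl (insert k N') \<subseteq> K" using k N'(3) by (intro genideal_minimal assms(2)) auto
  qed
  have ks: "K = scale k (carrier R) \<boxplus> N'"
    using Idl_insert[OF kc ideal_subset[OF N'(1)]] Idl_ideal[OF N'(1)] ki by simp
  define E where "E = scale k m \<boxplus> N'"
  have E: "ideal E R" "N' \<subseteq> E" unfolding E_def
    by (rule add_ideals[OF scale_ideal[OF kc ideal_m] N'(1)])
      (rule sum_upper2[OF scale_ideal[OF kc ideal_m] N'(1)])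
  have "m \<cdot> K \<subseteq> E"
  proof (rule ideal_prod_least[OF E(1)])
    fix a b assume ab: "a \<in> m" "b \<in> K"
    then obtain r n where rn: "r \<in> carrier R" "n \<in> N'" "b = k \<otimes> r \<oplus> n"
      unfolding ks by (auto elim!: sum_memE)
    note carr = rn(1) kc idealD(2)[OF N'(1) rn(2)] idealD(2)[OF ideal_m ab(1)]
    have "a \<otimes> b = k \<otimes> (a \<otimes> r) \<oplus> a \<otimes> n" unfolding rn(3) using carr by algebra
    then show "a \<otimes> b \<in> E"
      unfolding E_def using idealD(6)[OF N'(1) rn(2)] idealD(7)[OF ideal_m ab(1) rn(1)] carr(4)
      by (simp add: sum_memI)
  qed
  then have "Idl (N \<union> m \<cdot> K) \<subseteq> E"
    using E(2) N'(2) by (intro genideal_minimal E(1)) auto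
  then have "k \<in> E" using k assms(4) by auto
  then obtain a n where an: "a \<in> m" "n \<in> N'" "k = k \<otimes> a \<oplus> n" unfolding E_def by (auto elim!: sum_memE)
  note carr = kc idealD(2)[OF N'(1) an(2)] idealD(2)[OF ideal_m an(1)]
  have "\<one> \<ominus> a \<notin> m"
  proof
    assume "\<one> \<ominus> a \<in> m"
    then have "\<one> \<ominus> a \<oplus> a \<in> m" using an idealD(3)[OF ideal_m] by auto
    moreover have "\<one> \<ominus> a \<oplus> a = \<one>" using carr by algebra
    ultimately show False using one_notin_m by auto
  qed
  then obtain u where u: "u \<in> carrier R" "u \<otimes> (\<one> \<ominus> a) = \<one>"
    using unit_of_notin_m[of "\<one> \<ominus> a"] carr by auto
  have "n = k \<otimes> a \<oplus> n \<ominus> k \<otimes> a" using carr by algebra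
  then have "n = k \<ominus> k \<otimes> a" using an(3) by simp
  then have "u \<otimes> n = (u \<otimes> (\<one> \<ominus> a)) \<otimes> k" using carr u(1) by algebra
  then have "k = u \<otimes> n" using u carr by simp
  then show False using k idealD(6)[OF N'(1) an(2) u(1)] by simp
qed

lemma fin_len_m: "fin_len m (carrier R)" "len m (carrier R) \<le> 1"
proof -
  have "n \<le> 1" if "chain n m (carrier R)" for n
    using that
  proof (cases rule: chain.cases)
    case (chain_Suc D k)
    then have "D = carrier R"
      using maximalideal.I_maximal[OF max_m, of D] chainD[OF chain_Suc(4)] by auto
    then show ?thesis using chain_self chain_Suc by auto
  qed auto
  then show "fin_len m (carrier R)" "len m (carrier R) \<le> 1"
    using len_le[OF ideal_m oneideal ideal_subset[OF ideal_m]] by blast+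
qed

text \<open>Each \<open>m^n/m^(n+1)\<close> is generated by finitely many elements killed by
  \<open>m\<close>, so \<open>len_generated_le\<close> applies with \<open>Q = m\<close>.\<close>

lemma fin_len_pow_m: "fin_len (ideal_pow R m n) (carrier R)"
proof (induction n)
  case 0
  then show ?case using len_self[OF oneideal] by simp
next
  case (Suc n)
  let ?A = "ideal_pow R m n" and ?B = "ideal_pow R m (Suc n)"
  have AB: "ideal ?A R" "ideal ?B R" "?B \<subseteq> ?A"
    using pow_ideal[OF ideal_m] pow_Suc_subset[OF ideal_m] by blast+
  obtain S where S: "S \<subseteq> carrier R" "finite S" "?A = Idl S" using finetely_gen[OF AB(1)] by auto
  have SA: "S \<subseteq> ?A" using genideal_self[OF S(1)] S by auto
  have fin: "fin_len ?B (Idl (?B \<union> S))"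
  proof (rule len_generated_le[OF S(2,1) AB(2) ideal_m fin_len_m(1), THEN conjunct1])
    show "q \<otimes> s \<in> ?B" if "q \<in> m" "s \<in> S" for q s
      using that SA ideal_prod.prod[of q m s ?A R] by auto
  qed
  have sub: "?B \<union> S \<subseteq> carrier R" using ideal_subset[OF AB(2)] S by auto
  have "Idl (?B \<union> S) = ?A"
    using AB SA Idl_mono[of S "?B \<union> S"] sub S
    by (intro equalityI genideal_minimal) auto
  then show ?case
    using len_add(2)[OF AB(2,1) oneideal AB(3) ideal_subset[OF AB(1)] _ Suc] fin by simp
qed

lemma fin_len_carrier:
  assumes "ideal K R" "ideal_pow R m N \<subseteq> K"
  shows "fin_len K (carrier R)"
  using fin_len_sub(2)[OF fin_len_pow_m pow_ideal[OF ideal_m] assms(1) oneideal assms(2)]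
    ideal_subset[OF assms(1)] by auto

text \<open>A lower bound for the height. The dimension enters by contradiction, through a chain of
  length \<open>d + 1\<close> that ends in \<open>m\<close>.\<close>

definition height_ge :: "nat \<Rightarrow> 'a set \<Rightarrow> bool" where
  "height_ge n Q \<longleftrightarrow> (\<exists>P :: nat \<Rightarrow> 'a set. (\<forall>i\<le>n. primeideal (P i) R) \<and>
      (\<forall>i<n. P i \<subset> P (Suc i)) \<and> P n = Q)"

lemma height_ge_Suc:
  assumes "height_ge n P" "primeideal Q R" "P \<subset> Q"
  shows "height_ge (Suc n) Q"
proof -
  obtain C :: "nat \<Rightarrow> 'a set" where C: "\<forall>i\<le>n. primeideal (C i) R" "\<forall>i<n. C i \<subset> C (Suc i)" "C n = P"
    using assms(1) by (auto simp: height_ge_def)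
  show ?thesis unfolding height_ge_def
    by (rule exI[of _ "C(Suc n := Q)"]) (use C assms in \<open>auto simp: less_Suc_eq le_Suc_eq\<close>)
qed

text \<open>By prime avoidance, each new parameter leaves the finitely many primes \<open>\<noteq> m\<close> minimal over
  the previous parameters, so the remaining primes have larger and larger height.\<close>

lemma parameters_exist:
  "\<exists>ys. length ys = i \<and> set ys \<subseteq> m \<and>
     (\<forall>P. primeideal P R \<longrightarrow> set ys \<subseteq> P \<longrightarrow> P \<noteq> m \<longrightarrow> height_ge i P)"
proof (induction i)
  case 0
  have "height_ge 0 P" if "primeideal P R" for P
    unfolding height_ge_def by (rule exI[of _ "\<lambda>_. P"]) (use that in auto)
  then show ?case by auto
next
  case (Suc i)
  then obtain ys where ys: "length ys = i" "set ys \<subseteq> m"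
     "\<And>P. primeideal P R \<Longrightarrow> set ys \<subseteq> P \<Longrightarrow> P \<noteq> m \<Longrightarrow> height_ge i P" by blast
  have ysc: "set ys \<subseteq> carrier R" using ys(2) ideal_subset[OF ideal_m] by auto
  obtain Ps where Ps: "\<forall>P\<in>set Ps. primeideal P R \<and> Idl (set ys) \<subseteq> P"
    "foldr (\<cdot>) Ps (carrier R) \<subseteq> Idl (set ys)"
    using prime_product[OF genideal_ideal[OF ysc]] by blast
  have "\<exists>x\<in>m. \<forall>P\<in>set Ps - {m}. x \<notin> P"
  proof (rule prime_avoidance[OF ideal_m])
    fix P assume "P \<in> set Ps - {m}"
    then show "primeideal P R \<and> \<not> m \<subseteq> P" using Ps prime_subset_m[of P] by auto
  qed auto
  then obtain x where x: "x \<in> m" "\<And>P. P \<in> set Ps \<Longrightarrow> P \<noteq> m \<Longrightarrow> x \<notin> P" by blast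
  have "height_ge (Suc i) Q" if Q: "primeideal Q R" "set (x # ys) \<subseteq> Q" "Q \<noteq> m" for Q
  proof -
    have "Idl (set ys) \<subseteq> Q"
      using Q by (intro genideal_minimal primeideal.axioms(1)[OF Q(1)]) auto
    then have "foldr (\<cdot>) Ps (carrier R) \<subseteq> Q" using Ps by blast
    \<comment> \<open>A prime over the product contains one of its factors. This factor differs from
      \<open>m\<close> as \<open>P \<subseteq> Q \<subset> m\<close>, so \<open>x\<close> was chosen
      outside it and its inclusion in \<open>Q\<close> is strict.\<close>
    then obtain P where P: "P \<in> set Ps" "P \<subseteq> Q"
      using prime_foldr_prod_subset[OF Q(1), of Ps] Ps primeideal.axioms(1) by blast
    have "P \<noteq> m" using P Q prime_subset_m[OF Q(1)] by auto
    then have "x \<notin> P" using x P by auto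
    then have "P \<subset> Q" using P Q by auto
    moreover have "height_ge i P"
      using P(1) Ps(1) genideal_self[OF ysc] by (intro ys(3)[OF _ _ \<open>P \<noteq> m\<close>]) auto
    ultimately show ?thesis using height_ge_Suc Q by blast
  qed
  then show ?case using x ys by (intro exI[of _ "x # ys"]) auto
qed

text \<open>A prime \<open>P \<noteq> m\<close> over these \<open>d\<close> elements has height at
  least \<open>d\<close>, and \<open>m\<close> on top of it would give a chain of length
  \<open>d + 1\<close>. So \<open>m\<close> is the only prime over them, and some power of
  \<open>m\<close> lies in the ideal that they generate.\<close>

lemma parameter_ideal:
  assumes "krull_dim_eq R d"
  obtains ys N where "length ys = d" "set ys \<subseteq> m" "ideal_pow R m N \<subseteq> Idl (set ys)"
proof -
  obtain ys where ys: "length ys = d" "set ys \<subseteq> m"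
     "\<And>P. primeideal P R \<Longrightarrow> set ys \<subseteq> P \<Longrightarrow> P \<noteq> m \<Longrightarrow> height_ge d P"
    using parameters_exist[of d] by blast
  have ysc: "set ys \<subseteq> carrier R" using ys(2) ideal_subset[OF ideal_m] by auto
  have "P = m" if "primeideal P R" "Idl (set ys) \<subseteq> P" for P
  proof (rule ccontr)
    assume "P \<noteq> m"
    moreover have "P \<subseteq> m"
      using prime_subset_m[OF that(1)] .
    moreover have "height_ge d P"
      using that genideal_self[OF ysc] by (intro ys(3)[OF _ _ \<open>P \<noteq> m\<close>]) auto
    ultimately have "height_ge (Suc d) m" using height_ge_Suc prime_m by blast
    then have "prime_chain R (Suc d)" unfolding height_ge_def prime_chain_def by blast
    then show False using assms by (simp add: krull_dim_eq_def)
  qed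
  then obtain N where "ideal_pow R m N \<subseteq> Idl (set ys)"
    using pow_subset_of_unique_prime[OF genideal_ideal[OF ysc]] by metis
  then show ?thesis using that ys by blast
qed

end

section \<open>Functions that are eventually polynomial\<close>

text \<open>\<open>evpoly r f\<close>: the \<open>r\<close>-th difference of \<open>f\<close> vanishes eventually, i.e. \<open>f\<close> is
  eventually a polynomial of degree less than \<open>r\<close>.\<close>

primrec evpoly :: "nat \<Rightarrow> (nat \<Rightarrow> int) \<Rightarrow> bool" where
  "evpoly 0 f \<longleftrightarrow> (\<forall>\<^sub>F n in sequentially. f n = 0)"
| "evpoly (Suc r) f \<longleftrightarrow> evpoly r (\<lambda>n. f (Suc n) - f n)"

lemma evpoly_diff: "evpoly r f \<Longrightarrow> evpoly r g \<Longrightarrow> evpoly r (\<lambda>n. f n - g n)"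
proof (induction r arbitrary: f g)
  case 0
  from 0[unfolded evpoly.simps] show ?case
    unfolding evpoly.simps by eventually_elim simp
next
  case (Suc r)
  then have "evpoly r (\<lambda>n. (f (Suc n) - f n) - (g (Suc n) - g n))" by simp
  then show ?case by (simp add: algebra_simps)
qed

lemma evpoly_shift: "evpoly r (\<lambda>n. f (Suc n)) \<longleftrightarrow> evpoly r f"
proof (induction r arbitrary: f)
  case 0
  show ?case by (simp add: eventually_sequentially_Suc[of "\<lambda>n. f n = 0"])
next
  case (Suc r)
  show ?case using Suc[of "\<lambda>n. f (Suc n) - f n"] by simp
qed

context cring
begin

section \<open>Noetherianity of the Rees algebra\<close>

text \<open>\<open>deg_part xs n\<close> is \<open>(xs)\<^sup>n\<close>, split according to the powers of the first generator.\<close>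

fun deg_part :: "'a list \<Rightarrow> nat \<Rightarrow> 'a set" where
  "deg_part xs 0 = carrier R"
| "deg_part [] (Suc n) = {\<zero>}"
| "deg_part (x # xs) (Suc n) = scale x (deg_part (x # xs) n) \<boxplus> deg_part xs (Suc n)"

lemma deg_part_ideal: "set xs \<subseteq> carrier R \<Longrightarrow> ideal (deg_part xs n) R"
  by (induction xs n rule: deg_part.induct) (auto intro!: oneideal zeroideal add_ideals scale_ideal)

text \<open>Outer induction on the list, inner induction on the degree: a factor
  \<open>y \<noteq> x\<close> is moved past the leading \<open>x\<close> into a smaller
  degree.\<close>

lemma deg_part_mult:
  "set xs \<subseteq> carrier R \<Longrightarrow> y \<in> set xs \<Longrightarrow> c \<in> deg_part xs n \<Longrightarrow> y \<otimes> c \<in> deg_part xs (Suc n)"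
proof (induction xs arbitrary: n c)
  case Nil
  then show ?case by simp
next
  case (Cons x xs)
  have id: "ideal (deg_part (x # xs) k) R" "ideal (deg_part xs k) R" for k
    using Cons.prems by (auto intro!: deg_part_ideal)
  have x: "x \<in> carrier R" and y: "y \<in> carrier R" using Cons.prems by auto
  note sc = scale_ideal[OF x id(1)]
  show ?case
  proof (cases "y = x")
    case True
    then show ?thesis
      using sum_upper1[OF sc[of n] id(2)[of "Suc n"]] Cons.prems(3) by auto
  next
    case False
    then have yxs: "y \<in> set xs" using Cons.prems by auto
    show ?thesis using Cons.prems(3)
    proof (induction n arbitrary: c)
      case 0
      then have "y \<otimes> c \<in> deg_part xs 1" using Cons.IH[of c 0] yxs Cons.prems by auto
      then show ?case using sum_upper2[OF sc[of 0] id(2)[of 1]] by auto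
    next
      case (Suc n)
      then obtain a b where ab: "a \<in> deg_part (x # xs) n" "b \<in> deg_part xs (Suc n)" "c = x \<otimes> a \<oplus> b"
        by (auto elim!: sum_memE)
      have "y \<otimes> c = x \<otimes> (y \<otimes> a) \<oplus> y \<otimes> b"
        unfolding ab(3) using x y idealD(2)[OF id(1) ab(1)] idealD(2)[OF id(2) ab(2)] by algebra
      moreover have "y \<otimes> a \<in> deg_part (x # xs) (Suc n)" by (rule Suc.IH[OF ab(1)])
      moreover have "y \<otimes> b \<in> deg_part xs (Suc (Suc n))" using Cons.IH[OF _ yxs ab(2)] Cons.prems by auto
      ultimately show ?case
        by (simp add: sum_memI del: deg_part.simps(3) add: deg_part.simps(3)[of x xs "Suc n"])
    qed
  qed
qed

lemma pow_subset_deg_part: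
  assumes "set xs \<subseteq> carrier R"
  shows "ideal_pow R (Idl (set xs)) n \<subseteq> deg_part xs n"
proof (induction n)
  case 0
  then show ?case by simp
next
  case (Suc n)
  note id = deg_part_ideal[OF assms]
  have "a \<otimes> b \<in> deg_part xs (Suc n)" if ab: "a \<in> Idl (set xs)" "b \<in> deg_part xs n" for a b
  proof -
    have "Idl (set xs) \<subseteq> colon_ideal R (deg_part xs (Suc n)) {b}"
      using deg_part_mult[OF assms _ ab(2)] assms idealD(2)[OF id ab(2)]
      by (intro genideal_minimal colon_ideal_ideal id) (auto simp: colon_ideal_def)
    then show ?thesis using ab(1) by (auto simp: colon_ideal_def)
  qed
  then have "(Idl (set xs)) \<cdot> deg_part xs n \<subseteq> deg_part xs (Suc n)" by (intro ideal_prod_least id)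
  then show ?case using ideal_prod_mono[OF subset_refl Suc] by fastforce
qed

text \<open>For an ideal \<open>C\<close> this is the product \<open>(xs) C\<close>, that is, what
  the component \<open>C\<close> generates in the next degree.\<close>

definition gen :: "'a list \<Rightarrow> 'a set \<Rightarrow> 'a set" where
  "gen xs C = Idl {y \<otimes> c |y c. y \<in> set xs \<and> c \<in> C}"

lemma gen_ideal: "set xs \<subseteq> carrier R \<Longrightarrow> C \<subseteq> carrier R \<Longrightarrow> ideal (gen xs C) R"
  unfolding gen_def by (intro genideal_ideal) auto

lemma gen_mem:
  "set xs \<subseteq> carrier R \<Longrightarrow> C \<subseteq> carrier R \<Longrightarrow> y \<in> set xs \<Longrightarrow> c \<in> C \<Longrightarrow> y \<otimes> c \<in> gen xs C"
  unfolding gen_def by (rule subsetD[OF genideal_self]) auto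

lemma gen_least:
  "ideal E R \<Longrightarrow> (\<And>y c. y \<in> set xs \<Longrightarrow> c \<in> C \<Longrightarrow> y \<otimes> c \<in> E) \<Longrightarrow> gen xs C \<subseteq> E"
  unfolding gen_def by (intro genideal_minimal) auto

text \<open>These families are the graded submodules of \<open>R[t]\<close> over a polynomial ring
  whose variables act as \<open>y t\<close> for \<open>y\<close> in \<open>xs\<close>.\<close>

definition graded_family :: "'a list \<Rightarrow> (nat \<Rightarrow> 'a set) \<Rightarrow> bool" where
  "graded_family xs C \<longleftrightarrow> (\<forall>n. ideal (C n) R) \<and>
     (\<forall>n. \<forall>y\<in>set xs. \<forall>c\<in>C n. y \<otimes> c \<in> C (Suc n))"

text \<open>\<open>lower x xs k n\<close> consists of the elements of degree \<open>n + k\<close> whose degree in \<open>x\<close> is less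
  than \<open>k\<close>.\<close>

primrec lower :: "'a \<Rightarrow> 'a list \<Rightarrow> nat \<Rightarrow> nat \<Rightarrow> 'a set" where
  "lower x xs 0 n = {\<zero>}"
| "lower x xs (Suc k) n = scale (x [^] k) (deg_part xs (Suc n)) \<boxplus> lower x xs k (Suc n)"

context
  fixes x xs
  assumes x: "x \<in> carrier R" and xs: "set xs \<subseteq> carrier R"
begin

lemma lower_ideal: "ideal (lower x xs k n) R"
  by (induction k arbitrary: n) (auto intro!: zeroideal add_ideals scale_ideal deg_part_ideal xs x)

lemma lower_x_mult: "w \<in> lower x xs k n \<Longrightarrow> x \<otimes> w \<in> lower x xs (Suc k) n"
proof (induction k arbitrary: n w)
  case 0
  then have "w = \<zero>" by simp
  then show ?case using idealD(1)[OF lower_ideal[of "Suc 0" n]] x by (simp del: lower.simps)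
next
  case (Suc k)
  then obtain p v where pv: "p \<in> deg_part xs (Suc n)" "v \<in> lower x xs k (Suc n)"
    "w = x [^] k \<otimes> p \<oplus> v" by (auto elim!: sum_memE)
  have carr: "p \<in> carrier R" "v \<in> carrier R" "x [^] k \<in> carrier R" "x \<in> carrier R"
    using pv idealD(2) deg_part_ideal[OF xs] lower_ideal x by blast+
  have "x \<otimes> w = (x [^] k \<otimes> x) \<otimes> p \<oplus> x \<otimes> v" unfolding pv(3) using carr by algebra
  then have "x \<otimes> w = x [^] Suc k \<otimes> p \<oplus> x \<otimes> v" by simp
  then show ?case using Suc.IH[OF pv(2)] pv(1) lower.simps(2)[of x xs "Suc k" n]
    by (metis imageI sum_memI)
qed

lemma lower_mult:
  "y \<in> set xs \<Longrightarrow> w \<in> lower x xs k n \<Longrightarrow> y \<otimes> w \<in> lower x xs k (Suc n)"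
proof (induction k arbitrary: n w)
  case 0
  then show ?case using xs by auto
next
  case (Suc k)
  then obtain p v where pv: "p \<in> deg_part xs (Suc n)" "v \<in> lower x xs k (Suc n)"
    "w = x [^] k \<otimes> p \<oplus> v" by (auto elim!: sum_memE)
  have carr: "p \<in> carrier R" "v \<in> carrier R" "x [^] k \<in> carrier R" "y \<in> carrier R"
    using pv idealD(2) deg_part_ideal[OF xs] lower_ideal x xs Suc.prems by blast+
  have "y \<otimes> w = x [^] k \<otimes> (y \<otimes> p) \<oplus> y \<otimes> v" unfolding pv(3) using carr by algebra
  then show ?case using Suc.IH[OF Suc.prems(1) pv(2)] deg_part_mult[OF xs Suc.prems(1) pv(1)]
      lower.simps(2)[of x xs k "Suc n"]
    by (metis imageI sum_memI)
qed

lemma deg_part_subset_lower: "deg_part xs (n + Suc k) \<subseteq> lower x xs (Suc k) n"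
proof (induction k arbitrary: n)
  case 0
  have "scale \<one> (deg_part xs (Suc n)) = deg_part xs (Suc n)"
    using ideal_subset[OF deg_part_ideal[OF xs]] by force
  then show ?case using sum_upper1[OF deg_part_ideal[OF xs] zeroideal] by auto
next
  case (Suc k)
  have "deg_part xs (n + Suc (Suc k)) \<subseteq> lower x xs (Suc k) (Suc n)"
    using Suc[of "Suc n"] by simp
  also have "\<dots> \<subseteq> lower x xs (Suc (Suc k)) n"
    unfolding lower.simps(2)[of x xs "Suc k" n]
    using x by (intro sum_upper2 lower_ideal scale_ideal deg_part_ideal xs) auto
  finally show ?case .
qed

text \<open>Splits off the pure power of \<open>x\<close>. With it every element of
  \<open>C (Suc n)\<close> enters the descent of \<open>rees_noetherian\<close> at the largest
  possible \<open>x\<close>-degree.\<close>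

lemma deg_part_Cons_subset:
  "deg_part (x # xs) n \<subseteq> scale (x [^] n) (carrier R) \<boxplus> lower x xs n 0"
proof (induction n)
  case 0
  have "r \<in> scale \<one> (carrier R) \<boxplus> {\<zero>}" if "r \<in> carrier R" for r
    using that by (metis image_eqI insertI1 l_one r_zero sum_memI)
  then show ?case by auto
next
  case (Suc n)
  show ?case
  proof
    fix c assume "c \<in> deg_part (x # xs) (Suc n)"
    then obtain p b where pb: "p \<in> deg_part (x # xs) n" "b \<in> deg_part xs (Suc n)" "c = x \<otimes> p \<oplus> b"
      by (auto elim!: sum_memE)
    then obtain r v where rv: "r \<in> carrier R" "v \<in> lower x xs n 0" "p = x [^] n \<otimes> r \<oplus> v"
      using Suc by (auto elim!: sum_memE)
    have carr: "v \<in> carrier R" "b \<in> carrier R" "x [^] n \<in> carrier R"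
      using pb rv idealD(2) deg_part_ideal[OF xs] lower_ideal x by blast+
    have "c = (x [^] n \<otimes> x) \<otimes> r \<oplus> (x \<otimes> v \<oplus> b)"
      unfolding pb(3) rv(3) using carr rv(1) x by algebra
    moreover have "x \<otimes> v \<oplus> b \<in> lower x xs (Suc n) 0"
      using lower_x_mult[OF rv(2)] deg_part_subset_lower[of 0 n] pb(2)
      by (intro idealD(3)[OF lower_ideal]) auto
    ultimately show "c \<in> scale (x [^] Suc n) (carrier R) \<boxplus> lower x xs (Suc n) 0"
      using rv(1) by (auto intro!: sum_memI)
  qed
qed

end

end

context noetherian_cring
begin

text \<open>Hilbert's basis theorem in graded form: one compares \<open>C\<close> with the families \<open>D k\<close> of
  coefficients of \<open>x\<^sup>k\<close> in elements of \<open>C\<close> of degree at most \<open>k\<close> in \<open>x\<close>.\<close>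

lemma rees_noetherian:
  assumes "set xs \<subseteq> carrier R" "graded_family xs C" "\<And>n. C n \<subseteq> deg_part xs n"
  shows "\<exists>N. \<forall>n\<ge>N. C (Suc n) \<subseteq> gen xs (C n)"
  using assms
proof (induction xs arbitrary: C)
  case Nil
  have "C (Suc n) \<subseteq> gen [] (C n)" for n
    using Nil(3)[of "Suc n"] idealD(1)[OF gen_ideal[of "[]" "C n"]] Nil(2) ideal_subset
    by (auto simp: graded_family_def)
  then show ?case by auto
next
  case (Cons x xs)
  have x: "x \<in> carrier R" and xs: "set xs \<subseteq> carrier R" using Cons.prems by auto
  have C: "\<And>n. ideal (C n) R" "\<And>n y c. y \<in> set (x # xs) \<Longrightarrow> c \<in> C n \<Longrightarrow> y \<otimes> c \<in> C (Suc n)"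
    using Cons.prems(2) by (auto simp: graded_family_def)
  note low = lower_ideal[OF x xs] and deg = deg_part_ideal[OF xs]
  \<comment> \<open>An element of \<open>R\<close> has no well-defined \<open>x\<close>-degree, so
    \<open>D\<close> asks for some representation with leading term \<open>x^k c\<close>. The index
    \<open>n\<close> is the degree of the coefficient \<open>c\<close>; the element of
    \<open>C\<close> has degree \<open>n + k\<close>.\<close>
  define D where "D k n = {c \<in> deg_part xs n. \<exists>w\<in>lower x xs k n. x [^] k \<otimes> c \<oplus> w \<in> C (n + k)}" for k n
  have xk: "x [^] (k::nat) \<in> carrier R" for k using x by simp
  have D_ideal: "ideal (D k n) R" for k n
  proof (rule idealI')
    show "D k n \<subseteq> carrier R" using ideal_subset[OF deg] by (auto simp: D_def)
    show "\<zero> \<in> D k n"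
      using idealD(1)[OF deg] idealD(1)[OF low, of k n] idealD(1)[OF C(1)] xk
      by (auto simp: D_def intro!: bexI[of _ \<zero>])
  next
    fix a b assume "a \<in> D k n" "b \<in> D k n"
    then obtain u v where *: "a \<in> deg_part xs n" "b \<in> deg_part xs n" "u \<in> lower x xs k n"
      "v \<in> lower x xs k n" "x [^] k \<otimes> a \<oplus> u \<in> C (n + k)" "x [^] k \<otimes> b \<oplus> v \<in> C (n + k)"
      by (auto simp: D_def)
    have carr: "a \<in> carrier R" "b \<in> carrier R" "u \<in> carrier R" "v \<in> carrier R"
      using * idealD(2)[OF deg] idealD(2)[OF low] by blast+
    have "(x [^] k \<otimes> a \<oplus> u) \<oplus> (x [^] k \<otimes> b \<oplus> v) = x [^] k \<otimes> (a \<oplus> b) \<oplus> (u \<oplus> v)"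
      using carr xk[of k] by algebra
    then have "x [^] k \<otimes> (a \<oplus> b) \<oplus> (u \<oplus> v) \<in> C (n + k)"
      using idealD(3)[OF C(1) *(5,6)] by simp
    then show "a \<oplus> b \<in> D k n"
      using idealD(3)[OF deg *(1,2)] idealD(3)[OF low *(3,4)] by (auto simp: D_def)
  next
    fix a r assume "a \<in> D k n" and r: "r \<in> carrier R"
    then obtain u where *: "a \<in> deg_part xs n" "u \<in> lower x xs k n"
      "x [^] k \<otimes> a \<oplus> u \<in> C (n + k)" by (auto simp: D_def)
    have carr: "a \<in> carrier R" "u \<in> carrier R"
      using * idealD(2)[OF deg] idealD(2)[OF low] by blast+
    have "r \<otimes> (x [^] k \<otimes> a \<oplus> u) = x [^] k \<otimes> (r \<otimes> a) \<oplus> r \<otimes> u"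
      using carr xk[of k] r by algebra
    then have "x [^] k \<otimes> (r \<otimes> a) \<oplus> r \<otimes> u \<in> C (n + k)"
      using idealD(6)[OF C(1) *(3) r] by simp
    then show "r \<otimes> a \<in> D k n"
      using idealD(6)[OF deg *(1) r] idealD(6)[OF low *(2) r] by (auto simp: D_def)
  qed
  have D_mult: "y \<otimes> c \<in> D k (Suc n)" if yc: "y \<in> set xs" "c \<in> D k n" for y c k n
  proof -
    obtain u where *: "c \<in> deg_part xs n" "u \<in> lower x xs k n" "x [^] k \<otimes> c \<oplus> u \<in> C (n + k)"
      using yc by (auto simp: D_def)
    have carr: "c \<in> carrier R" "u \<in> carrier R" "y \<in> carrier R"
      using * idealD(2)[OF deg] idealD(2)[OF low] yc(1) xs by blast+
    have "y \<otimes> (x [^] k \<otimes> c \<oplus> u) = x [^] k \<otimes> (y \<otimes> c) \<oplus> y \<otimes> u"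
      using carr xk[of k] by algebra
    then have "x [^] k \<otimes> (y \<otimes> c) \<oplus> y \<otimes> u \<in> C (Suc n + k)"
      using C(2)[OF _ *(3), of y] yc(1) by simp
    then show ?thesis
      using deg_part_mult[OF xs yc(1) *(1)] lower_mult[OF x xs yc(1) *(2)] by (auto simp: D_def)
  qed
  have D_Suc: "D k n \<subseteq> D (Suc k) n" for k n
  proof
    fix c assume "c \<in> D k n"
    then obtain u where *: "c \<in> deg_part xs n" "u \<in> lower x xs k n" "x [^] k \<otimes> c \<oplus> u \<in> C (n + k)"
      by (auto simp: D_def)
    have carr: "c \<in> carrier R" "u \<in> carrier R"
      using * idealD(2)[OF deg] idealD(2)[OF low] by blast+
    have "x \<otimes> (x [^] k \<otimes> c \<oplus> u) = (x [^] k \<otimes> x) \<otimes> c \<oplus> x \<otimes> u"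
      using carr xk[of k] x by algebra
    then have "x [^] Suc k \<otimes> c \<oplus> x \<otimes> u \<in> C (n + Suc k)"
      using C(2)[OF _ *(3), of x] by simp
    then show "c \<in> D (Suc k) n"
      using *(1) lower_x_mult[OF x xs *(2)] by (auto simp: D_def)
  qed
  have D_mono: "D k n \<subseteq> D l n" if "k \<le> l" for k l n
    using lift_Suc_mono_le[of "\<lambda>k. D k n", OF D_Suc that] .
  \<comment> \<open>Leading coefficients for all \<open>x\<close>-degrees together. The induction
    hypothesis is used for \<open>U\<close> and for each \<open>D k\<close>; once
    \<open>U = D k0\<close> is known, the bounds \<open>N k\<close> with \<open>k \<le> k0\<close>
    suffice.\<close>
  define U where "U n = (\<Union>k. D k n)" for n
  have U_ideal: "ideal (U n) R" for n
    unfolding U_def by (rule ascending_stable(2)[of "\<lambda>k. D k n" for n, OF D_ideal D_Suc])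
  have D_sub: "D k n \<subseteq> deg_part xs n" for k n by (auto simp: D_def)
  have U_mult: "y \<otimes> c \<in> U (Suc n)" if "y \<in> set xs" "c \<in> U n" for y c n
    using that D_mult unfolding U_def by blast
  have "U n \<subseteq> deg_part xs n" for n using D_sub unfolding U_def by blast
  then have "\<exists>N. \<forall>n\<ge>N. U (Suc n) \<subseteq> gen xs (U n)"
    using U_ideal U_mult by (intro Cons.IH[OF xs]) (auto simp: graded_family_def)
  then obtain N0 where N0: "\<And>n. n \<ge> N0 \<Longrightarrow> U (Suc n) \<subseteq> gen xs (U n)" by auto
  have "\<exists>N. \<forall>n\<ge>N. D k (Suc n) \<subseteq> gen xs (D k n)" for k
    by (rule Cons.IH[OF xs]) (use D_ideal D_mult D_sub in \<open>auto simp: graded_family_def\<close>)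
  then obtain N where N: "\<And>k n. n \<ge> N k \<Longrightarrow> D k (Suc n) \<subseteq> gen xs (D k n)" by metis
  have "\<exists>l. \<forall>k\<ge>l. D k n = D l n" for n
    by (rule ascending_stable(1)[of "\<lambda>k. D k n" for n, OF D_ideal D_Suc])
  then obtain l where l: "\<And>n k. k \<ge> l n \<Longrightarrow> D k n = D (l n) n" by metis
  \<comment> \<open>The chain in \<open>k\<close> is known to become stationary only for each degree
    \<open>n\<close> separately. So \<open>k0\<close> is chosen for the degrees up to
    \<open>N0\<close>; beyond \<open>N0\<close>, generation from the previous degree carries
    \<open>U n = D k0 n\<close> upwards.\<close>
  define k0 where "k0 = Max (l ` {..N0})"
  have k0: "l n \<le> k0" if "n \<le> N0" for n using that by (auto simp: k0_def)
  have U_low: "U n = D k0 n" if "n \<le> N0" for n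
  proof
    show "U n \<subseteq> D k0 n"
    proof
      fix c assume "c \<in> U n"
      then obtain k where "c \<in> D k n" by (auto simp: U_def)
      then have "c \<in> D (max k k0) n" using D_mono[of k "max k k0"] by auto
      then show "c \<in> D k0 n" using l[of n "max k k0"] l[of n k0] k0[OF that] by auto
    qed
  qed (auto simp: U_def)
  have U_eq: "U n = D k0 n" for n
  proof (induction n)
    case 0
    then show ?case using U_low by auto
  next
    case (Suc n)
    show ?case
    proof (cases "Suc n \<le> N0")
      case True
      then show ?thesis using U_low by auto
    next
      case False
      then have "U (Suc n) \<subseteq> gen xs (D k0 n)" using N0[of n] Suc by auto
      also have "\<dots> \<subseteq> D k0 (Suc n)" using D_mult by (intro gen_least D_ideal) auto
      finally show ?thesis by (auto simp: U_def)
    qed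
  qed
  \<comment> \<open>Then \<open>n \<ge> M\<close> gives \<open>n - k \<ge> N k\<close> for all
    \<open>k \<le> k0\<close>, where \<open>n - k\<close> is the degree of the coefficient of
    \<open>x^k\<close> in degree \<open>n\<close>.\<close>
  define M where "M = k0 + Max (N ` {..k0})"
  have M: "N k + k \<le> M" if "k \<le> k0" for k
  proof -
    have "N k \<le> Max (N ` {..k0})" using that by (intro Max_ge) auto
    then show ?thesis using that unfolding M_def by linarith
  qed
  have "C (Suc n) \<subseteq> gen (x # xs) (C n)" if n: "n \<ge> M" for n
  proof -
    define G where "G = gen (x # xs) (C n)"
    have G: "ideal G R" "G \<subseteq> C (Suc n)"
      using Cons.prems(1) ideal_subset[OF C(1)] C
      unfolding G_def by (intro gen_ideal gen_least; simp)+
    have Gmem: "y \<otimes> c \<in> G" if "y \<in> set (x # xs)" "c \<in> C n" for y c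
      unfolding G_def by (rule gen_mem[OF Cons.prems(1) ideal_subset[OF C(1)] that])
    \<comment> \<open>An element of \<open>G\<close> cancels the leading term. For
      \<open>k \<le> k0\<close> the coefficient is generated from degree \<open>n - k\<close> by
      factors \<open>y\<close> in \<open>xs\<close>; for \<open>k > k0\<close> it already occurs as
      a coefficient of \<open>x^(k-1)\<close>, and the factor \<open>x\<close> raises the
      power.\<close>
    have lead: "\<exists>g\<in>G. x [^] k \<otimes> a \<ominus> g \<in> lower x xs k (Suc n - k)"
      if k: "k \<le> Suc n" and a: "a \<in> D k (Suc n - k)" for k a
    proof (cases "k \<le> k0")
      case True
      have "k \<le> n" using True n by (auto simp: M_def)
      then have eq: "Suc n - k = Suc (n - k)" by auto
      define H where "H = {a \<in> carrier R. \<exists>g\<in>G. x [^] k \<otimes> a \<ominus> g \<in> lower x xs k (Suc n - k)}"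
      have "ideal H R"
      proof (rule idealI')
        have "x [^] k \<otimes> \<zero> \<ominus> \<zero> = \<zero>" using xk[of k] by algebra
        then show "\<zero> \<in> H"
          using idealD(1)[OF G(1)] idealD(1)[OF low, of k "Suc n - k"]
          by (auto simp: H_def intro!: bexI[of _ \<zero>])
      next
        fix a b assume "a \<in> H" "b \<in> H"
        then obtain g h where *: "a \<in> carrier R" "b \<in> carrier R" "g \<in> G" "h \<in> G"
          "x [^] k \<otimes> a \<ominus> g \<in> lower x xs k (Suc n - k)" "x [^] k \<otimes> b \<ominus> h \<in> lower x xs k (Suc n - k)"
          by (auto simp: H_def)
        have "(x [^] k \<otimes> a \<ominus> g) \<oplus> (x [^] k \<otimes> b \<ominus> h) = x [^] k \<otimes> (a \<oplus> b) \<ominus> (g \<oplus> h)"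
          using * (1,2) idealD(2)[OF G(1) *(3)] idealD(2)[OF G(1) *(4)] xk[of k] by algebra
        then show "a \<oplus> b \<in> H"
          using idealD(3)[OF low *(5,6)] idealD(3)[OF G(1) *(3,4)] * (1,2) by (auto simp: H_def)
      next
        fix a r assume "a \<in> H" and r: "r \<in> carrier R"
        then obtain g where *: "a \<in> carrier R" "g \<in> G"
          "x [^] k \<otimes> a \<ominus> g \<in> lower x xs k (Suc n - k)" by (auto simp: H_def)
        have "r \<otimes> (x [^] k \<otimes> a \<ominus> g) = x [^] k \<otimes> (r \<otimes> a) \<ominus> (r \<otimes> g)"
          using * (1) idealD(2)[OF G(1) *(2)] xk[of k] r by algebra
        then show "r \<otimes> a \<in> H"
          using idealD(6)[OF low *(3) r] idealD(6)[OF G(1) *(2) r] * (1) r by (auto simp: H_def)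
      qed (auto simp: H_def)
      moreover have "y \<otimes> c \<in> H" if yc: "y \<in> set xs" "c \<in> D k (n - k)" for y c
      proof -
        obtain u where *: "c \<in> deg_part xs (n - k)" "u \<in> lower x xs k (n - k)"
          "x [^] k \<otimes> c \<oplus> u \<in> C (n - k + k)" using yc by (auto simp: D_def)
        have carr: "c \<in> carrier R" "u \<in> carrier R" "y \<in> carrier R"
          using * idealD(2)[OF deg] idealD(2)[OF low] yc(1) xs by blast+
        have "x [^] k \<otimes> (y \<otimes> c) \<ominus> y \<otimes> (x [^] k \<otimes> c \<oplus> u) = \<ominus> (y \<otimes> u)"
          using carr xk[of k] by algebra
        moreover have "\<ominus> (y \<otimes> u) \<in> lower x xs k (Suc n - k)"
          using idealD(4)[OF low lower_mult[OF x xs yc(1) *(2)]] eq by simp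
        moreover have "y \<otimes> (x [^] k \<otimes> c \<oplus> u) \<in> G"
          using *(3) \<open>k \<le> n\<close> yc(1) by (intro Gmem) auto
        ultimately show ?thesis using carr by (auto simp: H_def intro!: bexI)
      qed
      ultimately have "gen xs (D k (n - k)) \<subseteq> H" by (rule gen_least)
      moreover have "a \<in> gen xs (D k (n - k))"
      proof -
        have "N k \<le> n - k" using M[OF True] n by linarith
        then show ?thesis using N[of k "n - k"] a eq by auto
      qed
      ultimately show ?thesis by (auto simp: H_def)
    next
      case False
      then obtain j where j: "k = Suc j" "k0 \<le> j" by (cases k) auto
      then have "a \<in> D j (Suc n - k)"
        using a U_eq[of "Suc n - k"] D_mono[of k0 j "Suc n - k"] by (auto simp: U_def)
      then obtain u where *: "a \<in> deg_part xs (Suc n - k)" "u \<in> lower x xs j (Suc n - k)"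
          "x [^] j \<otimes> a \<oplus> u \<in> C (Suc n - k + j)" by (auto simp: D_def)
      have carr: "a \<in> carrier R" "u \<in> carrier R"
          using * idealD(2)[OF deg] idealD(2)[OF low] by blast+
      have "(x [^] j \<otimes> x) \<otimes> a \<ominus> x \<otimes> (x [^] j \<otimes> a \<oplus> u) = \<ominus> (x \<otimes> u)"
          using carr xk[of j] x by algebra
      moreover have "\<ominus> (x \<otimes> u) \<in> lower x xs k (Suc n - k)"
        using idealD(4)[OF low lower_x_mult[OF x xs *(2)]] j by simp
      moreover have "x \<otimes> (x [^] j \<otimes> a \<oplus> u) \<in> G"
        using *(3) j k by (intro Gmem) auto
      ultimately show ?thesis using j by (auto intro!: bexI)
    qed
    \<comment> \<open>The division algorithm: subtracting \<open>g \<in> G\<close> pushes an element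
      of \<open>C (Suc n)\<close> down to smaller \<open>x\<close>-degree. At \<open>k = 0\<close>
      the lower part is \<open>{\<zero>}\<close>, so the element equals the \<open>g\<close> found
      for it.\<close>
    have step: "c \<in> G" if "k \<le> Suc n" "c \<in> C (Suc n)" 
      "c \<in> scale (x [^] k) (deg_part xs (Suc n - k)) \<boxplus> lower x xs k (Suc n - k)" for c k
      using that
    proof (induction k arbitrary: c)
      case (0 c)
      then have c: "c \<in> carrier R" using idealD(2)[OF C(1)] by blast
      obtain a where a: "a \<in> deg_part xs (Suc n)" "c = \<one> \<otimes> a \<oplus> \<zero>"
        using 0 by (auto elim!: sum_memE)
      then have "a = c" using idealD(2)[OF deg a(1)] by simp
      then have "c \<in> D 0 (Suc n)" using a 0(2) by (auto simp: D_def)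
      then obtain g where "g \<in> G" "x [^] (0::nat) \<otimes> c \<ominus> g \<in> {\<zero>}"
        using lead[of 0 c] by auto
      moreover then have "c = g" using c idealD(2)[OF G(1)] r_right_minus_eq[of c g] by auto
      ultimately show ?case by auto
    next
      case (Suc k c)
      let ?e = "Suc n - Suc k"
      obtain a w where aw: "a \<in> deg_part xs ?e" "w \<in> lower x xs (Suc k) ?e" "c = x [^] Suc k \<otimes> a \<oplus> w"
        using Suc.prems(3) by (elim sum_memE imageE) metis
      have "?e + Suc k = Suc n" using Suc.prems by auto
      then have "a \<in> D (Suc k) ?e" using aw Suc.prems(2) by (auto simp: D_def)
      then obtain g where g: "g \<in> G" "x [^] Suc k \<otimes> a \<ominus> g \<in> lower x xs (Suc k) ?e"
        using lead[OF Suc.prems(1)] by auto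
      have carr: "a \<in> carrier R" "w \<in> carrier R" "g \<in> carrier R" "x [^] Suc k \<in> carrier R"
        using aw g idealD(2)[OF G(1)] idealD(2)[OF deg] idealD(2)[OF low] xk by blast+
      have "c \<ominus> g = (x [^] Suc k \<otimes> a \<ominus> g) \<oplus> w" unfolding aw(3) using carr by algebra
      then have "c \<ominus> g \<in> lower x xs (Suc k) ?e" using idealD(3)[OF low g(2) aw(2)] by simp
      moreover have "Suc ?e = Suc n - k" using Suc.prems by auto
      ultimately have "c \<ominus> g \<in> scale (x [^] k) (deg_part xs (Suc n - k)) \<boxplus> lower x xs k (Suc n - k)"
        using lower.simps(2)[of x xs k ?e] by metis
      moreover have "c \<ominus> g \<in> C (Suc n)" using Suc.prems g G idealD(5)[OF C(1)] by blast
      ultimately have "c \<ominus> g \<in> G" using Suc.IH[of "c \<ominus> g"] Suc.prems by auto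
      then have "(c \<ominus> g) \<oplus> g \<in> G" using g idealD(3)[OF G(1)] by blast
      moreover have "(c \<ominus> g) \<oplus> g = c"
        using carr idealD(2)[OF C(1) Suc.prems(2)] by algebra
      ultimately show ?case by simp
    qed
    show ?thesis
    proof
      fix c assume c: "c \<in> C (Suc n)"
      then have "c \<in> scale (x [^] Suc n) (carrier R) \<boxplus> lower x xs (Suc n) 0"
        using Cons.prems(3) deg_part_Cons_subset[OF x xs] by blast
      then show "c \<in> gen (x # xs) (C n)"
        using step[of "Suc n" c] c by (simp add: G_def)
    qed
  qed
  then show ?case by auto
qed

section \<open>Hilbert functions are eventually polynomial\<close>

text \<open>\<open>stable_pair xs A B\<close> says that the graded module \<open>\<Oplus> A n / B n\<close> over \<open>R[xs]\<close> is Noetherian.\<close>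

definition stable_pair :: "'a list \<Rightarrow> (nat \<Rightarrow> 'a set) \<Rightarrow> (nat \<Rightarrow> 'a set) \<Rightarrow> bool" where
  "stable_pair xs A B \<longleftrightarrow> (\<forall>C. graded_family xs C \<longrightarrow> (\<forall>n. B n \<subseteq> C n \<and> C n \<subseteq> A n) \<longrightarrow>
     (\<exists>N. \<forall>n\<ge>N. C (Suc n) \<subseteq> Idl (B (Suc n) \<union> gen xs (C n))))"

text \<open>Multiplication by \<open>x\<close> from degree \<open>n\<close> to \<open>n + 1\<close>
  of \<open>A/B\<close> has kernel \<open>K/B\<close> and cokernel \<open>A'/B'\<close>. Both are
  killed by \<open>x\<close> and hence modules over \<open>xs\<close> alone, and their lengths
  differ by the first difference of the Hilbert function.\<close>

lemma hilbert_serre: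
  assumes "set xs \<subseteq> carrier R" "graded_family xs A" "graded_family xs B"
    and "\<And>n. B n \<subseteq> A n" "\<And>n. fin_len (B n) (A n)" "stable_pair xs A B"
  shows "evpoly (length xs) (\<lambda>n. int (len (B n) (A n)))"
  using assms
proof (induction xs arbitrary: A B)
  case Nil
  have id: "ideal (A n) R" "ideal (B n) R" for n
    using Nil by (auto simp: graded_family_def)
  obtain N where N: "\<And>n. n \<ge> N \<Longrightarrow> A (Suc n) \<subseteq> Idl (B (Suc n) \<union> gen [] (A n))"
    using Nil unfolding stable_pair_def by blast
  have "len (B n) (A n) = 0" if n: "n \<ge> Suc N" for n
  proof -
    obtain k where k: "n = Suc k" "k \<ge> N" using n by (cases n) auto
    have "A n \<subseteq> B n"
      using N[OF k(2)] genideal_minimal[OF id(2), of "B n \<union> gen [] (A k)" n]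
        gen_least[OF id(2), of "[]" "A k" n] k by auto
    then have "A n = B n" using Nil by blast
    then show ?thesis using len_self[OF id(2)[of n]] by simp
  qed
  then show ?case by (auto simp: eventually_sequentially intro!: exI[of _ "Suc N"])
next
  case (Cons x xs)
  have x: "x \<in> carrier R" and xs: "set xs \<subseteq> carrier R" using Cons.prems by auto
  have A: "\<And>n. ideal (A n) R" "\<And>n y c. y \<in> set (x # xs) \<Longrightarrow> c \<in> A n \<Longrightarrow> y \<otimes> c \<in> A (Suc n)"
    using Cons.prems(2) by (auto simp: graded_family_def)
  have B: "\<And>n. ideal (B n) R" "\<And>n y c. y \<in> set (x # xs) \<Longrightarrow> c \<in> B n \<Longrightarrow> y \<otimes> c \<in> B (Suc n)"
    using Cons.prems(3) by (auto simp: graded_family_def)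
  note BA = Cons.prems(4) and fin = Cons.prems(5) and stable = Cons.prems(6)[unfolded stable_pair_def, rule_format]
  define K where "K n = A n \<inter> colon_ideal R (B (Suc n)) {x}" for n
  define A' where "A' n = A (Suc n)" for n
  define B' where "B' n = scale x (A n) \<boxplus> B (Suc n)" for n
  have K_iff: "a \<in> K n \<longleftrightarrow> a \<in> A n \<and> a \<otimes> x \<in> B (Suc n)" for a n
    using idealD(2)[OF A(1)] by (auto simp: K_def colon_ideal_def)
  have id: "ideal (K n) R" "ideal (A' n) R" "ideal (B' n) R" for n
    unfolding K_def A'_def B'_def using A B x
    by (auto intro!: i_intersect colon_ideal_ideal add_ideals scale_ideal)
  have sub: "B n \<subseteq> K n" "K n \<subseteq> A n" "B (Suc n) \<subseteq> B' n" "B' n \<subseteq> A' n" for n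
  proof -
    show "B n \<subseteq> K n"
    proof
      fix b assume b: "b \<in> B n"
      then have "x \<otimes> b \<in> B (Suc n)" using B(2) by auto
      then show "b \<in> K n" using K_iff BA b x idealD(2)[OF B(1) b] m_comm by auto
    qed
    show "K n \<subseteq> A n" by (auto simp: K_def)
    show "B (Suc n) \<subseteq> B' n" unfolding B'_def by (intro sum_upper2 scale_ideal x A B)
    show "B' n \<subseteq> A' n" unfolding B'_def A'_def using BA A by (intro sum_least A) auto
  qed
  have xA: "x \<otimes> a \<in> B' n" if "a \<in> A n" for a n
    using sum_upper1[OF scale_ideal[OF x A(1)] B(1)] that unfolding B'_def by blast
  have fin1: "fin_len (B n) (K n)" "fin_len (K n) (A n)"
    "len (B n) (A n) = len (B n) (K n) + len (K n) (A n)" for n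
  proof -
    show *: "fin_len (B n) (K n)" "fin_len (K n) (A n)"
      by (rule fin_len_sub[OF fin B(1) id(1) A(1) sub(1,2)])+
    show "len (B n) (A n) = len (B n) (K n) + len (K n) (A n)"
      by (rule len_add(1)[OF B(1) id(1) A(1) sub(1,2) *])
  qed
  have fin2: "fin_len (B (Suc n)) (B' n)" "fin_len (B' n) (A' n)"
    "len (B (Suc n)) (A (Suc n)) = len (B (Suc n)) (B' n) + len (B' n) (A' n)" for n
  proof -
    show *: "fin_len (B (Suc n)) (B' n)" "fin_len (B' n) (A' n)"
      using fin_len_sub[OF fin B(1) id(3) A(1), of "Suc n" n] sub(3,4) by (auto simp: A'_def)
    show "len (B (Suc n)) (A (Suc n)) = len (B (Suc n)) (B' n) + len (B' n) (A' n)"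
      using len_add(1)[OF B(1) id(3,2) sub(3,4) *] by (simp add: A'_def)
  qed
  \<comment> \<open>Coimage and image of the multiplication by \<open>x\<close> have equal length
    and cancel in the first difference.\<close>
  have eq: "len (K n) (A n) = len (B (Suc n)) (B' n)" for n
    using len_scale[OF A(1) B(1) x, of _ n "Suc n"] by (simp add: len_def K_def B'_def)
  have "evpoly (length xs) (\<lambda>n. int (len (B n) (K n)))"
  proof (rule Cons.IH[OF xs _ _ sub(1) fin1(1)])
    show "graded_family xs B" using B by (auto simp: graded_family_def)
    show "graded_family xs K"
      unfolding graded_family_def
    proof (intro conjI allI ballI id)
      fix n y c assume yc: "y \<in> set xs" "c \<in> K n"
      then have c: "c \<in> A n" "c \<otimes> x \<in> B (Suc n)" by (auto simp: K_iff)
      then have "y \<otimes> (c \<otimes> x) \<in> B (Suc (Suc n))" "y \<otimes> c \<in> A (Suc n)" using yc A B by auto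
      moreover have "y \<in> carrier R" "c \<in> carrier R" using yc xs idealD(2)[OF A(1) c(1)] by auto
      ultimately show "y \<otimes> c \<in> K (Suc n)" using x by (auto simp: K_iff m_assoc)
    qed
    \<comment> \<open>As \<open>C \<subseteq> K\<close>, multiplication by \<open>x\<close> maps
      \<open>C\<close> into \<open>B\<close>. So \<open>C\<close> is also graded for
      \<open>x # xs\<close>, and products with \<open>x\<close> are absorbed by
      \<open>B (Suc n)\<close>.\<close>
    show "stable_pair xs K B"
      unfolding stable_pair_def
    proof (intro allI impI)
      fix C assume C: "graded_family xs C" "\<forall>n. B n \<subseteq> C n \<and> C n \<subseteq> K n"
      have Cid: "ideal (C n) R" for n using C by (auto simp: graded_family_def)
      have xC: "x \<otimes> c \<in> B (Suc n)" if "c \<in> C n" for c n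
      proof -
        have "c \<in> K n" using C that by blast
        then show ?thesis using K_iff x idealD(2)[OF id(1)] m_comm by auto
      qed
      then have "x \<otimes> c \<in> C (Suc n)" if "c \<in> C n" for c n using C(2) that by blast
      then have "graded_family (x # xs) C"
        using C(1) by (auto simp: graded_family_def)
      then have "\<exists>N. \<forall>n\<ge>N. C (Suc n) \<subseteq> Idl (B (Suc n) \<union> gen (x # xs) (C n))"
        using C(2) sub(2) by (intro stable) blast+
      moreover have "Idl (B (Suc n) \<union> gen (x # xs) (C n)) \<subseteq> Idl (B (Suc n) \<union> gen xs (C n))" for n
      proof -
        have s: "B (Suc n) \<union> gen xs (C n) \<subseteq> carrier R"
          using ideal_subset[OF B(1)] ideal_subset[OF gen_ideal[OF xs ideal_subset[OF Cid]]] by auto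
        have i: "ideal (Idl (B (Suc n) \<union> gen xs (C n))) R" by (rule genideal_ideal[OF s])
        have "gen (x # xs) (C n) \<subseteq> Idl (B (Suc n) \<union> gen xs (C n))"
          using genideal_self[OF s] xC gen_mem[OF xs ideal_subset[OF Cid]]
          by (intro gen_least i) auto
        then show ?thesis using genideal_self[OF s] by (intro genideal_minimal i) auto
      qed
      ultimately show "\<exists>N. \<forall>n\<ge>N. C (Suc n) \<subseteq> Idl (B (Suc n) \<union> gen xs (C n))"
        by (meson order_trans)
    qed
  qed
  moreover have "evpoly (length xs) (\<lambda>n. int (len (B' n) (A' n)))"
  proof (rule Cons.IH[OF xs _ _ sub(4) fin2(2)])
    show "graded_family xs A'" using A by (auto simp: graded_family_def A'_def)
    show "graded_family xs B'"
      unfolding graded_family_def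
    proof (intro conjI allI ballI id)
      fix n y c assume yc: "y \<in> set xs" "c \<in> B' n"
      then obtain a b where ab: "a \<in> A n" "b \<in> B (Suc n)" "c = x \<otimes> a \<oplus> b"
        by (auto simp: B'_def elim!: sum_memE)
      have carr: "a \<in> carrier R" "b \<in> carrier R" "y \<in> carrier R"
        using yc xs idealD(2)[OF A(1) ab(1)] idealD(2)[OF B(1) ab(2)] by auto
      have "y \<otimes> c = x \<otimes> (y \<otimes> a) \<oplus> y \<otimes> b" unfolding ab(3) using carr x by algebra
      then show "y \<otimes> c \<in> B' (Suc n)"
        unfolding B'_def using A(2)[OF _ ab(1), of y] B(2)[OF _ ab(2), of y] yc(1)
        by (auto intro!: sum_memI)
    qed
    show "stable_pair xs A' B'"
      unfolding stable_pair_def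
    proof (intro allI impI)
      fix C assume C: "graded_family xs C" "\<forall>n. B' n \<subseteq> C n \<and> C n \<subseteq> A' n"
      have Cid: "ideal (C n) R" for n using C by (auto simp: graded_family_def)
      have xC: "x \<otimes> c \<in> B' (Suc n)" if "c \<in> C n" for c n
        using C(2) that by (intro xA) (auto simp: A'_def)
      \<comment> \<open>\<open>A'\<close> is \<open>A\<close> moved down by one degree, so
        \<open>C\<close> is moved back up to lie between \<open>B\<close> and \<open>A\<close>. The
        vacant degree is filled with \<open>B 0\<close>, whose multiples lie in
        \<open>B 1 \<subseteq> B' 0 \<subseteq> C 0\<close>.\<close>
      define C' where "C' = case_nat (B 0) C"
      have "graded_family (x # xs) C'"
        unfolding graded_family_def
      proof (intro conjI allI ballI)
        fix n
        show "ideal (C' n) R" using B Cid by (auto simp: C'_def split: nat.splits)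
        fix y c assume yc: "y \<in> set (x # xs)" "c \<in> C' n"
        show "y \<otimes> c \<in> C' (Suc n)"
        proof (cases n)
          case 0
          then have "y \<otimes> c \<in> B 1" using yc B(2)[of y c 0] by (auto simp: C'_def)
          then have "y \<otimes> c \<in> C 0" using sub(3)[of 0] C(2) by auto
          then show ?thesis using 0 by (simp add: C'_def)
        next
          case (Suc k)
          then have "c \<in> C k" using yc by (simp add: C'_def)
          then have "y \<otimes> c \<in> C (Suc k)"
            using yc(1) xC[of c k] C by (auto simp: graded_family_def)
          then show ?thesis using Suc by (simp add: C'_def)
        qed
      qed
      moreover have "B n \<subseteq> C' n \<and> C' n \<subseteq> A n" for n
      proof (cases n)
        case (Suc k)
        have "B n \<subseteq> B' k" "B' k \<subseteq> C k" "C k \<subseteq> A n"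
          using sub(3)[of k] C(2) Suc by (auto simp: A'_def)
        then show ?thesis using Suc by (auto simp: C'_def)
      qed (use BA in \<open>auto simp: C'_def\<close>)
      ultimately have "\<exists>N. \<forall>n\<ge>N. C' (Suc n) \<subseteq> Idl (B (Suc n) \<union> gen (x # xs) (C' n))"
        by (intro stable) auto
      then obtain N where N: "\<And>n. n \<ge> N \<Longrightarrow> C' (Suc n) \<subseteq> Idl (B (Suc n) \<union> gen (x # xs) (C' n))"
        by auto
      have "C (Suc n) \<subseteq> Idl (B' (Suc n) \<union> gen xs (C n))" if "n \<ge> N" for n
      proof -
        have s: "B' (Suc n) \<union> gen xs (C n) \<subseteq> carrier R"
          using ideal_subset[OF id(3)] ideal_subset[OF gen_ideal[OF xs ideal_subset[OF Cid]]] by auto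
        have i: "ideal (Idl (B' (Suc n) \<union> gen xs (C n))) R" by (rule genideal_ideal[OF s])
        have "gen (x # xs) (C n) \<subseteq> Idl (B' (Suc n) \<union> gen xs (C n))"
          using genideal_self[OF s] xC gen_mem[OF xs ideal_subset[OF Cid]]
          by (intro gen_least i) auto
        then have "Idl (B (Suc (Suc n)) \<union> gen (x # xs) (C n)) \<subseteq> Idl (B' (Suc n) \<union> gen xs (C n))"
          using genideal_self[OF s] sub(3)[of "Suc n"] by (intro genideal_minimal i) auto
        then show ?thesis using N[of "Suc n"] that by (auto simp: C'_def)
      qed
      then show "\<exists>N. \<forall>n\<ge>N. C (Suc n) \<subseteq> Idl (B' (Suc n) \<union> gen xs (C n))" by auto
    qed
  qed
  ultimately have "evpoly (length xs) (\<lambda>n. int (len (B' n) (A' n)) - int (len (B n) (K n)))"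
    by (intro evpoly_diff)
  moreover have "int (len (B (Suc n)) (A (Suc n))) - int (len (B n) (A n)) =
      int (len (B' n) (A' n)) - int (len (B n) (K n))" for n
    using fin1(3)[of n] fin2(3)[of n] eq[of n] by simp
  ultimately show ?case by simp
qed

text \<open>Every graded family between \<open>B\<close> and the powers lies in the Rees algebra,
  where \<open>rees_noetherian\<close> applies. It is used for \<open>B n = K^(n+1)\<close>, the
  associated graded ring, and for \<open>B n = m K^n\<close>, the special fiber.\<close>

lemma hilbert_function_evpoly:
  assumes "set xs \<subseteq> carrier R" "graded_family xs B"
    and "\<And>n. B n \<subseteq> ideal_pow R (Idl (set xs)) n"
    and "\<And>n. fin_len (B n) (ideal_pow R (Idl (set xs)) n)"
  shows "evpoly (length xs) (\<lambda>n. int (len (B n) (ideal_pow R (Idl (set xs)) n)))"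
proof (rule hilbert_serre[OF assms(1) _ assms(2-4)])
  have id: "ideal (Idl (set xs)) R" by (rule genideal_ideal[OF assms(1)])
  show "graded_family xs (ideal_pow R (Idl (set xs)))"
    unfolding graded_family_def
    using pow_ideal[OF id] genideal_self[OF assms(1)] by (auto intro!: ideal_prod.prod)
  show "stable_pair xs (ideal_pow R (Idl (set xs))) B"
    unfolding stable_pair_def
  proof (intro allI impI)
    fix C assume C: "graded_family xs C" "\<forall>n. B n \<subseteq> C n \<and> C n \<subseteq> ideal_pow R (Idl (set xs)) n"
    have "C n \<subseteq> deg_part xs n" for n using C(2) pow_subset_deg_part[OF assms(1)] by blast
    then obtain N where N: "\<And>n. n \<ge> N \<Longrightarrow> C (Suc n) \<subseteq> gen xs (C n)"
      using rees_noetherian[OF assms(1) C(1)] by blast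
    have "gen xs (C n) \<subseteq> Idl (B (Suc n) \<union> gen xs (C n))" for n
    proof -
      have "B (Suc n) \<union> gen xs (C n) \<subseteq> carrier R"
        using assms(2) C gen_ideal[OF assms(1)] ideal_subset by (auto simp: graded_family_def)
      then show ?thesis using genideal_self by blast
    qed
    then show "\<exists>N. \<forall>n\<ge>N. C (Suc n) \<subseteq> Idl (B (Suc n) \<union> gen xs (C n))"
      using N by (meson order_trans)
  qed
qed

end

section \<open>Coefficients of eventually polynomial functions\<close>

text \<open>This basis is the one of the Hilbert coefficients, and it keeps the coefficients
  integral.\<close>

definition binomial_poly :: "nat \<Rightarrow> (nat \<Rightarrow> int) \<Rightarrow> bool" where
  "binomial_poly r f \<longleftrightarrow>
     (\<exists>a. \<forall>\<^sub>F n in sequentially. f n = (\<Sum>k<r. a k * int ((n + k) choose k)))"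

lemma evpoly_imp_binomial_poly: "evpoly r f \<Longrightarrow> binomial_poly r f"
proof (induction r arbitrary: f)
  case 0
  then show ?case by (simp add: binomial_poly_def)
next
  case (Suc r)
  \<comment> \<open>Backward differences fit the basis: \<open>(n + k choose k)\<close> is the
    backward difference of \<open>(n + k + 1 choose k + 1)\<close>. What remains after subtracting
    those terms is eventually constant and becomes the coefficient of index
    \<open>0\<close>.\<close>
  define g where "g n = f n - f (n - 1)" for n
  have "evpoly r (\<lambda>n. g (Suc n))" using Suc.prems by (simp add: g_def)
  then have "evpoly r g" by (simp only: evpoly_shift)
  then obtain b where b: "\<forall>\<^sub>F n in sequentially. g n = (\<Sum>k<r. b k * int ((n + k) choose k))"
    using Suc.IH by (auto simp: binomial_poly_def)
  define h where "h n = f n - (\<Sum>k<r. b k * int ((n + Suc k) choose Suc k))" for n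
  have "\<forall>\<^sub>F n in sequentially. h (Suc n) = h n"
    using b[unfolded eventually_sequentially_Suc[symmetric, of "\<lambda>n. g n = _ n"]]
  proof eventually_elim
    case (elim n)
    have "f (Suc n) - f n = (\<Sum>k<r. b k * int ((Suc n + k) choose k))"
      using elim by (simp add: g_def)
    also have "\<dots> = (\<Sum>k<r. b k * int ((Suc n + Suc k) choose Suc k)) - (\<Sum>k<r. b k * int ((n + Suc k) choose Suc k))"
      unfolding sum_subtractf[symmetric] by (intro sum.cong) (auto simp: algebra_simps)
    finally show ?case by (simp add: h_def)
  qed
  then obtain N where N: "\<And>n. n \<ge> N \<Longrightarrow> h (Suc n) = h n"
    by (auto simp: eventually_sequentially)
  have hN: "h n = h N" if "n \<ge> N" for n
    using that by (induction n rule: dec_induct) (auto simp: N)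
  have "f n = (\<Sum>k<Suc r. case_nat (h N) b k * int ((n + k) choose k))" if "n \<ge> N" for n
    unfolding sum.lessThan_Suc_shift using hN[OF that] by (simp add: h_def[of n])
  then show ?case unfolding binomial_poly_def eventually_sequentially by blast
qed

lemma binomial_poly_Suc: "binomial_poly r f \<Longrightarrow> binomial_poly (Suc r) f"
proof -
  assume "binomial_poly r f"
  then obtain a where "\<forall>\<^sub>F n in sequentially. f n = (\<Sum>k<r. a k * int ((n + k) choose k))"
    by (auto simp: binomial_poly_def)
  then have "\<forall>\<^sub>F n in sequentially. f n = (\<Sum>k<Suc r. (a(r := 0)) k * int ((n + k) choose k))"
    by eventually_elim auto
  then show ?thesis unfolding binomial_poly_def by blast
qed

lemma binomial_poly_mono: "r \<le> s \<Longrightarrow> binomial_poly r f \<Longrightarrow> binomial_poly s f"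
  by (induction s rule: dec_induct) (auto intro: binomial_poly_Suc)

section \<open>Growth rates and leading coefficients\<close>

lemma tendsto_inverse_power_nat: "0 < k \<Longrightarrow> (\<lambda>n. 1 / real n ^ k) \<longlonglongrightarrow> 0"
  using tendsto_power[OF lim_inverse_n, of k] by (simp add: power_one_over inverse_eq_divide zero_power)

lemma tendsto_null_comparison:
  fixes f g :: "nat \<Rightarrow> real"
  assumes "\<forall>\<^sub>F n in sequentially. norm (f n) \<le> g n" "g \<longlonglongrightarrow> 0"
  shows "f \<longlonglongrightarrow> 0"
  by (rule tendsto_0_le[OF assms(2), of _ 1]) (use assms(1) in \<open>auto elim: eventually_mono\<close>)

lemma tendsto_binomial_div_power:
  "(\<lambda>n. real ((n + k) choose k) / real n ^ k) \<longlonglongrightarrow> 1 / fact k"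
proof (induction k)
  case 0
  then show ?case by simp
next
  case (Suc k)
  have "(\<lambda>n. 1 + (real k + 1) * (1 / real n ^ 1)) \<longlonglongrightarrow> 1 + (real k + 1) * 0"
    by (intro tendsto_intros tendsto_inverse_power_nat) auto
  then have "(\<lambda>n. real ((n + k) choose k) / real n ^ k * ((1 + (real k + 1) * (1 / real n ^ 1)) / (real k + 1)))
      \<longlonglongrightarrow> 1 / fact k * (1 / (real k + 1))"
    by (intro tendsto_mult Suc tendsto_divide tendsto_const) auto
  moreover have "\<forall>\<^sub>F n in sequentially. real ((n + k) choose k) / real n ^ k *
      ((1 + (real k + 1) * (1 / real n ^ 1)) / (real k + 1)) = real ((n + Suc k) choose Suc k) / real n ^ Suc k"
    using eventually_gt_at_top[of 0]
  proof eventually_elim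
    case (elim n)
    have "Suc k * ((n + Suc k) choose Suc k) = (n + Suc k) * ((n + k) choose k)"
      using Suc_times_binomial[of k "n + k"] by simp
    then have "real (Suc k) * real ((n + Suc k) choose Suc k) = real (n + Suc k) * real ((n + k) choose k)"
      unfolding of_nat_mult[symmetric] by (rule arg_cong)
    then have "real ((n + Suc k) choose Suc k) = real (n + Suc k) * real ((n + k) choose k) / real (Suc k)"
      by (simp add: eq_divide_eq ac_simps)
    moreover have "1 + (real k + 1) * (1 / real n ^ 1) = real (n + Suc k) / real n"
      using elim by (simp add: add_divide_distrib)
    ultimately show ?case by (simp add: ac_simps)
  qed
  ultimately have "(\<lambda>n. real ((n + Suc k) choose Suc k) / real n ^ Suc k) \<longlonglongrightarrow> 1 / fact k * (1 / (real k + 1))"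
    by (rule Lim_transform_eventually)
  then show ?case by (simp add: algebra_simps)
qed

lemma tendsto_binomial_div_larger_power:
  assumes "k < d"
  shows "(\<lambda>n. real ((n + k) choose k) / real n ^ d) \<longlonglongrightarrow> 0"
proof -
  have "(\<lambda>n. real ((n + k) choose k) / real n ^ k * (1 / real n ^ (d - k))) \<longlonglongrightarrow> 1 / fact k * 0"
    using assms by (intro tendsto_mult tendsto_binomial_div_power tendsto_inverse_power_nat) auto
  moreover have "real ((n + k) choose k) / real n ^ k * (1 / real n ^ (d - k)) = real ((n + k) choose k) / real n ^ d" for n
    using assms by (simp flip: power_add)
  ultimately show ?thesis by simp
qed

lemma tendsto_leading_coeff:
  assumes "\<forall>\<^sub>F n in sequentially. f n = (\<Sum>k<Suc d. a k * int ((n + k) choose k))"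
  shows "(\<lambda>n. real_of_int (f n) / real n ^ d) \<longlonglongrightarrow> real_of_int (a d) / fact d"
proof -
  have "(\<lambda>n. \<Sum>k<Suc d. real_of_int (a k) * (real ((n + k) choose k) / real n ^ d))
      \<longlonglongrightarrow> (\<Sum>k<Suc d. real_of_int (a k) * (if k = d then 1 / fact d else 0))"
    by (intro tendsto_sum tendsto_mult tendsto_const)
      (auto intro: tendsto_binomial_div_power tendsto_binomial_div_larger_power)
  also have "(\<Sum>k<Suc d. real_of_int (a k) * (if k = d then 1 / fact d else 0)) = real_of_int (a d) / fact d"
    by simp
  finally have "(\<lambda>n. \<Sum>k<Suc d. real_of_int (a k) * (real ((n + k) choose k) / real n ^ d))
      \<longlonglongrightarrow> real_of_int (a d) / fact d" .
  moreover have "\<forall>\<^sub>F n in sequentially. real_of_int (f n) / real n ^ d =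
      (\<Sum>k<Suc d. real_of_int (a k) * (real ((n + k) choose k) / real n ^ d))"
    using assms by eventually_elim (simp add: sum_divide_distrib add_divide_distrib)
  ultimately show ?thesis by (simp only: tendsto_cong)
qed

lemma binomial_poly_bound:
  assumes "binomial_poly (Suc d) f"
  shows "\<exists>C\<ge>0. \<forall>\<^sub>F n in sequentially. \<bar>real_of_int (f n)\<bar> \<le> C * real n ^ d"
proof -
  obtain a where "\<forall>\<^sub>F n in sequentially. f n = (\<Sum>k<Suc d. a k * int ((n + k) choose k))"
    using assms by (auto simp: binomial_poly_def)
  then have "(\<lambda>n. real_of_int (f n) / real n ^ d) \<longlonglongrightarrow> real_of_int (a d) / fact d"
    by (rule tendsto_leading_coeff)
  then have "Bseq (\<lambda>n. real_of_int (f n) / real n ^ d)"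
    by (rule convergent_imp_Bseq[OF convergentI])
  then obtain C where C: "C > 0" "\<And>n. norm (real_of_int (f n) / real n ^ d) \<le> C"
    by (auto elim: BseqE)
  have "\<forall>\<^sub>F n in sequentially. \<bar>real_of_int (f n)\<bar> \<le> C * real n ^ d"
    using eventually_gt_at_top[of 0]
  proof eventually_elim
    case (elim n)
    then show ?case using C(2)[of n] by (simp add: divide_le_eq)
  qed
  then show ?thesis using C(1) by (intro exI[of _ C]) auto
qed

lemma binomial_poly_reduce:
  assumes "binomial_poly r f" "\<forall>\<^sub>F n in sequentially. \<bar>real_of_int (f n)\<bar> \<le> C * real n ^ d"
  shows "binomial_poly (Suc d) f"
  using assms(1)
proof (induction r)
  case 0
  then show ?case using binomial_poly_mono[of 0 "Suc d"] by simp
next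
  case (Suc e)
  show ?case
  proof (cases "e \<le> d")
    case True
    then show ?thesis using binomial_poly_mono[of "Suc e" "Suc d"] Suc.prems by simp
  next
    case False
    obtain a where a: "\<forall>\<^sub>F n in sequentially. f n = (\<Sum>k<Suc e. a k * int ((n + k) choose k))"
      using Suc.prems by (auto simp: binomial_poly_def)
    have "(\<lambda>n. C * (1 / real n ^ (e - d))) \<longlonglongrightarrow> C * 0"
      using False by (intro tendsto_mult tendsto_const tendsto_inverse_power_nat) auto
    then have "(\<lambda>n. C * (1 / real n ^ (e - d))) \<longlonglongrightarrow> 0" by simp
    moreover have "\<forall>\<^sub>F n in sequentially. norm (real_of_int (f n) / real n ^ e) \<le> C * (1 / real n ^ (e - d))"
      using assms(2) eventually_gt_at_top[of 0]
    proof eventually_elim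
      case (elim n)
      have "real n ^ e = real n ^ d * real n ^ (e - d)" using False by (simp flip: power_add)
      then show ?case using elim by (simp add: field_simps)
    qed
    ultimately have "(\<lambda>n. real_of_int (f n) / real n ^ e) \<longlonglongrightarrow> 0"
      by (rule tendsto_null_comparison[rotated])
    then have "real_of_int (a e) / fact e = 0"
      by (rule LIMSEQ_unique[OF tendsto_leading_coeff[OF a]])
    then have "a e = 0" by simp
    then have "binomial_poly e f" using a by (auto simp: binomial_poly_def)
    then show ?thesis by (rule Suc.IH)
  qed
qed

lemma binomial_coeffs_zero:
  assumes "\<forall>\<^sub>F n in sequentially. (\<Sum>k<r. a k * int ((n + k) choose k)) = 0" "k < r"
  shows "a k = 0"
  using assms
proof (induction r)
  case (Suc r)
  have "(\<lambda>n. real_of_int ((\<lambda>_. 0) n) / real n ^ r) \<longlonglongrightarrow> real_of_int (a r) / fact r"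
    using Suc.prems(1) by (intro tendsto_leading_coeff) (auto elim: eventually_mono)
  then have "a r = 0" using LIMSEQ_unique[OF tendsto_const] by fastforce
  then show ?case using Suc by (cases "k = r") auto
qed simp

section \<open>Hilbert coefficients and the fiber multiplicity\<close>

lemma hilbert_sum_reindex:
  "(\<Sum>i\<le>d. (-1)^i * e i * int ((n + d - i) choose (d - i))) =
   (\<Sum>k<Suc d. ((-1)^(d - k) * e (d - k)) * int ((n + k) choose k))"
proof -
  have "(\<Sum>i<Suc d. (\<lambda>k. ((-1)^(d - k) * e (d - k)) * int ((n + k) choose k)) (Suc d - Suc i)) =
     (\<Sum>k<Suc d. ((-1)^(d - k) * e (d - k)) * int ((n + k) choose k))"
    by (rule sum.nat_diff_reindex)
  moreover have "(\<Sum>i<Suc d. (\<lambda>k. ((-1)^(d - k) * e (d - k)) * int ((n + k) choose k)) (Suc d - Suc i)) =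
     (\<Sum>i\<le>d. (-1)^i * e i * int ((n + d - i) choose (d - i)))"
    unfolding lessThan_Suc_atMost by (intro sum.cong) auto
  ultimately show ?thesis by simp
qed

text \<open>The description needs a unique witness: vanishing beyond \<open>d\<close> fixes the
  values that the sum does not see, and \<open>binomial_coeffs_zero\<close> fixes the
  others.\<close>

lemma hilbert_coeff_spec:
  assumes "binomial_poly (Suc d) (\<lambda>n. int (colength R (ideal_pow R K (Suc n))))"
  shows "\<forall>\<^sub>F n in sequentially. int (colength R (ideal_pow R K (Suc n))) =
        (\<Sum>i\<le>d. (-1)^i * hilbert_coeff R d K i * int ((n + d - i) choose (d - i)))"
proof -
  let ?P = "\<lambda>e. (\<forall>i>d. e i = 0) \<and>
     (\<forall>\<^sub>F n in sequentially. int (colength R (ideal_pow R K (Suc n))) =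
        (\<Sum>i\<le>d. (-1)^i * e i * int ((n + d - i) choose (d - i))))"
  obtain a where a: "\<forall>\<^sub>F n in sequentially. int (colength R (ideal_pow R K (Suc n))) =
      (\<Sum>k<Suc d. a k * int ((n + k) choose k))"
    using assms by (auto simp: binomial_poly_def)
  define e where "e i = (if i > d then 0 else (-1)^i * a (d - i))" for i
  have "(\<Sum>i\<le>d. (-1)^i * e i * int ((n + d - i) choose (d - i))) = (\<Sum>k<Suc d. a k * int ((n + k) choose k))" for n
    unfolding hilbert_sum_reindex
    by (intro sum.cong) (auto simp: e_def simp flip: mult.assoc power_add mult_2)
  then have Pe: "?P e" using a by (auto simp: e_def)
  have unique: "e1 = e2" if "?P e1" "?P e2" for e1 e2
  proof
    fix i
    have ev: "\<forall>\<^sub>F n in sequentially. (\<Sum>k<Suc d. ((-1)^(d - k) * (e1 (d - k) - e2 (d - k))) * int ((n + k) choose k)) = 0"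
      using that[THEN conjunct2]
    proof eventually_elim
      case (elim n)
      then have "(\<Sum>k<Suc d. ((-1)^(d - k) * e1 (d - k)) * int ((n + k) choose k)) -
          (\<Sum>k<Suc d. ((-1)^(d - k) * e2 (d - k)) * int ((n + k) choose k)) = 0"
        by (simp only: hilbert_sum_reindex)
      then show ?case by (simp only: sum_subtractf[symmetric] left_diff_distrib right_diff_distrib)
    qed
    show "e1 i = e2 i"
    proof (cases "i > d")
      case False
      then show ?thesis using binomial_coeffs_zero[OF ev, of "d - i"] by simp
    qed (use that in auto)
  qed
  have "\<exists>!e. ?P e" by (rule ex1I[of ?P, OF Pe]) (erule unique[OF _ Pe])
  then show ?thesis unfolding hilbert_coeff_def by (rule theI'[THEN conjunct2])
qed

lemma tendsto_fiber_mult: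
  assumes "binomial_poly d (\<lambda>n. int (mingens R (ideal_pow R K n)))" "d \<ge> 1"
  shows "(\<lambda>n. real (mingens R (ideal_pow R K n)) / real n ^ (d - 1)) \<longlonglongrightarrow>
     real_of_int (fiber_mult R d K) / fact (d - 1)"
proof -
  let ?v = "\<lambda>n. real (mingens R (ideal_pow R K n))"
  let ?P = "\<lambda>f :: int. (\<lambda>n. ?v n - real_of_int f * real ((n + d - 1) choose (d - 1))) \<in> O(\<lambda>n. real n powr (real d - 2))"
  obtain D where d: "d = Suc D" using assms(2) by (cases d) auto
  obtain a where a: "\<forall>\<^sub>F n in sequentially. int (mingens R (ideal_pow R K n)) = (\<Sum>k<Suc D. a k * int ((n + k) choose k))"
    using assms(1) by (auto simp: binomial_poly_def d)
  have lim: "(\<lambda>n. ?v n / real n ^ D) \<longlonglongrightarrow> real_of_int (a D) / fact D"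
    using tendsto_leading_coeff[OF a] by simp
  \<comment> \<open>For \<open>d = 1\<close> the allowed error is \<open>O(1/n)\<close>; there the
    polynomial is constant and the difference vanishes eventually. For larger \<open>d\<close> the
    remaining terms are \<open>O(n^(d-2))\<close>.\<close>
  have ex: "?P (a D)"
  proof (cases D)
    case 0
    have "\<forall>\<^sub>F n in sequentially. ?v n - real_of_int (a D) * real ((n + d - 1) choose (d - 1)) = 0"
      using a by eventually_elim (simp add: 0 d)
    then show ?thesis by (subst landau_o.big.in_cong[where g = "\<lambda>_. 0"]) auto
  next
    case (Suc E)
    have "binomial_poly (Suc E) (\<lambda>n. int (mingens R (ideal_pow R K n)) - a D * int ((n + D) choose D))"
      unfolding binomial_poly_def using a
      by (intro exI[of _ a]) (auto simp: Suc elim!: eventually_mono)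
    then obtain C where "\<forall>\<^sub>F n in sequentially. \<bar>real_of_int (int (mingens R (ideal_pow R K n)) - a D * int ((n + D) choose D))\<bar> \<le> C * real n ^ E"
      using binomial_poly_bound by blast
    then have "\<forall>\<^sub>F n in sequentially. norm (?v n - real_of_int (a D) * real ((n + d - 1) choose (d - 1))) \<le> C * norm (real n powr (real d - 2))"
      using eventually_gt_at_top[of 0]
      by eventually_elim (auto simp: d Suc powr_realpow)
    then show ?thesis by (rule bigoI)
  qed
  \<comment> \<open>Division by \<open>n^(d-1)\<close> removes an error of order
    \<open>n^(d-2)\<close>, so \<open>f / (d-1)!\<close> must be the limit.\<close>
  have uniq: "f = a D" if Pf: "?P f" for f
  proof -
    have 1: "(\<lambda>n. (?v n - real_of_int f * real ((n + D) choose D)) / real n ^ D) \<longlonglongrightarrow> 0"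
    proof -
      obtain C where "\<forall>\<^sub>F n in sequentially. norm (?v n - real_of_int f * real ((n + d - 1) choose (d - 1))) \<le> C * norm (real n powr (real d - 2))"
        using landau_o.bigE[OF Pf] by blast
      then have "\<forall>\<^sub>F n in sequentially. norm ((?v n - real_of_int f * real ((n + D) choose D)) / real n ^ D) \<le> C * (1 / real n ^ 1)"
        using eventually_gt_at_top[of 0]
      proof eventually_elim
        case (elim n)
        have "real n powr (real d - 2) = real n ^ D / real n"
          using elim powr_diff[of "real n" "real D" 1] by (simp add: d powr_realpow)
        then show ?case using elim by (simp add: d divide_le_eq)
      qed
      moreover have "(\<lambda>n. C * (1 / real n ^ 1)) \<longlonglongrightarrow> 0"
        using tendsto_mult[OF tendsto_const tendsto_inverse_power_nat[of 1], of C] by simp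
      ultimately show ?thesis by (rule tendsto_null_comparison)
    qed
    have 2: "(\<lambda>n. ?v n / real n ^ D - real_of_int f * (real ((n + D) choose D) / real n ^ D))
        \<longlonglongrightarrow> real_of_int (a D) / fact D - real_of_int f * (1 / fact D)"
      by (intro tendsto_diff tendsto_mult tendsto_const lim tendsto_binomial_div_power)
    have "real_of_int (a D) / fact D - real_of_int f * (1 / fact D) = 0"
      by (rule LIMSEQ_unique[OF 2]) (use 1 in \<open>simp add: diff_divide_distrib\<close>)
    then show ?thesis by simp
  qed
  have "fiber_mult R d K = a D"
    unfolding fiber_mult_def by (rule the_equality[of ?P, OF ex uniq])
  then show ?thesis using lim by (simp add: d)
qed

text \<open>The shift changes the quotient by the factor \<open>((n + 1 - j) / n)^k\<close>, which
  tends to \<open>1\<close>. Hence all terms \<open>\<nu>(J^(n+1-j))\<close> share one limit after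
  division by \<open>n^(d-1)\<close>.\<close>

lemma tendsto_shifted:
  fixes g :: "nat \<Rightarrow> real"
  assumes "(\<lambda>n. g n / real n ^ k) \<longlonglongrightarrow> L"
  shows "(\<lambda>n. g (Suc n - j) / real n ^ k) \<longlonglongrightarrow> L"
proof -
  have lim: "filterlim (\<lambda>n. Suc n - j) sequentially sequentially"
    unfolding filterlim_at_top
  proof
    fix Z show "\<forall>\<^sub>F n in sequentially. Z \<le> Suc n - j"
      by (rule eventually_sequentiallyI[of "Z + j"]) auto
  qed
  have "(\<lambda>n. 1 + (1 - real j) * (1 / real n ^ 1)) \<longlonglongrightarrow> 1 + (1 - real j) * 0"
    by (intro tendsto_intros tendsto_inverse_power_nat) auto
  then have "(\<lambda>n. g (Suc n - j) / real (Suc n - j) ^ k * (1 + (1 - real j) * (1 / real n ^ 1)) ^ k) \<longlonglongrightarrow> L * 1 ^ k"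
    by (intro tendsto_mult tendsto_power filterlim_compose[OF assms lim]) auto
  moreover have "\<forall>\<^sub>F n in sequentially. g (Suc n - j) / real (Suc n - j) ^ k * (1 + (1 - real j) * (1 / real n ^ 1)) ^ k =
      g (Suc n - j) / real n ^ k"
    using eventually_gt_at_top[of j]
  proof eventually_elim
    case (elim n)
    then have "1 + (1 - real j) * (1 / real n ^ 1) = real (Suc n - j) / real n"
      by (simp add: of_nat_diff add_divide_distrib diff_divide_distrib)
    then show ?case using elim by (simp add: power_divide)
  qed
  ultimately have "(\<lambda>n. g (Suc n - j) / real n ^ k) \<longlonglongrightarrow> L * 1 ^ k"
    by (rule Lim_transform_eventually)
  then show ?thesis by simp
qed

text \<open>Dividing by \<open>n\<^sup>d\<close> shows that the coefficients \<open>e\<^sub>0\<close> agree; then dividing by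
  \<open>n\<^bsup>d-1\<^esup>\<close> compares the coefficients \<open>e\<^sub>1\<close>.\<close>

lemma second_coeff_diff_le:
  fixes F G :: "nat \<Rightarrow> int" and \<nu> :: "nat \<Rightarrow> nat"
  assumes F: "\<forall>\<^sub>F n in sequentially. F n = (\<Sum>i\<le>d. (-1)^i * e i * int ((n + d - i) choose (d - i)))"
    and G: "\<forall>\<^sub>F n in sequentially. G n = (\<Sum>i\<le>d. (-1)^i * e' i * int ((n + d - i) choose (d - i)))"
    and "d \<ge> 1"
    and \<nu>: "(\<lambda>n. real (\<nu> n) / real n ^ (d - 1)) \<longlonglongrightarrow> real_of_int f / fact (d - 1)"
    and le: "\<forall>\<^sub>F n in sequentially. 0 \<le> F n - G n \<and> F n - G n \<le> int c * (\<Sum>j\<in>{1..s}. int (\<nu> (Suc n - j)))"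
  shows "e' 1 - e 1 \<le> int s * int c * f"
proof -
  obtain D where d: "d = Suc D" using assms(3) by (cases d) auto
  \<comment> \<open>The coefficients of \<open>F - G\<close>: \<open>a d\<close> is
    \<open>e 0 - e' 0\<close>, while the alternating sign turns \<open>a (d - 1)\<close> into
    \<open>e' 1 - e 1\<close>.\<close>
  define a where "a k = (-1)^(d - k) * (e (d - k) - e' (d - k))" for k
  have H: "\<forall>\<^sub>F n in sequentially. F n - G n = (\<Sum>k<Suc d. a k * int ((n + k) choose k))"
    using F G
  proof eventually_elim
    case (elim n)
    show ?case
      unfolding elim hilbert_sum_reindex sum_subtractf[symmetric]
      by (intro sum.cong) (auto simp: a_def algebra_simps)
  qed
  define B where "B n = real c * (\<Sum>j\<in>{1..s}. real (\<nu> (Suc n - j)))" for n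
  have leB: "\<forall>\<^sub>F n in sequentially. 0 \<le> real_of_int (F n - G n) \<and> real_of_int (F n - G n) \<le> B n"
    using le
  proof eventually_elim
    case (elim n)
    have "B n = real_of_int (int c * (\<Sum>j\<in>{1..s}. int (\<nu> (Suc n - j))))"
      by (simp add: B_def)
    then show ?case using elim by (simp only: of_int_le_iff of_int_0_le_iff)
  qed
  have Blim: "(\<lambda>n. B n / real n ^ D) \<longlonglongrightarrow> real c * (\<Sum>j\<in>{1..s}. real_of_int f / fact D)"
  proof -
    have "(\<lambda>n. real c * (\<Sum>j\<in>{1..s}. real (\<nu> (Suc n - j)) / real n ^ D)) \<longlonglongrightarrow> real c * (\<Sum>j\<in>{1..s}. real_of_int f / fact D)"
      using \<nu> by (intro tendsto_mult tendsto_const tendsto_sum tendsto_shifted[of "\<lambda>n. real (\<nu> n)"]) (simp add: d)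
    then show ?thesis unfolding B_def by (simp add: sum_divide_distrib[symmetric])
  qed
  have "a d = 0"
  proof -
    have "(\<lambda>n. B n / real n ^ D * (1 / real n ^ 1)) \<longlonglongrightarrow> real c * (\<Sum>j\<in>{1..s}. real_of_int f / fact D) * 0"
      by (intro tendsto_mult Blim tendsto_inverse_power_nat) auto
    then have "(\<lambda>n. B n / real n ^ d) \<longlonglongrightarrow> 0" by (simp add: d mult.commute)
    moreover have "\<forall>\<^sub>F n in sequentially. norm (real_of_int (F n - G n) / real n ^ d) \<le> B n / real n ^ d"
      using leB by eventually_elim (simp add: divide_right_mono)
    ultimately have "(\<lambda>n. real_of_int (F n - G n) / real n ^ d) \<longlonglongrightarrow> 0"
      by (rule tendsto_null_comparison[rotated])
    then have "real_of_int (a d) / fact d = 0"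
      by (rule LIMSEQ_unique[OF tendsto_leading_coeff[OF H]])
    then show ?thesis by simp
  qed
  then have "\<forall>\<^sub>F n in sequentially. F n - G n = (\<Sum>k<Suc D. a k * int ((n + k) choose k))"
    using H by (simp add: d)
  then have "(\<lambda>n. real_of_int (F n - G n) / real n ^ D) \<longlonglongrightarrow> real_of_int (a D) / fact D"
    by (rule tendsto_leading_coeff)
  moreover have "\<forall>\<^sub>F n in sequentially. real_of_int (F n - G n) / real n ^ D \<le> B n / real n ^ D"
    using leB by eventually_elim (simp add: divide_right_mono)
  ultimately have "real_of_int (a D) / fact D \<le> real c * (\<Sum>j\<in>{1..s}. real_of_int f / fact D)"
    by (rule tendsto_le[OF trivial_limit_sequentially Blim])
  also have "\<dots> = real_of_int (int s * int c * f) / fact D" by simp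
  finally have "real_of_int (a D) \<le> real_of_int (int s * int c * f)"
    by (simp add: divide_le_cancel)
  then have "a D \<le> int s * int c * f" by (simp only: of_int_le_iff)
  moreover have "a D = e' 1 - e 1" by (simp add: a_def d)
  ultimately show ?thesis by simp
qed

lemma binomial_poly_difference:
  assumes "binomial_poly (Suc d) f"
  shows "binomial_poly d (\<lambda>n. f n - f (n - 1))"
proof -
  obtain a where a: "\<forall>\<^sub>F n in sequentially. f n = (\<Sum>k<Suc d. a k * int ((n + k) choose k))"
    using assms by (auto simp: binomial_poly_def)
  have "\<forall>\<^sub>F n in sequentially. f (Suc n) - f n = (\<Sum>k<d. a (Suc k) * int ((Suc n + k) choose k))"
    using a a[unfolded eventually_sequentially_Suc[symmetric, of "\<lambda>n. f n = _ n"]]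
  proof eventually_elim
    case (elim n)
    have "f (Suc n) - f n = (\<Sum>k<d. a (Suc k) * (int ((Suc n + Suc k) choose Suc k) - int ((n + Suc k) choose Suc k)))"
      unfolding elim sum.lessThan_Suc_shift
      by (simp add: sum_subtractf right_diff_distrib del: binomial_Suc_Suc)
    also have "\<dots> = (\<Sum>k<d. a (Suc k) * int ((Suc n + k) choose k))"
      by (intro sum.cong) auto
    finally show ?case .
  qed
  then have "\<forall>\<^sub>F n in sequentially. f n - f (n - 1) = (\<Sum>k<d. a (Suc k) * int ((n + k) choose k))"
    by (subst eventually_sequentially_Suc[symmetric]) simp
  then show ?thesis unfolding binomial_poly_def by (intro exI)
qed

context cring
begin

lemma prime_pow_mem:
  assumes "primeideal P R" "x \<in> carrier R" "x [^] (n::nat) \<in> P"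
  shows "x \<in> P"
  using assms(3)
proof (induction n)
  case 0
  then show ?case
    using primeideal.I_notcarr[OF assms(1)] ideal.one_imp_carrier[OF primeideal.axioms(1)[OF assms(1)]] by auto
next
  case (Suc n)
  then show ?case using primeideal.I_prime[OF assms(1), of "x [^] n" x] assms(2) by auto
qed

section \<open>Reductions by one element\<close>

context
  fixes J h I
  assumes J: "ideal J R" and h: "h \<in> carrier R"
  defines "I \<equiv> Idl (J \<union> {h})"
begin

lemma ext_eq: "I = scale h (carrier R) \<boxplus> J"
  using Idl_insert[OF h ideal_subset[OF J]] Idl_ideal[OF J] by (simp add: I_def)

lemma ext_ideal: "ideal I R"
  unfolding I_def using h ideal_subset[OF J] by (intro genideal_ideal) auto

lemma ext_subset: "J \<subseteq> I" "h \<in> I"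
  using genideal_self[of "J \<union> {h}"] h ideal_subset[OF J] by (auto simp: I_def)

text \<open>When a product of \<open>n + 1\<close> elements of \<open>(h) + J\<close> is expanded,
  only the multiple of \<open>h^(n+1)\<close> has no factor from \<open>J\<close>.\<close>

lemma pow_ext_subset:
  "ideal_pow R I (Suc n) \<subseteq> scale (h [^] Suc n) (carrier R) \<boxplus> (J \<cdot> ideal_pow R I n)"
proof (induction n)
  case 0
  show ?case using ext_eq ideal_prod_one[OF J] ideal_prod_one[OF ext_ideal] h by simp
next
  case (Suc n)
  let ?T = "scale (h [^] Suc (Suc n)) (carrier R) \<boxplus> (J \<cdot> ideal_pow R I (Suc n))"
  note pw = pow_ideal[OF ext_ideal]
  note JI = ideal_prod_is_ideal[OF J pw]
  have hn: "h [^] k \<in> carrier R" for k :: nat using h by simp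
  have T: "ideal ?T R" by (intro add_ideals scale_ideal oneideal JI hn)
  have "x \<otimes> y \<in> ?T" if xy: "x \<in> I" "y \<in> ideal_pow R I (Suc n)" for x y
  proof -
    obtain r j where x: "r \<in> carrier R" "j \<in> J" "x = h \<otimes> r \<oplus> j"
      using xy(1) unfolding ext_eq by (elim sum_memE imageE) metis
    obtain r' w where y: "r' \<in> carrier R" "w \<in> J \<cdot> ideal_pow R I n" "y = h [^] Suc n \<otimes> r' \<oplus> w"
      using subsetD[OF Suc xy(2)] by (elim sum_memE imageE) metis
    have carr: "j \<in> carrier R" "w \<in> carrier R" "y \<in> carrier R" "h [^] Suc n \<in> carrier R"
      by (rule idealD(2)[OF J x(2)], rule idealD(2)[OF JI y(2)], rule idealD(2)[OF pw xy(2)], rule hn)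
    have "x \<otimes> y = h \<otimes> r \<otimes> y \<oplus> j \<otimes> y"
      unfolding x(3) using x(1) h carr(1,3) by algebra
    moreover have "h \<otimes> r \<otimes> (p \<otimes> r' \<oplus> w) = (p \<otimes> h) \<otimes> (r \<otimes> r') \<oplus> r \<otimes> (h \<otimes> w)"
      if "p \<in> carrier R" for p
      using that x(1) y(1) h carr(2) by algebra
    from this[OF carr(4)] have "h \<otimes> r \<otimes> y = h [^] Suc (Suc n) \<otimes> (r \<otimes> r') \<oplus> r \<otimes> (h \<otimes> w)"
      by (simp only: y(3) nat_pow_Suc)
    ultimately have eq: "x \<otimes> y = (h [^] Suc (Suc n) \<otimes> (r \<otimes> r') \<oplus> r \<otimes> (h \<otimes> w)) \<oplus> j \<otimes> y"
      by (simp only:)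
    have jy: "j \<otimes> y \<in> J \<cdot> ideal_pow R I (Suc n)" using x(2) xy(2) by (rule ideal_prod.prod)
    have "J \<cdot> ideal_pow R I n \<subseteq> colon_ideal R (J \<cdot> ideal_pow R I (Suc n)) {h}"
    proof (rule ideal_prod_least)
      show "ideal (colon_ideal R (J \<cdot> ideal_pow R I (Suc n)) {h}) R"
        using h by (intro colon_ideal_ideal JI) auto
      fix a b assume ab: "a \<in> J" "b \<in> ideal_pow R I n"
      have "h \<otimes> b \<in> ideal_pow R I (Suc n)"
        using ideal_prod.prod[OF ext_subset(2) ab(2)] by simp
      then have "a \<otimes> (h \<otimes> b) \<in> J \<cdot> ideal_pow R I (Suc n)" using ab(1) by (intro ideal_prod.prod)
      then show "a \<otimes> b \<in> colon_ideal R (J \<cdot> ideal_pow R I (Suc n)) {h}"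
        using h idealD(2)[OF J ab(1)] idealD(2)[OF pw ab(2)]
        by (simp add: colon_ideal_def m_assoc m_comm[of b h])
    qed
    then have "h \<otimes> w \<in> J \<cdot> ideal_pow R I (Suc n)"
      using y(2) m_comm[OF h carr(2)] by (auto simp: colon_ideal_def)
    then have rw: "r \<otimes> (h \<otimes> w) \<in> J \<cdot> ideal_pow R I (Suc n)" using idealD(6)[OF JI _ x(1)] by blast
    have "h [^] Suc (Suc n) \<otimes> (r \<otimes> r') \<oplus> r \<otimes> (h \<otimes> w) \<in> ?T"
      using x(1) y(1) by (intro sum_memI[OF imageI rw]) auto
    moreover have "j \<otimes> y \<in> ?T"
      using sum_upper2[OF scale_ideal[OF hn[of "Suc (Suc n)"] oneideal] JI[of "Suc n"]] jy by blast
    ultimately show ?thesis unfolding eq by (rule idealD(3)[OF T])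
  qed
  then show ?case by (subst ideal_pow.simps(2)) (rule ideal_prod_least[OF T])
qed

text \<open>An integral equation of degree \<open>s + 1\<close> writes \<open>h^(s+1)\<close> as a
  sum of terms in \<open>J^i I^(s+1-i)\<close> with \<open>i \<ge> 1\<close>, all of which lie in
  \<open>J I^s\<close>. By \<open>pow_ext_subset\<close> all of \<open>I^(s+1)\<close> then lies
  there.\<close>

lemma integral_reduction:
  assumes "integral_over R J h"
  shows "\<exists>s. ideal_pow R I (Suc s) = J \<cdot> ideal_pow R I s"
proof -
  note pw = pow_ideal[OF ext_ideal]
  note JI = ideal_prod_is_ideal[OF J pw]
  obtain k a where k: "k \<ge> 1" "\<forall>i\<in>{1..k}. a i \<in> ideal_pow R J i"
     "h [^] k \<oplus> (finsum R (\<lambda>i. a i \<otimes> h [^] (k - i)) {1..k}) = \<zero>"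
    using assms unfolding integral_over_def by blast
  obtain s where s: "k = Suc s" using k(1) by (cases k) auto
  let ?T = "J \<cdot> ideal_pow R I s"
  have summand: "a i \<otimes> h [^] (k - i) \<in> ?T" if i: "i \<in> {1..k}" for i
  proof -
    obtain j where j: "i = Suc j" using i by (cases i) auto
    have "a i \<in> ideal_pow R J (Suc j)" using k(2) i unfolding j by blast
    then have "a i \<otimes> h [^] (k - i) \<in> (J \<cdot> ideal_pow R J j) \<cdot> ideal_pow R I (k - i)"
      using elt_pow_mem[OF ext_ideal ext_subset(2), of "k - i"] ideal_prod.prod by simp
    also have "\<dots> = J \<cdot> (ideal_pow R J j \<cdot> ideal_pow R I (k - i))"
      by (rule ideal_prod_assoc[OF J pow_ideal[OF J] pw])
    also have "\<dots> \<subseteq> J \<cdot> (ideal_pow R I j \<cdot> ideal_pow R I (k - i))"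
      by (intro ideal_prod_mono pow_mono ext_subset subset_refl)
    also have "\<dots> = ?T"
      using pow_add[OF ext_ideal, of j "k - i"] i j s by simp
    finally show ?thesis .
  qed
  have sum: "finsum R f A \<in> ?T" if "finite A" "\<And>i. i \<in> A \<Longrightarrow> f i \<in> ?T" for f and A :: "nat set"
    using that
  proof (induction A)
    case (insert i A)
    then have "\<And>j. j \<in> insert i A \<Longrightarrow> f j \<in> carrier R" using idealD(2)[OF JI, of _ s] by blast
    then have "f \<in> A \<rightarrow> carrier R" "f i \<in> carrier R" by auto
    then show ?case using insert idealD(3)[OF JI, of _ s] by simp
  qed (use idealD(1)[OF JI] in simp)
  define S where "S = finsum R (\<lambda>i. a i \<otimes> h [^] (k - i)) {1..k}"
  have S: "S \<in> ?T" unfolding S_def using summand by (intro sum) auto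
  have Sc: "S \<in> carrier R" using S idealD(2)[OF JI] by blast
  have "h [^] k \<oplus> S = \<zero>" using k(3) by (simp add: S_def)
  then have hS: "h [^] k = \<ominus> S" using minus_equality[of "h [^] k" S] Sc h by simp
  have hk: "h [^] Suc s \<in> ?T" unfolding s[symmetric] hS by (rule idealD(4)[OF JI S])
  have "ideal_pow R I (Suc s) \<subseteq> scale (h [^] Suc s) (carrier R) \<boxplus> ?T" by (rule pow_ext_subset)
  also have "\<dots> \<subseteq> ?T"
    using idealD(7)[OF JI hk] by (intro sum_least JI) auto
  finally have "ideal_pow R I (Suc s) \<subseteq> ?T" .
  moreover have "?T \<subseteq> ideal_pow R I (Suc s)" using ideal_prod_mono[OF ext_subset(1) subset_refl] by simp
  ultimately show ?thesis by blast
qed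

lemma pow_reduction:
  assumes "ideal_pow R I (Suc s) = J \<cdot> ideal_pow R I s"
  shows "ideal_pow R I (s + k) = ideal_pow R J k \<cdot> ideal_pow R I s"
proof (induction k)
  case 0
  show ?case
    using ideal_prod_one[OF pow_ideal[OF ext_ideal]] ideal_prod_commute[OF oneideal pow_ideal[OF ext_ideal]] by simp
next
  case (Suc k)
  note pw = pow_ideal[OF ext_ideal] and pj = pow_ideal[OF J]
  have "ideal_pow R I (s + Suc k) = I \<cdot> (ideal_pow R J k \<cdot> ideal_pow R I s)" using Suc by simp
  also have "\<dots> = ideal_pow R J k \<cdot> ideal_pow R I (Suc s)"
    using ideal_prod_assoc[OF ext_ideal pj pw, of k s] ideal_prod_assoc[OF pj ext_ideal pw, of k s]
      ideal_prod_commute[OF ext_ideal pj, of k] by simp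
  also have "\<dots> = ideal_pow R J (Suc k) \<cdot> ideal_pow R I s"
    using assms ideal_prod_assoc[OF pj J pw, of k s] ideal_prod_commute[OF J pj, of k] by simp
  finally show ?case .
qed

text \<open>\<open>filt i n\<close> is \<open>J\<^sup>n + h J\<^bsup>n-1\<^esup> + \<dots> + h\<^sup>i J\<^bsup>n-i\<^esup>\<close>, for \<open>i \<le> n\<close>.\<close>

primrec filt :: "nat \<Rightarrow> nat \<Rightarrow> 'a set" where
  "filt 0 n = ideal_pow R J n"
| "filt (Suc i) n = scale (h [^] Suc i) (ideal_pow R J (n - Suc i)) \<boxplus> filt i n"

lemma filt_ideal: "ideal (filt i n) R"
  by (induction i) (auto intro!: add_ideals scale_ideal pow_ideal J h simp del: nat_pow_Suc)

lemma filt_upper: "scale (h [^] i) (ideal_pow R J (n - i)) \<subseteq> filt i n"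
proof (cases i)
  case 0
  then show ?thesis using ideal_subset[OF pow_ideal[OF J]] by force
next
  case (Suc j)
  then show ?thesis using sum_upper1[OF scale_ideal[OF _ pow_ideal[OF J]] filt_ideal] h by simp
qed

lemma filt_Suc_subset: "filt i n \<subseteq> filt (Suc i) n"
  using sum_upper2[OF scale_ideal[OF _ pow_ideal[OF J]] filt_ideal] h by simp

lemma filt_h_mult: "i \<le> n \<Longrightarrow> x \<in> filt i n \<Longrightarrow> h \<otimes> x \<in> filt (Suc i) (Suc n)"
proof (induction i arbitrary: x)
  case 0
  then have "h \<otimes> x \<in> scale (h [^] Suc 0) (ideal_pow R J (Suc n - Suc 0))" using h by simp
  then show ?case using filt_upper[of "Suc 0" "Suc n"] by blast
next
  case (Suc i)
  then have "x \<in> scale (h [^] Suc i) (ideal_pow R J (n - Suc i)) \<boxplus> filt i n"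
    by (simp only: filt.simps)
  then obtain p w where pw: "p \<in> ideal_pow R J (n - Suc i)" "w \<in> filt i n" "x = h [^] Suc i \<otimes> p \<oplus> w"
    by (elim sum_memE imageE) metis
  have carr: "p \<in> carrier R" "w \<in> carrier R" "h [^] Suc i \<in> carrier R"
    using pw idealD(2) pow_ideal[OF J] filt_ideal h nat_pow_closed by blast+
  have eq: "h \<otimes> x = (h [^] Suc i \<otimes> h) \<otimes> p \<oplus> h \<otimes> w" unfolding pw(3) using carr h by algebra
  have "h [^] Suc (Suc i) \<otimes> p \<in> filt (Suc (Suc i)) (Suc n)"
    using filt_upper[of "Suc (Suc i)" "Suc n"] pw(1) by auto
  moreover have "h \<otimes> w \<in> filt (Suc (Suc i)) (Suc n)"
    using Suc.IH[OF _ pw(2)] Suc.prems filt_Suc_subset[of "Suc i" "Suc n"] by auto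
  ultimately have "h [^] Suc (Suc i) \<otimes> p \<oplus> h \<otimes> w \<in> filt (Suc (Suc i)) (Suc n)"
    by (rule idealD(3)[OF filt_ideal])
  then show ?case unfolding eq by (simp only: nat_pow_Suc)
qed

lemma filt_J_mult: "i \<le> n \<Longrightarrow> j \<in> J \<Longrightarrow> x \<in> filt i n \<Longrightarrow> j \<otimes> x \<in> filt i (Suc n)"
proof (induction i arbitrary: x)
  case 0
  then show ?case by (auto intro: ideal_prod.prod)
next
  case (Suc i)
  then have "x \<in> scale (h [^] Suc i) (ideal_pow R J (n - Suc i)) \<boxplus> filt i n"
    by (simp only: filt.simps)
  then obtain p w where pw: "p \<in> ideal_pow R J (n - Suc i)" "w \<in> filt i n" "x = h [^] Suc i \<otimes> p \<oplus> w"
    by (elim sum_memE imageE) metis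
  have carr: "p \<in> carrier R" "w \<in> carrier R" "h [^] Suc i \<in> carrier R" "j \<in> carrier R"
    using pw idealD(2) pow_ideal[OF J] filt_ideal h nat_pow_closed J Suc.prems by blast+
  have eq: "j \<otimes> x = h [^] Suc i \<otimes> (j \<otimes> p) \<oplus> j \<otimes> w" unfolding pw(3) using carr by algebra
  \<comment> \<open>This is where \<open>Suc i \<le> n\<close> enters: under truncated subtraction
    the exponent would otherwise stay \<open>0\<close> and not absorb the factor
    \<open>j\<close>.\<close>
  have "Suc n - Suc i = Suc (n - Suc i)" using Suc.prems by auto
  then have "j \<otimes> p \<in> ideal_pow R J (Suc n - Suc i)"
    using Suc.prems(2) pw(1) by (auto intro: ideal_prod.prod)
  then have "h [^] Suc i \<otimes> (j \<otimes> p) \<in> filt (Suc i) (Suc n)"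
    using filt_upper[of "Suc i" "Suc n"] by auto
  moreover have "j \<otimes> w \<in> filt (Suc i) (Suc n)"
    using Suc.IH[OF _ Suc.prems(2) pw(2)] Suc.prems filt_Suc_subset[of i "Suc n"] by auto
  ultimately show ?case unfolding eq by (rule idealD(3)[OF filt_ideal])
qed

lemma pow_subset_filt: "ideal_pow R I n \<subseteq> filt n n"
proof (induction n)
  case 0
  show ?case by simp
next
  case (Suc n)
  have "x \<otimes> y \<in> filt (Suc n) (Suc n)" if xy: "x \<in> I" "y \<in> filt n n" for x y
  proof -
    obtain r j where x: "r \<in> carrier R" "j \<in> J" "x = h \<otimes> r \<oplus> j"
      using xy(1) unfolding ext_eq by (elim sum_memE imageE) metis
    have carr: "j \<in> carrier R" "y \<in> carrier R"
      using idealD(2)[OF J x(2)] idealD(2)[OF filt_ideal xy(2)] by auto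
    have eq: "x \<otimes> y = r \<otimes> (h \<otimes> y) \<oplus> j \<otimes> y" unfolding x(3) using carr x(1) h by algebra
    have "r \<otimes> (h \<otimes> y) \<in> filt (Suc n) (Suc n)"
      using idealD(6)[OF filt_ideal filt_h_mult[OF le_refl xy(2)] x(1)] .
    moreover have "j \<otimes> y \<in> filt (Suc n) (Suc n)"
      using filt_J_mult[OF le_refl x(2) xy(2)] filt_Suc_subset by blast
    ultimately show ?thesis unfolding eq by (rule idealD(3)[OF filt_ideal])
  qed
  then have "I \<cdot> filt n n \<subseteq> filt (Suc n) (Suc n)" by (intro ideal_prod_least filt_ideal)
  then show ?case
    using ideal_prod_mono[OF subset_refl Suc, of I] unfolding ideal_pow.simps by (rule order_trans[rotated])
qed

lemma pow_J_filt_subset: "ideal_pow R J k \<cdot> filt s s \<subseteq> filt s (s + k)"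
proof (induction k)
  case 0
  show ?case
    using ideal_prod_commute[OF oneideal filt_ideal] ideal_prod_one[OF filt_ideal] by simp
next
  case (Suc k)
  have "ideal_pow R J (Suc k) \<cdot> filt s s = J \<cdot> (ideal_pow R J k \<cdot> filt s s)"
    using ideal_prod_assoc[OF J pow_ideal[OF J] filt_ideal] by simp
  also have "\<dots> \<subseteq> J \<cdot> filt s (s + k)" by (intro ideal_prod_mono Suc subset_refl)
  also have "\<dots> \<subseteq> filt s (s + Suc k)"
    using filt_J_mult[of s "s + k"] by (intro ideal_prod_least filt_ideal) simp
  finally show ?case .
qed

text \<open>From \<open>s\<close> on, the powers of \<open>I\<close> grow by factors from
  \<open>J\<close> only, and \<open>I^s\<close> involves no power of \<open>h\<close> beyond
  \<open>h^s\<close>. This gives \<open>s\<close> rather than \<open>n\<close> steps of the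
  filtration, whence the factor \<open>s\<close> in the inequality.\<close>

lemma pow_subset_filt_reduction:
  assumes "ideal_pow R I (Suc s) = J \<cdot> ideal_pow R I s" "s \<le> n"
  shows "ideal_pow R I n \<subseteq> filt s n"
proof -
  obtain k where k: "n = s + k" using assms(2) le_Suc_ex by blast
  have "ideal_pow R I n = ideal_pow R J k \<cdot> ideal_pow R I s"
    using pow_reduction[OF assms(1)] k by simp
  also have "\<dots> \<subseteq> ideal_pow R J k \<cdot> filt s s" by (intro ideal_prod_mono pow_subset_filt subset_refl)
  also have "\<dots> \<subseteq> filt s n" unfolding k by (rule pow_J_filt_subset)
  finally show ?thesis .
qed

text \<open>The step from \<open>filt i n\<close> to \<open>filt (Suc i) n\<close> is generated by \<open>h\<^bsup>i+1\<^esup>\<close> times generators of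
  \<open>J\<^bsup>n-i-1\<^esup>\<close>, and it is killed by \<open>J : I\<close>.\<close>

lemma len_filt_step:
  assumes "Suc i \<le> n" "finite S" "S \<subseteq> carrier R" "Idl S = ideal_pow R J (n - Suc i)"
    and fin: "fin_len (colon_ideal R J I) (carrier R)"
  shows "fin_len (filt i n) (filt (Suc i) n)"
    "len (filt i n) (filt (Suc i) n) \<le> card S * len (colon_ideal R J I) (carrier R)"
proof -
  let ?Q = "colon_ideal R J I" and ?B = "filt i n"
  have Q: "ideal ?Q R" by (intro colon_ideal_ideal J ideal_subset ext_ideal)
  define T where "T = scale (h [^] Suc i) S"
  have hc: "h [^] Suc i \<in> carrier R" using h by (rule nat_pow_closed)
  have T: "finite T" "T \<subseteq> carrier R" "card T \<le> card S"
    using assms hc by (auto simp: T_def card_image_le simp del: nat_pow_Suc)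
  have kill: "q \<otimes> t \<in> ?B" if q: "q \<in> ?Q" and t: "t \<in> T" for q t
  proof -
    obtain z where z: "z \<in> S" "t = h [^] Suc i \<otimes> z" using t by (auto simp: T_def)
    have zJ: "z \<in> ideal_pow R J (n - Suc i)" using genideal_self[OF assms(3)] z assms(4) by auto
    have carr: "q \<in> carrier R" "z \<in> carrier R" "h [^] i \<in> carrier R"
      using q z assms(3) h by (auto simp: colon_ideal_def)
    \<comment> \<open>One factor \<open>h\<close> is traded for an element of \<open>J\<close>: the
      exponent of \<open>h\<close> drops to \<open>i\<close> and that of \<open>J\<close> rises to
      \<open>n - i\<close>.\<close>
    have "q \<otimes> h \<in> J" using q ext_subset(2) by (auto simp: colon_ideal_def)
    then have "(q \<otimes> h) \<otimes> z \<in> ideal_pow R J (Suc (n - Suc i))" using zJ by (auto intro: ideal_prod.prod)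
    then have "(q \<otimes> h) \<otimes> z \<in> ideal_pow R J (n - i)" using assms(1) by (simp only: Suc_diff_le[symmetric] diff_Suc_Suc)
    then have "h [^] i \<otimes> ((q \<otimes> h) \<otimes> z) \<in> ?B" using filt_upper[of i n] by blast
    moreover have "h [^] i \<otimes> ((q \<otimes> h) \<otimes> z) = q \<otimes> ((h [^] i \<otimes> h) \<otimes> z)"
      using carr h by algebra
    ultimately show ?thesis using z by simp
  qed
  have gen: "fin_len ?B (Idl (?B \<union> T)) \<and> len ?B (Idl (?B \<union> T)) \<le> card T * len ?Q (carrier R)"
    by (rule len_generated_le[OF T(1,2) filt_ideal Q fin kill])
  have BT: "?B \<union> T \<subseteq> carrier R" using T ideal_subset[OF filt_ideal] by auto
  note E = genideal_ideal[OF BT]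
  have "scale (h [^] Suc i) (Idl S) \<subseteq> Idl T" unfolding T_def by (rule Idl_scale[OF hc assms(3)])
  also have "\<dots> \<subseteq> Idl (?B \<union> T)" by (rule Idl_mono[OF _ BT]) auto
  finally have sub: "filt (Suc i) n \<subseteq> Idl (?B \<union> T)"
    using assms(4) genideal_self[OF BT] unfolding filt.simps by (intro sum_least E) auto
  have sub': "Idl (?B \<union> T) \<subseteq> filt (Suc i) n"
  proof (rule genideal_minimal[OF filt_ideal])
    have "S \<subseteq> ideal_pow R J (n - Suc i)" using genideal_self[OF assms(3)] assms(4) by auto
    then have "T \<subseteq> filt (Suc i) n" using filt_upper[of "Suc i" n] by (auto simp: T_def)
    then show "?B \<union> T \<subseteq> filt (Suc i) n" using filt_Suc_subset by auto
  qed
  have eq: "filt (Suc i) n = Idl (?B \<union> T)" by (rule equalityI[OF sub sub'])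
  show "fin_len (filt i n) (filt (Suc i) n)" unfolding eq by (rule conjunct1[OF gen])
  show "len (filt i n) (filt (Suc i) n) \<le> card S * len ?Q (carrier R)"
    unfolding eq by (rule order_trans[OF conjunct2[OF gen] mult_le_mono1[OF T(3)]])
qed

end

end

context noetherian_local_ring
begin

section \<open>Hilbert-Samuel and fiber polynomials\<close>

text \<open>A prime over \<open>K\<close> contains the radical of \<open>K\<close>, which is
  \<open>m\<close>; so \<open>m\<close> is the only prime over \<open>K\<close>.\<close>

lemma m_primary_pow_subset:
  assumes "m_primary R m K"
  shows "ideal K R" "K \<subseteq> m" "\<exists>N. ideal_pow R m N \<subseteq> K"
proof -
  show K: "ideal K R" using assms by (simp add: m_primary_def)
  show "K \<subseteq> m" using assms by (intro proper_subset_m) (auto simp: m_primary_def)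
  have "P = m" if P: "primeideal P R" "K \<subseteq> P" for P
  proof -
    have "m \<subseteq> P"
    proof
      fix x assume "x \<in> m"
      then obtain n :: nat where "x \<in> carrier R" "x [^] n \<in> K" using assms by (auto simp: m_primary_def)
      then show "x \<in> P" using prime_pow_mem[OF P(1)] P(2) by blast
    qed
    then show ?thesis using prime_subset_m[OF P(1)] by auto
  qed
  then show "\<exists>N. ideal_pow R m N \<subseteq> K" using pow_subset_of_unique_prime[OF K] by metis
qed

lemma fin_len_pow:
  assumes "ideal K R" "ideal_pow R m N \<subseteq> K"
  shows "fin_len (ideal_pow R K n) (carrier R)"
  using fin_len_carrier[OF pow_ideal[OF assms(1)] pow_pow_subset[OF ideal_m assms]] .

text \<open>The first difference is the Hilbert function of the associated graded ring, moved by one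
  degree. The bound is the number of generators given, which may exceed \<open>d\<close>.\<close>

lemma evpoly_hilbert_samuel:
  assumes "set xs \<subseteq> carrier R" "\<And>n. fin_len (ideal_pow R (Idl (set xs)) n) (carrier R)"
  shows "evpoly (Suc (length xs)) (\<lambda>n. int (len (ideal_pow R (Idl (set xs)) (Suc n)) (carrier R)))"
proof -
  let ?K = "Idl (set xs)"
  let ?h = "\<lambda>n. int (len (ideal_pow R ?K (Suc n)) (ideal_pow R ?K n))"
  note K = genideal_ideal[OF assms(1)]
  note pw = pow_ideal[OF K]
  have "evpoly (length xs) ?h"
  proof (rule hilbert_function_evpoly[OF assms(1)])
    have "y \<otimes> c \<in> ideal_pow R ?K (Suc n)" if "y \<in> set xs" "c \<in> ideal_pow R ?K n" for y c n
      using that genideal_self[OF assms(1)] by (auto intro: ideal_prod.prod)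
    then show "graded_family xs (\<lambda>n. ideal_pow R ?K (Suc n))"
      unfolding graded_family_def using pw by blast
    show "ideal_pow R ?K (Suc n) \<subseteq> ideal_pow R ?K n" for n by (rule pow_Suc_subset[OF K])
    show "fin_len (ideal_pow R ?K (Suc n)) (ideal_pow R ?K n)" for n
      by (rule fin_len_sub(1)[OF assms(2) pw pw oneideal pow_Suc_subset[OF K] ideal_subset[OF pw]])
  qed
  then have "evpoly (length xs) (\<lambda>n. ?h (Suc n))" by (subst evpoly_shift)
  moreover have "int (len (ideal_pow R ?K (Suc (Suc n))) (carrier R)) - int (len (ideal_pow R ?K (Suc n)) (carrier R))
      = ?h (Suc n)" for n
    using len_add(1)[OF pw pw oneideal pow_Suc_subset[OF K] ideal_subset[OF pw]
        fin_len_sub(1)[OF assms(2) pw pw oneideal pow_Suc_subset[OF K] ideal_subset[OF pw]] assms(2), of "Suc n"]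
    by simp
  ultimately show ?thesis by (simp del: ideal_pow.simps)
qed

text \<open>Generators of \<open>K\<close> give some polynomial, and the parameter ideal
  \<open>q\<close> limits its degree: \<open>q^M \<subseteq> K\<close> yields
  \<open>\<lambda>(R/K^(n+1)) \<le> \<lambda>(R/q^(M(n+1)))\<close>, which is \<open>O(n^d)\<close>
  as \<open>q\<close> has \<open>d\<close> generators.\<close>

lemma hilbert_samuel_poly:
  assumes "krull_dim_eq R d" "ideal K R" "ideal_pow R m N \<subseteq> K"
  shows "binomial_poly (Suc d) (\<lambda>n. int (len (ideal_pow R K (Suc n)) (carrier R)))"
proof -
  obtain ys N' where ys: "length ys = d" "set ys \<subseteq> m" "ideal_pow R m N' \<subseteq> Idl (set ys)"
    using parameter_ideal[OF assms(1)] by blast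
  have ysc: "set ys \<subseteq> carrier R" using ys(2) ideal_subset[OF ideal_m] by auto
  let ?q = "Idl (set ys)"
  note q = genideal_ideal[OF ysc]
  note pq = pow_ideal[OF q] and pK = pow_ideal[OF assms(2)]
  \<comment> \<open>One more than \<open>N\<close>, so that \<open>M > 0\<close> and
    \<open>M * Suc n\<close> has a predecessor \<open>k\<close>; the function of \<open>q\<close> is
    indexed by \<open>Suc k\<close>.\<close>
  define M where "M = Suc N"
  have "ideal_pow R ?q M \<subseteq> ideal_pow R m M"
    by (rule pow_mono[OF genideal_minimal[OF ideal_m ys(2)]])
  also have "\<dots> \<subseteq> ideal_pow R m N" by (rule pow_antimono[OF ideal_m]) (simp add: M_def)
  also have "\<dots> \<subseteq> K" by fact
  finally have qM: "ideal_pow R ?q M \<subseteq> K" .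
  have "evpoly (Suc d) (\<lambda>n. int (len (ideal_pow R ?q (Suc n)) (carrier R)))"
    using evpoly_hilbert_samuel[OF ysc fin_len_pow[OF q ys(3)]] ys(1) by simp
  then obtain C where C: "C \<ge> 0"
    "\<forall>\<^sub>F n in sequentially. \<bar>real_of_int (int (len (ideal_pow R ?q (Suc n)) (carrier R)))\<bar> \<le> C * real n ^ d"
    using binomial_poly_bound[OF evpoly_imp_binomial_poly] by blast
  then obtain n0 where n0: "\<And>n. n \<ge> n0 \<Longrightarrow> real (len (ideal_pow R ?q (Suc n)) (carrier R)) \<le> C * real n ^ d"
    by (auto simp: eventually_sequentially)
  have "\<forall>\<^sub>F n in sequentially. \<bar>real_of_int (int (len (ideal_pow R K (Suc n)) (carrier R)))\<bar> \<le> (C * (2 * real M) ^ d) * real n ^ d"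
    using eventually_ge_at_top[of "Suc n0"]
  proof eventually_elim
    case (elim n)
    define k where "k = M * Suc n - 1"
    have k: "Suc k = M * Suc n" by (simp add: k_def M_def)
    have kn: "k \<ge> n0" "real k \<le> 2 * real M * real n"
    proof -
      have "M * Suc n \<ge> Suc n" by (simp add: M_def)
      then show "k \<ge> n0" using elim k by linarith
      \<comment> \<open>The factor \<open>2\<close> comes from \<open>Suc n \<le> 2 * n\<close>,
        valid as \<open>n \<ge> 1\<close>.\<close>
      have "Suc k \<le> M * (2 * n)" unfolding k by (rule mult_le_mono2) (use elim in simp)
      then have "k \<le> 2 * M * n" by simp
      then have "real k \<le> real (2 * M * n)" by (rule of_nat_mono)
      then show "real k \<le> 2 * real M * real n" by simp
    qed
    have "len (ideal_pow R K (Suc n)) (carrier R) \<le> len (ideal_pow R ?q (Suc k)) (carrier R)"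
      unfolding k
      by (rule len_mono_left[OF pq pK oneideal pow_pow_subset[OF q assms(2) qM] ideal_subset[OF pK] fin_len_pow[OF q ys(3)]])
    then have "real (len (ideal_pow R K (Suc n)) (carrier R)) \<le> C * real k ^ d"
      using n0[OF kn(1)] by linarith
    also have "\<dots> \<le> C * (2 * real M * real n) ^ d"
      using kn(2) C(1) by (intro mult_left_mono power_mono) auto
    finally show ?case by (simp add: power_mult_distrib mult.assoc)
  qed
  moreover have "\<exists>r. binomial_poly r (\<lambda>n. int (len (ideal_pow R K (Suc n)) (carrier R)))"
  proof -
    obtain A where A: "A \<subseteq> carrier R" "finite A" "K = Idl A" using finetely_gen[OF assms(2)] by auto
    then obtain xs where "set xs = A" using finite_list by blast
    then show ?thesis
      using evpoly_hilbert_samuel[of xs] fin_len_pow[OF assms(2,3)] A evpoly_imp_binomial_poly by blast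
  qed
  ultimately show ?thesis using binomial_poly_reduce by blast
qed

section \<open>Numbers of generators and the special fiber\<close>

lemma generating_set_le_len:
  assumes "ideal A R" "ideal K R" "A \<subseteq> K" "fin_len A K"
  shows "\<exists>S. finite S \<and> S \<subseteq> K \<and> card S \<le> len A K \<and> Idl (A \<union> S) = K"
  using assms
proof (induction "len A K" arbitrary: A rule: less_induct)
  case (less A)
  show ?case
  proof (cases "A = K")
    case True
    then show ?thesis using Idl_ideal[OF assms(2)] by (intro exI[of _ "{}"]) auto
  next
    case False
    then obtain s where s: "s \<in> K" "s \<notin> A" using less.prems by auto
    have sA: "insert s A \<subseteq> carrier R" using s less.prems ideal_subset[OF assms(2)] by auto
    let ?A = "Idl (insert s A)"
    have A: "ideal ?A R" "A \<subset> ?A" "?A \<subseteq> K"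
      using genideal_ideal[OF sA] genideal_self[OF sA] s genideal_minimal[OF assms(2), of "insert s A"] less.prems
      by auto
    then have AA: "A \<subseteq> ?A" by auto
    note fin = fin_len_sub[OF less.prems(4,1) A(1) assms(2) AA A(3)]
    \<comment> \<open>Every chosen generator enlarges the ideal strictly and so uses up at least one
      unit of the length.\<close>
    have "1 \<le> len A ?A" by (rule chain_le_len[OF fin(1) chain_1[OF less.prems(1) A(1,2)]])
    then have lt: "Suc (len ?A K) \<le> len A K"
      using len_add(1)[OF less.prems(1) A(1) assms(2) AA A(3) fin] by simp
    then obtain S where S: "finite S" "S \<subseteq> K" "card S \<le> len ?A K" "Idl (?A \<union> S) = K"
      using less.hyps[OF _ A(1) assms(2) A(3) fin(2)] by auto
    have sub: "A \<union> insert s S \<subseteq> carrier R" using S s less.prems ideal_subset[OF assms(2)] by auto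
    note E = genideal_ideal[OF sub]
    have "?A \<subseteq> Idl (A \<union> insert s S)"
      using genideal_self[OF sub] by (intro genideal_minimal E) auto
    then have "Idl (?A \<union> S) \<subseteq> Idl (A \<union> insert s S)"
      using genideal_self[OF sub] by (intro genideal_minimal E) auto
    moreover have "Idl (A \<union> insert s S) \<subseteq> K"
      using S s less.prems by (intro genideal_minimal assms(2)) auto
    ultimately have "Idl (A \<union> insert s S) = K" using S by auto
    moreover have "card (insert s S) \<le> len A K"
      using card_insert_le_m1[of "Suc (card S)" S s] S(3) lt by (simp add: card_insert_if S(1))
    ultimately show ?thesis using S s by (intro exI[of _ "insert s S"]) auto
  qed
qed

text \<open>Generators of \<open>K\<close> modulo \<open>m K\<close> can be chosen at most
  \<open>\<lambda>(K/mK)\<close> in number, and Nakayama makes them generate \<open>K\<close>.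
  Conversely each generator adds at most \<open>\<lambda>(R/m) \<le> 1\<close> to the length, since
  \<open>m\<close> kills \<open>K/mK\<close>.\<close>

lemma mingens_eq_len:
  assumes "ideal K R" "fin_len (m \<cdot> K) K"
  shows "mingens R K = len (m \<cdot> K) K"
    "\<exists>S. S \<subseteq> carrier R \<and> finite S \<and> card S = mingens R K \<and> Idl S = K"
proof -
  note mK = ideal_prod_is_ideal[OF ideal_m assms(1)]
  have mKK: "m \<cdot> K \<subseteq> K" using ideal_prod_inter[OF ideal_m assms(1)] by auto
  obtain S where S: "finite S" "S \<subseteq> K" "card S \<le> len (m \<cdot> K) K" "Idl (m \<cdot> K \<union> S) = K"
    using generating_set_le_len[OF mK assms(1) mKK assms(2)] by blast
  have Sc: "S \<subseteq> carrier R" using S ideal_subset[OF assms(1)] by auto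
  note NS = genideal_ideal[OF Sc]
  have sub: "Idl S \<union> m \<cdot> K \<subseteq> carrier R" using ideal_subset[OF NS] ideal_subset[OF mK] by auto
  have "K = Idl S"
  proof (rule nakayama[OF NS assms(1)])
    show "Idl S \<subseteq> K" by (rule genideal_minimal[OF assms(1) S(2)])
    have "m \<cdot> K \<union> S \<subseteq> Idl S \<union> m \<cdot> K" using genideal_self[OF Sc] by auto
    then show "K \<subseteq> Idl (Idl S \<union> m \<cdot> K)" using Idl_mono[OF _ sub] S(4) by blast
  qed
  then have ex: "S \<subseteq> carrier R \<and> finite S \<and> card S = card S \<and> Idl S = K" using S Sc by auto
  then have 1: "mingens R K \<le> card S" unfolding mingens_def by (intro Least_le) blast
  show ex': "\<exists>S. S \<subseteq> carrier R \<and> finite S \<and> card S = mingens R K \<and> Idl S = K"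
    unfolding mingens_def by (rule LeastI_ex) (use ex in blast)
  then obtain T where T: "T \<subseteq> carrier R" "finite T" "card T = mingens R K" "Idl T = K" by blast
  have TK: "T \<subseteq> K" using genideal_self[OF T(1)] T(4) by auto
  have "K = Idl (m \<cdot> K \<union> T)"
  proof
    show "Idl (m \<cdot> K \<union> T) \<subseteq> K" using mKK TK by (intro genideal_minimal assms(1)) auto
    show "K \<subseteq> Idl (m \<cdot> K \<union> T)"
      using Idl_mono[of T "m \<cdot> K \<union> T"] T ideal_subset[OF mK] by auto
  qed
  then have "len (m \<cdot> K) K = len (m \<cdot> K) (Idl (m \<cdot> K \<union> T))" by simp
  also have "\<dots> \<le> card T * len m (carrier R)"
    by (rule len_generated_le[OF T(2,1) mK ideal_m fin_len_m(1), THEN conjunct2])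
      (use TK in \<open>auto intro: ideal_prod.prod\<close>)
  also have "\<dots> \<le> card T * 1" by (rule mult_le_mono2[OF fin_len_m(2)])
  finally have "len (m \<cdot> K) K \<le> mingens R K" using T(3) by simp
  then show "mingens R K = len (m \<cdot> K) K" using 1 S(3) by linarith
qed

text \<open>\<open>J \<subseteq> m\<close> places \<open>m J^n\<close> between
  \<open>J^(n+1)\<close> and \<open>J^n\<close>, so the special fiber is bounded by the associated
  graded ring.\<close>

lemma fin_len_m_pow:
  assumes "ideal J R" "J \<subseteq> m" "ideal_pow R m N \<subseteq> J"
  shows "fin_len (m \<cdot> ideal_pow R J n) (ideal_pow R J n)"
    "len (m \<cdot> ideal_pow R J n) (ideal_pow R J n) \<le> len (ideal_pow R J (Suc n)) (ideal_pow R J n)"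
proof -
  note pJ = pow_ideal[OF assms(1)] and mJ = ideal_prod_is_ideal[OF ideal_m pow_ideal[OF assms(1)]]
  have sub: "ideal_pow R J (Suc n) \<subseteq> m \<cdot> ideal_pow R J n"
    using ideal_prod_mono[OF assms(2) subset_refl] by simp
  have sub': "m \<cdot> ideal_pow R J n \<subseteq> ideal_pow R J n" using ideal_prod_inter[OF ideal_m pJ] by auto
  have fin: "fin_len (ideal_pow R J (Suc n)) (ideal_pow R J n)"
    by (rule fin_len_sub(1)[OF fin_len_pow[OF assms(1,3)] pJ pJ oneideal pow_Suc_subset[OF assms(1)] ideal_subset[OF pJ]])
  show "fin_len (m \<cdot> ideal_pow R J n) (ideal_pow R J n)"
    by (rule fin_len_sub(2)[OF fin pJ mJ pJ sub sub'])
  show "len (m \<cdot> ideal_pow R J n) (ideal_pow R J n) \<le> len (ideal_pow R J (Suc n)) (ideal_pow R J n)"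
    by (rule len_mono_left[OF pJ mJ pJ sub sub' fin])
qed

text \<open>Hilbert-Serre for the special fiber yields a polynomial. Its degree is below
  \<open>d\<close> because \<open>\<nu>(J^n) \<le> \<lambda>(J^n/J^(n+1))\<close>, a first
  difference of the Hilbert-Samuel function of \<open>J\<close>.\<close>

lemma fiber_poly:
  assumes "krull_dim_eq R d" "d \<ge> 1" "ideal J R" "J \<subseteq> m" "ideal_pow R m N \<subseteq> J"
  shows "binomial_poly d (\<lambda>n. int (mingens R (ideal_pow R J n)))"
proof -
  note pJ = pow_ideal[OF assms(3)]
  note fin = fin_len_m_pow(1)[OF assms(3-5)]
  have ming: "mingens R (ideal_pow R J n) = len (m \<cdot> ideal_pow R J n) (ideal_pow R J n)" for n
    by (rule mingens_eq_len(1)[OF pJ fin])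
  obtain D where d: "d = Suc D" using assms(2) by (cases d) auto
  let ?f = "\<lambda>n. int (len (ideal_pow R J (Suc n)) (carrier R))"
  have "binomial_poly d (\<lambda>n. ?f n - ?f (n - 1))"
    by (rule binomial_poly_difference[OF hilbert_samuel_poly[OF assms(1,3,5)]])
  then obtain C where C: "\<forall>\<^sub>F n in sequentially. \<bar>real_of_int (?f n - ?f (n - 1))\<bar> \<le> C * real n ^ D"
    using binomial_poly_bound d by blast
  have bound: "\<forall>\<^sub>F n in sequentially. \<bar>real_of_int (int (mingens R (ideal_pow R J n)))\<bar> \<le> C * real n ^ D"
    using C eventually_gt_at_top[of 0]
  proof eventually_elim
    case (elim n)
    have "len (ideal_pow R J (Suc n)) (carrier R) =
        len (ideal_pow R J (Suc n)) (ideal_pow R J n) + len (ideal_pow R J n) (carrier R)"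
      by (rule len_add(1)[OF pJ pJ oneideal pow_Suc_subset[OF assms(3)] ideal_subset[OF pJ]
            fin_len_sub(1)[OF fin_len_pow[OF assms(3,5)] pJ pJ oneideal pow_Suc_subset[OF assms(3)] ideal_subset[OF pJ]]
            fin_len_pow[OF assms(3,5)]])
    then have "int (mingens R (ideal_pow R J n)) \<le> ?f n - ?f (n - 1)"
      using fin_len_m_pow(2)[OF assms(3-5), of n] elim(2) by (simp add: ming del: ideal_pow.simps)
    then have "real_of_int (int (mingens R (ideal_pow R J n))) \<le> real_of_int (?f n - ?f (n - 1))"
      by (simp only: of_int_le_iff)
    then show ?case using elim(1) by linarith
  qed
  have "\<exists>r. binomial_poly r (\<lambda>n. int (mingens R (ideal_pow R J n)))"
  proof -
    obtain A where A: "A \<subseteq> carrier R" "finite A" "J = Idl A" using finetely_gen[OF assms(3)] by auto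
    then obtain xs where xs: "set xs = A" using finite_list by blast
    have JA: "Idl (set xs) = J" using A xs by simp
    have xsc: "set xs \<subseteq> carrier R" using A xs by simp
    have "evpoly (length xs) (\<lambda>n. int (len (m \<cdot> ideal_pow R J n) (ideal_pow R (Idl (set xs)) n)))"
    proof (rule hilbert_function_evpoly[OF xsc])
      have "m \<cdot> ideal_pow R J n \<subseteq> colon_ideal R (m \<cdot> ideal_pow R J (Suc n)) {y}" if y: "y \<in> set xs" for y n
      proof (rule ideal_prod_least)
        have yc: "y \<in> carrier R" "y \<in> J" using y xsc genideal_self[OF xsc] JA by auto
        show "ideal (colon_ideal R (m \<cdot> ideal_pow R J (Suc n)) {y}) R"
          using yc by (intro colon_ideal_ideal ideal_prod_is_ideal ideal_m pJ) auto
        fix a b assume ab: "a \<in> m" "b \<in> ideal_pow R J n"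
        have "y \<otimes> b \<in> ideal_pow R J (Suc n)" using yc ab by (auto intro: ideal_prod.prod)
        then have "a \<otimes> (y \<otimes> b) \<in> m \<cdot> ideal_pow R J (Suc n)" using ab(1) by (intro ideal_prod.prod)
        then show "a \<otimes> b \<in> colon_ideal R (m \<cdot> ideal_pow R J (Suc n)) {y}"
          using yc idealD(2)[OF ideal_m ab(1)] idealD(2)[OF pJ ab(2)]
          by (simp add: colon_ideal_def m_assoc m_comm[of b y])
      qed
      then have "c \<otimes> y \<in> m \<cdot> ideal_pow R J (Suc n)" if "y \<in> set xs" "c \<in> m \<cdot> ideal_pow R J n" for y c n
        using that by (auto simp: colon_ideal_def)
      moreover have "y \<otimes> c = c \<otimes> y" if "y \<in> set xs" "c \<in> m \<cdot> ideal_pow R J n" for y c n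
        using that xsc idealD(2)[OF ideal_prod_is_ideal[OF ideal_m pJ]] by (intro m_comm) auto
      ultimately show "graded_family xs (\<lambda>n. m \<cdot> ideal_pow R J n)"
        unfolding graded_family_def using ideal_prod_is_ideal[OF ideal_m pJ] by metis
      show "m \<cdot> ideal_pow R J n \<subseteq> ideal_pow R (Idl (set xs)) n" for n
        unfolding JA using ideal_prod_inter[OF ideal_m pJ] by auto
      show "fin_len (m \<cdot> ideal_pow R J n) (ideal_pow R (Idl (set xs)) n)" for n
        unfolding JA by (rule fin)
    qed
    then show ?thesis using evpoly_imp_binomial_poly unfolding ming JA by blast
  qed
  then show ?thesis using binomial_poly_reduce[OF _ bound] d by blast
qed

section \<open>The length of \<open>I^n/J^n\<close> and the inequality\<close>

lemma len_pow_ext_le: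
  assumes "ideal J R" "h \<in> carrier R" "J \<subseteq> m" "ideal_pow R m N \<subseteq> J"
    and "ideal_pow R (Idl (J \<union> {h})) (Suc s) = J \<cdot> ideal_pow R (Idl (J \<union> {h})) s" "s \<le> n"
  shows "len (ideal_pow R J n) (carrier R) \<le> len (ideal_pow R (Idl (J \<union> {h})) n) (carrier R) +
     len (colon_ideal R J (Idl (J \<union> {h}))) (carrier R) * (\<Sum>j\<in>{1..s}. mingens R (ideal_pow R J (n - j)))"
proof -
  let ?I = "Idl (J \<union> {h})"
  let ?Q = "colon_ideal R J ?I"
  note I = ext_ideal[OF assms(1,2)] and JI = ext_subset(1)[OF assms(1,2)]
  note pJ = pow_ideal[OF assms(1)] and pI = pow_ideal[OF I]
  note filt = filt_ideal[OF assms(1,2)]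
  have Q: "ideal ?Q R" by (intro colon_ideal_ideal assms(1) ideal_subset I)
  have JQ: "J \<subseteq> ?Q"
    using idealD(2)[OF assms(1)] idealD(7)[OF assms(1)] idealD(2)[OF I] by (auto simp: colon_ideal_def)
  \<comment> \<open>\<open>J : I\<close> contains \<open>J\<close> and with it a power of
    \<open>m\<close>.\<close>
  have finQ: "fin_len ?Q (carrier R)"
    using fin_len_carrier[OF Q order_trans[OF assms(4) JQ]] .
  have main: "fin_len (ideal_pow R J n) (filt J h i n) \<and>
      len (ideal_pow R J n) (filt J h i n) \<le> len ?Q (carrier R) * (\<Sum>j\<in>{1..i}. mingens R (ideal_pow R J (n - j))) \<and>
      ideal_pow R J n \<subseteq> filt J h i n" if "i \<le> n" for i
    using that
  proof (induction i)
    case 0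
    then show ?case using len_self[OF pJ] by (simp add: filt.simps[OF assms(1,2)])
  next
    case (Suc i)
    then have IH: "fin_len (ideal_pow R J n) (filt J h i n)"
      "len (ideal_pow R J n) (filt J h i n) \<le> len ?Q (carrier R) * (\<Sum>j\<in>{1..i}. mingens R (ideal_pow R J (n - j)))"
      "ideal_pow R J n \<subseteq> filt J h i n" by auto
    obtain S where S: "S \<subseteq> carrier R" "finite S" "card S = mingens R (ideal_pow R J (n - Suc i))"
        "Idl S = ideal_pow R J (n - Suc i)"
      using mingens_eq_len(2)[OF pJ fin_len_m_pow(1)[OF assms(1,3,4)]] by blast
    note step = len_filt_step[OF assms(1,2) Suc.prems S(2,1,4) finQ]
    note up = filt_Suc_subset[OF assms(1,2), of i n]
    note add = len_add[OF pJ filt filt IH(3) up IH(1) step(1)]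
    have "len (ideal_pow R J n) (filt J h (Suc i) n) \<le>
        len ?Q (carrier R) * (\<Sum>j\<in>{1..i}. mingens R (ideal_pow R J (n - j))) +
        mingens R (ideal_pow R J (n - Suc i)) * len ?Q (carrier R)"
      using add(1) IH(2) step(2) S(3) by simp
    also have "\<dots> = len ?Q (carrier R) * (\<Sum>j\<in>{1..Suc i}. mingens R (ideal_pow R J (n - j)))"
      by (simp add: algebra_simps)
    finally show ?case using add(2) IH(3) up by blast
  qed
  have sub: "ideal_pow R J n \<subseteq> ideal_pow R ?I n" by (rule pow_mono[OF JI])
  have sub': "ideal_pow R ?I n \<subseteq> filt J h s n"
    by (rule pow_subset_filt_reduction[OF assms(1,2,5,6)])
  note ms = main[OF assms(6)]
  note fs = fin_len_sub[OF ms[THEN conjunct1] pJ pI filt sub sub']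
  have "len (ideal_pow R J n) (ideal_pow R ?I n) \<le> len (ideal_pow R J n) (filt J h s n)"
    using len_add(1)[OF pJ pI filt sub sub' fs] by simp
  also have "\<dots> \<le> len ?Q (carrier R) * (\<Sum>j\<in>{1..s}. mingens R (ideal_pow R J (n - j)))"
    using ms by blast
  finally show ?thesis
    using len_add(1)[OF pJ pI oneideal sub ideal_subset[OF pI] fs(1)
        fin_len_pow[OF I order_trans[OF assms(4) JI]]] by simp
qed

end

theorem theorem2p3:
  fixes R :: "('a, 'b) ring_scheme" and m J :: "'a set" and h :: 'a and d :: nat
  assumes "local_noetherian R m"
    and "krull_dim_eq R d" and "d \<ge> 1"
    and "m_primary R m J"
    and "h \<in> carrier R" and "integral_over R J h"
  shows "hilbert_coeff R d (genideal R (J \<union> {h})) 1 - hilbert_coeff R d J 1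
     \<le> int (red_num R J (genideal R (J \<union> {h})))
       * int (colength R (colon_ideal R J (genideal R (J \<union> {h})))) * fiber_mult R d J"
proof -
  interpret noetherian_local_ring R m
  proof (intro noetherian_local_ring.intro noetherian_cring.intro noetherian_local_ring_axioms.intro)
    show "cring R" "noetherian_ring R" using assms(1) by (simp_all add: local_noetherian_def)
    show "maximalideal m R" using assms(1) by (simp add: local_noetherian_def)
    show "M = m" if "maximalideal M R" for M using assms(1) that by (simp add: local_noetherian_def)
  qed
  define I where "I = genideal R (J \<union> {h})"
  obtain N where J: "ideal J R" "J \<subseteq> m" "ideal_pow R m N \<subseteq> J"
    using m_primary_pow_subset[OF assms(4)] by blast
  have I: "ideal I R" "J \<subseteq> I"
    unfolding I_def by (rule ext_ideal[OF J(1) assms(5)], rule ext_subset(1)[OF J(1) assms(5)])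
  have NI: "ideal_pow R m N \<subseteq> I" using J(3) I(2) by (rule order_trans)
  define s where "s = red_num R J I"
  \<comment> \<open>The \<open>LEAST\<close> in \<open>red_num\<close> is attained because the
    integral equation of \<open>h\<close> supplies an exponent.\<close>
  have s: "ideal_pow R I (Suc s) = ideal_prod R J (ideal_pow R I s)"
    unfolding s_def red_num_def I_def by (rule LeastI_ex[OF integral_reduction[OF J(1) assms(5,6)]])
  have poly: "binomial_poly (Suc d) (\<lambda>n. int (colength R (ideal_pow R K (Suc n))))"
    if "ideal K R" "ideal_pow R m N \<subseteq> K" for K
    unfolding colength_eq_len by (rule hilbert_samuel_poly[OF assms(2) that])
  have fiber: "(\<lambda>n. real (mingens R (ideal_pow R J n)) / real n ^ (d - 1)) \<longlonglongrightarrow>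
      real_of_int (fiber_mult R d J) / fact (d - 1)"
    by (rule tendsto_fiber_mult[OF fiber_poly[OF assms(2,3) J] assms(3)])
  \<comment> \<open>Hilbert coefficients are indexed by the powers \<open>K^(n+1)\<close>, so the
    length bound is taken at \<open>Suc n\<close>; this is the origin of
    \<open>Suc n - j\<close>.\<close>
  have bounds: "\<forall>\<^sub>F n in sequentially.
      0 \<le> int (colength R (ideal_pow R J (Suc n))) - int (colength R (ideal_pow R I (Suc n))) \<and>
      int (colength R (ideal_pow R J (Suc n))) - int (colength R (ideal_pow R I (Suc n))) \<le>
      int (colength R (colon_ideal R J I)) * (\<Sum>j\<in>{1..s}. int (mingens R (ideal_pow R J (Suc n - j))))"
    using eventually_ge_at_top[of s]
  proof eventually_elim
    case (elim n)
    have "colength R (ideal_pow R I (Suc n)) \<le> colength R (ideal_pow R J (Suc n))"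
      unfolding colength_eq_len
      by (rule len_mono_left[OF pow_ideal[OF J(1)] pow_ideal[OF I(1)] oneideal pow_mono[OF I(2)]
            ideal_subset[OF pow_ideal[OF I(1)]] fin_len_pow[OF J(1,3)]])
    moreover have "colength R (ideal_pow R J (Suc n)) \<le> colength R (ideal_pow R I (Suc n)) +
        colength R (colon_ideal R J I) * (\<Sum>j\<in>{1..s}. mingens R (ideal_pow R J (Suc n - j)))"
      unfolding colength_eq_len I_def
      by (rule len_pow_ext_le[OF J(1) assms(5) J(2,3) s[unfolded I_def]]) (use elim in simp)
    then have "int (colength R (ideal_pow R J (Suc n))) \<le> int (colength R (ideal_pow R I (Suc n)) +
        colength R (colon_ideal R J I) * (\<Sum>j\<in>{1..s}. mingens R (ideal_pow R J (Suc n - j))))"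
      by (simp only: of_nat_le_iff)
    ultimately show ?case by (simp only: of_nat_add of_nat_mult of_nat_sum) linarith
  qed
  \<comment> \<open>The smaller ideal has the larger colength, so \<open>J\<close> plays the part of
    \<open>F\<close> and \<open>I\<close> that of \<open>G\<close>; the sign of \<open>e_1\<close>
    then gives the difference in the order claimed.\<close>
  have "hilbert_coeff R d I 1 - hilbert_coeff R d J 1 \<le>
      int s * int (colength R (colon_ideal R J I)) * fiber_mult R d J"
    by (rule second_coeff_diff_le[OF hilbert_coeff_spec[OF poly[OF J(1,3)]]
          hilbert_coeff_spec[OF poly[OF I(1) NI]] assms(3) fiber bounds])
  then show ?thesis unfolding s_def I_def .
qed

end
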